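(* Let $d\in\{1,2\}$. There exists a fundamental solution $E$ of the logarithmic Laplacian on $\mathbb R^d$, i.e. $\log(-\Delta)E=\delta_0$ in $\mathcal Z'(\mathbb R^d)$, which can be identified on $\{|x|\ge 2\}$ with a radial locally integrable function satisfying, for some constant $C>0$, $$|E(x)|\le C\,|x|^{-\frac{d-1}{2}}\qquad\text{for }|x|\ge 2.$$
   Context: Fourier transform: $\mathcal F(f)(\xi)=\hat f(\xi)=\int_{\mathbb R^d}e^{-ix\cdot\xi}f(x)\,dx$ on the Schwartz space $\mathcal S(\mathbb R^d)$, extended to tempered distributions $\mathcal S'(\mathbb R^d)$ by duality. Lizorkin space: $\mathcal Z(\mathbb R^d)=\{\varphi\in\mathcal S(\mathbb R^d):\int_{\mathbb R^d}x^\alpha\varphi(x)\,dx=0\text{ for all }\alpha\in\mathbb N_0^d\}$, with the topology induced by $\mathcal S(\mathbb R^d)$; equivalently $\varphi\in\mathcal S(\mathbb R^d)$ with $\partial^\alpha\hat\varphi(0)=0$ for all $\alpha$. $\mathcal Z'(\mathbb R^d)$ is the space of continuous linear functionals on $\mathcal Z(\mathbb R^d)$. It is identified with $\mathcal S'(\mathbb R^d)/\mathcal P(\mathbb R^d)$, where $\mathcal P(\mathbb R^d)$ is the space of polynomials: each element of $\mathcal Z'(\mathbb R^d)$ is the restriction to $\mathcal Z(\mathbb R^d)$ of some tempered distribution (a representative), unique up to adding a polynomial. Logarithmic Laplacian: for $\varphi\in\mathcal Z(\mathbb R^d)$, $\log(-\Delta)\varphi\in\mathcal Z(\mathbb R^d)$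 is the function with $\mathcal F(\log(-\Delta)\varphi)(\xi)=2\log(|\xi|)\hat\varphi(\xi)$ for $\xi\neq 0$. For $u\in\mathcal Z'(\mathbb R^d)$, $\log(-\Delta)u\in\mathcal Z'(\mathbb R^d)$ is defined by $\langle\log(-\Delta)u,\varphi\rangle=\langle u,\log(-\Delta)\varphi\rangle$ for all $\varphi\in\mathcal Z(\mathbb R^d)$. Thus $\log(-\Delta)E=\delta_0$ in $\mathcal Z'(\mathbb R^d)$ means $\langle E,\log(-\Delta)\varphi\rangle=\varphi(0)$ for all $\varphi\in\mathcal Z(\mathbb R^d)$. Convention: a fundamental solution in $\mathcal Z'(\mathbb R^d)$ is identified with its unique representative $E\in\mathcal S'(\mathbb R^d)$ such that $\hat E$ coincides with a locally integrable function in some sufficiently small neighbourhood of $0$. The identification with a function on $\{|x|\ge2\}$ refers to this tempered distribution $E$: there is a (complex-valued) locally integrable function on $\{|x|\ge2\}$, again denoted $E(x)$, with $\langle E,\varphi\rangle=\int_{|x|\ge 2}E(x)\varphi(x)\,dx$ for all smooth compactly supported $\varphi$ with support in $\{|x|\ge 2\}$. Radial means depending only on $|x|$. *)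

theory Defs
  imports "HOL-Analysis.Analysis"
begin

text \<open>
  A list of basis vectors plays the role of a multi-index for derivatives:
  \<open>[b\<^sub>1, \<dots>, b\<^sub>m]\<close> stands for the iterated partial derivative in these directions,
  the rightmost one being applied first.
\<close>

fun partial_deriv :: "'a list \<Rightarrow> ('a::euclidean_space \<Rightarrow> complex) \<Rightarrow> 'a \<Rightarrow> complex" where
  "partial_deriv [] f = f"
| "partial_deriv (b # bs) f = (\<lambda>x. frechet_derivative (partial_deriv bs f) (at x) b)"

definition smooth :: "('a::euclidean_space \<Rightarrow> complex) \<Rightarrow> bool" where
  "smooth f \<longleftrightarrow> (\<forall>bs \<in> lists Basis. \<forall>x. partial_deriv bs f differentiable (at x))"

definition schwartz :: "('a::euclidean_space \<Rightarrow> complex) set" where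
  "schwartz = {f. smooth f \<and>
     (\<forall>k. \<forall>bs \<in> lists Basis. bounded (range (\<lambda>x. norm x ^ k *\<^sub>R partial_deriv bs f x)))}"

definition schwartz_seminorm :: "nat \<Rightarrow> 'a list \<Rightarrow> ('a::euclidean_space \<Rightarrow> complex) \<Rightarrow> real" where
  "schwartz_seminorm k bs f = (SUP x. norm (norm x ^ k *\<^sub>R partial_deriv bs f x))"

definition schwartz_topology :: "('a::euclidean_space \<Rightarrow> complex) topology" where
  "schwartz_topology = topology_generated_by
     {{g \<in> schwartz. schwartz_seminorm k bs (\<lambda>x. g x - f x) < e} | k bs f e.
        bs \<in> lists Basis \<and> f \<in> schwartz \<and> e > 0}"

lemma topspace_schwartz_topology: "topspace schwartz_topology = schwartz"
proof (intro equalityI subsetI)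
  fix f :: "'a \<Rightarrow> complex"
  assume f: "f \<in> schwartz"
  let ?B = "{g \<in> schwartz. schwartz_seminorm 0 [] (\<lambda>x. g x - f x) < 1}"
  have "f \<in> ?B"
    using f by (simp add: schwartz_seminorm_def)
  moreover have "\<exists>k bs f' e. ?B = {g \<in> schwartz. schwartz_seminorm k bs (\<lambda>x. g x - f' x) < e} \<and>
      bs \<in> lists Basis \<and> f' \<in> schwartz \<and> e > (0::real)"
    by (rule exI[of _ 0], rule exI[of _ "[]"], rule exI[of _ f], rule exI[of _ 1]) (simp add: f)
  ultimately show "f \<in> topspace schwartz_topology"
    unfolding schwartz_topology_def topology_generated_by_topspace by blast
next
  fix f :: "'a \<Rightarrow> complex"
  assume "f \<in> topspace schwartz_topology"
  then show "f \<in> schwartz"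
    unfolding schwartz_topology_def topology_generated_by_topspace by blast
qed

definition monomial :: "('a::euclidean_space \<Rightarrow> nat) \<Rightarrow> 'a \<Rightarrow> real" where
  "monomial \<alpha> x = (\<Prod>b\<in>Basis. (x \<bullet> b) ^ \<alpha> b)"

definition lizorkin :: "('a::euclidean_space \<Rightarrow> complex) set" where
  "lizorkin = {f \<in> schwartz. \<forall>\<alpha>. (LINT x|lborel. of_real (monomial \<alpha> x) * f x) = 0}"

definition lizorkin_topology :: "('a::euclidean_space \<Rightarrow> complex) topology" where
  "lizorkin_topology = subtopology schwartz_topology lizorkin"

text \<open>
  Functionals are total functions on \<open>'a \<Rightarrow> complex\<close>; only their values on the
  carrier of the respective function space matter.
\<close>

definition continuous_dual ::
  "('a \<Rightarrow> complex) topology \<Rightarrow> (('a \<Rightarrow> complex) \<Rightarrow> complex) set" where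
  "continuous_dual X = {T.
     (\<forall>f \<in> topspace X. \<forall>g \<in> topspace X. T (\<lambda>x. f x + g x) = T f + T g) \<and>
     (\<forall>c. \<forall>f \<in> topspace X. T (\<lambda>x. c * f x) = c * T f) \<and>
     continuous_map X euclidean T}"

abbreviation tempered_distributions :: "(('a::euclidean_space \<Rightarrow> complex) \<Rightarrow> complex) set" where
  "tempered_distributions \<equiv> continuous_dual schwartz_topology"

abbreviation lizorkin_dual :: "(('a::euclidean_space \<Rightarrow> complex) \<Rightarrow> complex) set" where
  "lizorkin_dual \<equiv> continuous_dual lizorkin_topology"

definition fourier :: "('a::euclidean_space \<Rightarrow> complex) \<Rightarrow> 'a \<Rightarrow> complex" where
  "fourier f \<xi> = (LINT x|lborel. exp (- (\<i> * of_real (x \<bullet> \<xi>))) * f x)"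

definition fourier_dist ::
  "(('a::euclidean_space \<Rightarrow> complex) \<Rightarrow> complex) \<Rightarrow> ('a \<Rightarrow> complex) \<Rightarrow> complex" where
  "fourier_dist T f = T (fourier f)"

definition log_laplacian :: "('a::euclidean_space \<Rightarrow> complex) \<Rightarrow> 'a \<Rightarrow> complex" where
  "log_laplacian f = (THE g. g \<in> lizorkin \<and>
     (\<forall>\<xi>. \<xi> \<noteq> 0 \<longrightarrow> fourier g \<xi> = of_real (2 * ln (norm \<xi>)) * fourier f \<xi>))"

definition log_laplacian_dist ::
  "(('a::euclidean_space \<Rightarrow> complex) \<Rightarrow> complex) \<Rightarrow> ('a \<Rightarrow> complex) \<Rightarrow> complex" where
  "log_laplacian_dist u f = u (log_laplacian f)"

definition fundamental_solution :: "(('a::euclidean_space \<Rightarrow> complex) \<Rightarrow> complex) \<Rightarrow> bool" where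
  "fundamental_solution u \<longleftrightarrow>
     u \<in> lizorkin_dual \<and> (\<forall>f \<in> lizorkin. log_laplacian_dist u f = f 0)"

definition test_functions :: "'a set \<Rightarrow> ('a::euclidean_space \<Rightarrow> complex) set" where
  "test_functions S =
     {f. smooth f \<and> compact (closure {x. f x \<noteq> 0}) \<and> closure {x. f x \<noteq> 0} \<subseteq> S}"

definition locally_integrable_on :: "('a::euclidean_space \<Rightarrow> complex) \<Rightarrow> 'a set \<Rightarrow> bool" where
  "locally_integrable_on h S \<longleftrightarrow>
     (\<forall>K. compact K \<and> K \<subseteq> S \<longrightarrow> h absolutely_integrable_on K)"

definition coincides_on ::
  "(('a::euclidean_space \<Rightarrow> complex) \<Rightarrow> complex) \<Rightarrow> ('a \<Rightarrow> complex) \<Rightarrow> 'a set \<Rightarrow> bool" where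
  "coincides_on T h S \<longleftrightarrow> locally_integrable_on h S \<and>
     (\<forall>f \<in> test_functions S. T f = (LINT x:S|lebesgue. h x * f x))"

text \<open>
  The last condition singles out one tempered extension of \<open>u\<close>: two tempered
  extensions differ by a polynomial, whose Fourier transform is supported at the origin.
\<close>

definition representative ::
  "(('a::euclidean_space \<Rightarrow> complex) \<Rightarrow> complex) \<Rightarrow> (('a \<Rightarrow> complex) \<Rightarrow> complex) \<Rightarrow> bool" where
  "representative u E \<longleftrightarrow> E \<in> tempered_distributions \<and> (\<forall>f \<in> lizorkin. E f = u f) \<and>
     (\<exists>r > 0. \<exists>h. coincides_on (fourier_dist E) h (ball 0 r))"

definition radial_on :: "('a::real_normed_vector \<Rightarrow> 'b) \<Rightarrow> 'a set \<Rightarrow> bool" where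
  "radial_on g S \<longleftrightarrow> (\<forall>x \<in> S. \<forall>y \<in> S. norm x = norm y \<longrightarrow> g x = g y)"

end

theory Submission
  imports Defs "HOL-Probability.Characteristic_Functions" "HOL-Probability.Sinc_Integral"
    "HOL-Complex_Analysis.Conformal_Mappings"
begin

text \<open>
  On the Fourier side a fundamental solution has to be \<open>1 / log s\<close> with \<open>s = |\<xi>|\<^sup>2\<close>. This function
  is harmless at \<open>\<xi> = 0\<close>, where it tends to \<open>0\<close>, and has a simple pole on the unit sphere, with the
  same principal part as \<open>1 / (s - 1)\<close>. The proof rests on splitting off this pole exactly:
  \<open>1 / log s = 1 / (s - 1) + \<integral>\<^sub>0\<^sup>\<infinity> dt / ((s + t) (\<pi>\<^sup>2 + log\<^sup>2 t))\<close>.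

  The integral term is the Laplace transform, in the variable \<open>s\<close>, of a nonnegative function of total
  mass one (\<open>has_bochner_integral_log_density\<close>). Since \<open>exp (- \<sigma> |\<xi>|\<^sup>2)\<close> is the Fourier transform of the
  heat kernel at time \<open>\<sigma>\<close>, its inverse Fourier transform is an average of heat kernels. It is therefore
  integrable, and of size \<open>O(|x|\<^sup>-\<^sup>d)\<close> because this holds for every heat kernel uniformly in time.

  The term \<open>1 / (s - 1)\<close> belongs to the Helmholtz operator \<open>-\<Delta> - 1\<close>, and its outgoing fundamental
  solution carries the decay rate \<open>|x|\<close> to the power \<open>- (d - 1) / 2\<close>. It is obtained by limiting
  absorption. For \<open>\<kappa> > 0\<close> the kernel of \<open>1 / (s + \<kappa>\<^sup>2)\<close> is again a superposition of heat kernels, and a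
  substitution gives it a closed form (\<open>gaussian_mixture_damped\<close>) that stays meaningful, with the
  required bound (\<open>helmholtz_kernel_bound\<close>), for complex \<open>\<kappa>\<close> up to the imaginary axis away from \<open>0\<close>.
  The identity between the kernel and its symbol continues analytically to \<open>Re \<kappa> > 0\<close>, and
  \<open>\<kappa> \<rightarrow> - \<i>\<close> turns \<open>1 / (s + \<kappa>\<^sup>2)\<close> into \<open>1 / (s - 1)\<close> (\<open>helmholtz_pairing\<close>). No principal value is
  needed: in the applications the test function has a Fourier transform that either contains the factor
  \<open>log s\<close>, which vanishes on the unit sphere, or is supported near the origin.

  Hence the sum \<open>E\<close> of the two kernels is a locally integrable function, bounded by a multiple of
  \<open>|x|\<close> to the power \<open>- (d - 1) / 2\<close> for \<open>|x| \<ge> 2\<close>, and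
  \<open>(2 \<pi>)\<^sup>d \<integral> E g = \<integral> (\<F> g) / log s\<close> for suitable Schwartz functions \<open>g\<close> (\<open>log_kernel_pairing\<close>).
  For \<open>g = log(-\<Delta>) f\<close> the logarithms cancel and Fourier inversion leaves \<open>f 0\<close>. For \<open>g = \<F> \<phi>\<close> with
  \<open>\<phi>\<close> supported near the origin the identity says that the Fourier transform of \<open>E\<close> is \<open>1 / log s\<close>
  there.

  The operator \<open>log(-\<Delta>)\<close> is given by a definite description, so it must also be shown that it is well
  defined on the Lizorkin space (\<open>log_laplacian\<close>). This needs Fourier inversion on Schwartz space, the
  fact that the Lizorkin space corresponds to Schwartz functions that vanish to infinite order at the
  origin, and the fact that multiplication by \<open>log s\<close> preserves the latter.
\<close>

section \<open>Schwartz functions that vanish to infinite order on a set\<close>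

text \<open>
  The set \<open>Z\<close> lets one set of closure lemmas serve both for the whole Schwartz space (\<open>Z = {}\<close>) and
  for the Fourier image of the Lizorkin space (\<open>Z = {0}\<close>).
\<close>

definition schwartz_flat :: "'a::euclidean_space set \<Rightarrow> ('a \<Rightarrow> complex) set" where
  "schwartz_flat Z = {f \<in> schwartz. \<forall>bs \<in> lists Basis. \<forall>x \<in> Z. partial_deriv bs f x = 0}"

abbreviation dderiv :: "'a::euclidean_space \<Rightarrow> ('a \<Rightarrow> complex) \<Rightarrow> 'a \<Rightarrow> complex" where
  "dderiv b f \<equiv> \<lambda>x. frechet_derivative f (at x) b"

lemma schwartz_eq_flat: "schwartz = schwartz_flat {}"
  by (simp add: schwartz_flat_def)

lemma schwartz_flat_sub: "f \<in> schwartz_flat Z \<Longrightarrow> f \<in> schwartz"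
  by (simp add: schwartz_flat_def)

lemma bounded_range_iff_decay:
  "bounded (range (\<lambda>x. norm x ^ k *\<^sub>R f x)) \<longleftrightarrow> (\<exists>C. \<forall>x. norm x ^ k * norm (f x) \<le> C)"
  for f :: "'a::real_normed_vector \<Rightarrow> complex"
  by (auto simp: bounded_iff)

text \<open>
  Iterated derivatives never have to be computed: it is enough to exhibit a family of functions that is
  stable under first derivatives and each of whose members is differentiable, decays rapidly and
  vanishes on \<open>Z\<close>. The closure properties below follow from well-chosen families.
\<close>

lemma schwartz_flat_coinduct:
  assumes A: "f \<in> A"
    and diff: "\<And>f x. f \<in> A \<Longrightarrow> f differentiable (at x)"
    and closed: "\<And>f b. f \<in> A \<Longrightarrow> b \<in> Basis \<Longrightarrow> dderiv b f \<in> A"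
    and decay: "\<And>f k. f \<in> A \<Longrightarrow> \<exists>C. \<forall>x. norm x ^ k * norm (f x) \<le> C"
    and zero: "\<And>f x. f \<in> A \<Longrightarrow> x \<in> Z \<Longrightarrow> f x = 0"
  shows "f \<in> schwartz_flat Z"
proof -
  have "partial_deriv bs f \<in> A" if "bs \<in> lists Basis" for bs
    using that by (induction bs) (auto simp: A closed)
  then show ?thesis
    unfolding schwartz_flat_def schwartz_def smooth_def bounded_range_iff_decay
    using diff decay zero by blast
qed

lemma schwartz_flat_differentiable:
  assumes "f \<in> schwartz_flat Z"
  shows "f differentiable (at x)"
proof -
  have "partial_deriv [] f differentiable (at x)"
    using assms unfolding schwartz_flat_def schwartz_def smooth_def by blast
  then show ?thesis by simp
qed

lemma schwartz_flat_has_derivative: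
  "f \<in> schwartz_flat Z \<Longrightarrow> (f has_derivative frechet_derivative f (at x)) (at x)"
  using schwartz_flat_differentiable frechet_derivative_works by blast

lemma partial_deriv_snoc: "partial_deriv bs (dderiv b f) = partial_deriv (bs @ [b]) f"
  by (induction bs) auto

lemma schwartz_flat_deriv:
  assumes "f \<in> schwartz_flat Z" "b \<in> Basis"
  shows "dderiv b f \<in> schwartz_flat Z"
  using assms unfolding schwartz_flat_def schwartz_def smooth_def
  by (auto simp: partial_deriv_snoc)

lemma schwartz_flat_decay:
  assumes "f \<in> schwartz_flat Z"
  shows "\<exists>C. \<forall>x. norm x ^ k * norm (f x) \<le> C"
proof -
  have "bounded (range (\<lambda>x. norm x ^ k *\<^sub>R partial_deriv [] f x))"
    using assms unfolding schwartz_flat_def schwartz_def by blast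
  then show ?thesis by (simp add: bounded_range_iff_decay)
qed

lemma schwartz_flat_zero:
  assumes "f \<in> schwartz_flat Z" "x \<in> Z"
  shows "f x = 0"
proof -
  have "partial_deriv [] f x = 0"
    using assms unfolding schwartz_flat_def by blast
  then show ?thesis by simp
qed

lemma decay_add:
  fixes f g :: "'a::real_normed_vector \<Rightarrow> complex"
  assumes "\<exists>C. \<forall>x. norm x ^ k * norm (f x) \<le> C" "\<exists>C. \<forall>x. norm x ^ k * norm (g x) \<le> C"
  shows "\<exists>C. \<forall>x. norm x ^ k * norm (f x + g x) \<le> C"
proof -
  obtain C D where C: "\<And>x. norm x ^ k * norm (f x) \<le> C" and D: "\<And>x. norm x ^ k * norm (g x) \<le> D"
    using assms by blast
  have "norm x ^ k * norm (f x + g x) \<le> C + D" for x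
  proof -
    have "norm x ^ k * norm (f x + g x) \<le> norm x ^ k * (norm (f x) + norm (g x))"
      by (intro mult_left_mono norm_triangle_ineq) auto
    also have "\<dots> \<le> C + D" using C[of x] D[of x] by (simp add: algebra_simps)
    finally show ?thesis .
  qed
  then show ?thesis by blast
qed

lemma schwartz_flat_lincomb:
  assumes "f \<in> schwartz_flat Z" "g \<in> schwartz_flat Z"
  shows "(\<lambda>x. c * f x + g x) \<in> schwartz_flat Z"
proof (rule schwartz_flat_coinduct[where A = "{\<lambda>x. c * f x + g x | f g.
    f \<in> schwartz_flat Z \<and> g \<in> schwartz_flat Z}"])
  show "(\<lambda>x. c * f x + g x) \<in> {\<lambda>x. c * f x + g x | f g. f \<in> schwartz_flat Z \<and> g \<in> schwartz_flat Z}"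
    using assms by blast
next
  fix h :: "'a \<Rightarrow> complex"
  assume "h \<in> {\<lambda>x. c * f x + g x | f g. f \<in> schwartz_flat Z \<and> g \<in> schwartz_flat Z}"
  then obtain f g where h: "h = (\<lambda>x. c * f x + g x)"
    and f: "f \<in> schwartz_flat Z" and g: "g \<in> schwartz_flat Z" by blast
  have der: "(h has_derivative (\<lambda>v. c * frechet_derivative f (at x) v + frechet_derivative g (at x) v)) (at x)" for x
    unfolding h by (intro has_derivative_add has_derivative_mult_right
        schwartz_flat_has_derivative[OF f] schwartz_flat_has_derivative[OF g])
  show "h differentiable (at x)" for x using der differentiable_def by blast
  show "dderiv b h \<in> {\<lambda>x. c * f x + g x | f g. f \<in> schwartz_flat Z \<and> g \<in> schwartz_flat Z}"
    if "b \<in> Basis" for b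
    using frechet_derivative_at[OF der, symmetric] schwartz_flat_deriv[OF f that] schwartz_flat_deriv[OF g that] by auto
  obtain C where C: "\<And>x. norm x ^ k * norm (f x) \<le> C k" for k
    using schwartz_flat_decay[OF f] by metis
  show "\<exists>C. \<forall>x. norm x ^ k * norm (h x) \<le> C" for k
    unfolding h
  proof (rule decay_add[OF _ schwartz_flat_decay[OF g]])
    have "norm x ^ k * norm (c * f x) \<le> norm c * C k" for x
      using mult_left_mono[OF C[where x=x and k=k], of "norm c"] by (simp add: norm_mult ac_simps)
    then show "\<exists>C. \<forall>x. norm x ^ k * norm (c * f x) \<le> C" by blast
  qed
  show "h x = 0" if "x \<in> Z" for x
    using that h schwartz_flat_zero[OF f] schwartz_flat_zero[OF g] by simp
qed

lemma zero_schwartz_flat: "(\<lambda>x. 0) \<in> schwartz_flat Z"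
proof (rule schwartz_flat_coinduct[where A = "{\<lambda>x. 0}"])
  show "dderiv b f \<in> {\<lambda>x. 0}" if "f \<in> {\<lambda>x. 0}" for b :: 'a and f
    using that by (simp add: frechet_derivative_const)
qed (auto intro: exI[of _ 0])

lemma schwartz_flat_add:
  "f \<in> schwartz_flat Z \<Longrightarrow> g \<in> schwartz_flat Z \<Longrightarrow> (\<lambda>x. f x + g x) \<in> schwartz_flat Z"
  using schwartz_flat_lincomb[of f Z g 1] by simp

lemma schwartz_flat_scale: "f \<in> schwartz_flat Z \<Longrightarrow> (\<lambda>x. c * f x) \<in> schwartz_flat Z"
  using schwartz_flat_lincomb[OF _ zero_schwartz_flat] by simp

text \<open>
  The functions \<open>x\<^sub>c f + g\<close> form a stable family, since the product rule turns \<open>x\<^sub>c f\<close> into \<open>x\<^sub>c\<close> times a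
  derivative of \<open>f\<close> plus a multiple of \<open>f\<close>.
\<close>

lemma schwartz_flat_coord:
  assumes "f \<in> schwartz_flat Z" "c \<in> Basis"
  shows "(\<lambda>x. of_real (x \<bullet> c) * f x) \<in> schwartz_flat Z"
proof -
  define A where "A = {\<lambda>x. of_real (x \<bullet> c) * f x + g x | f g.
    f \<in> schwartz_flat Z \<and> g \<in> schwartz_flat Z}"
  have "(\<lambda>x. of_real (x \<bullet> c) * f x) \<in> A"
    unfolding A_def mem_Collect_eq
    by (rule exI[of _ f], rule exI[of _ "\<lambda>x. 0"]) (use assms zero_schwartz_flat in auto)
  then show ?thesis
  proof (rule schwartz_flat_coinduct)
    fix h assume "h \<in> A"
    then obtain f g where h: "h = (\<lambda>x. of_real (x \<bullet> c) * f x + g x)"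
      and f: "f \<in> schwartz_flat Z" and g: "g \<in> schwartz_flat Z" unfolding A_def by blast
    have der: "(h has_derivative (\<lambda>v. of_real (x \<bullet> c) * frechet_derivative f (at x) v
        + (of_real (v \<bullet> c) * f x + frechet_derivative g (at x) v))) (at x)" for x
    proof -
      have lin: "((\<lambda>x. complex_of_real (x \<bullet> c)) has_derivative (\<lambda>v. of_real (v \<bullet> c))) (at x)"
        by (intro has_derivative_of_real has_derivative_inner_left has_derivative_ident)
      show ?thesis
        using has_derivative_add[OF has_derivative_mult[OF lin schwartz_flat_has_derivative[OF f]]
            schwartz_flat_has_derivative[OF g]]
        unfolding h by (simp add: add.assoc)
    qed
    show "h differentiable (at x)" for x using der differentiable_def by blast
    show "dderiv b h \<in> A" if "b \<in> Basis" for b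
    proof -
      have "dderiv b h = (\<lambda>x. of_real (x \<bullet> c) * dderiv b f x + (of_real (b \<bullet> c) * f x + dderiv b g x))"
        using frechet_derivative_at[OF der, symmetric] by auto
      then show ?thesis
        unfolding A_def mem_Collect_eq
        using schwartz_flat_deriv[OF f that]
          schwartz_flat_lincomb[OF f schwartz_flat_deriv[OF g that], of "of_real (b \<bullet> c)"]
        by (intro exI[of _ "dderiv b f"] exI[of _ "\<lambda>x. of_real (b \<bullet> c) * f x + dderiv b g x"]) simp
    qed
    obtain C where C: "\<And>x. norm x ^ k * norm (f x) \<le> C k" for k
      using schwartz_flat_decay[OF f] by metis
    show "\<exists>C. \<forall>x. norm x ^ k * norm (h x) \<le> C" for k
      unfolding h
    proof (rule decay_add[OF _ schwartz_flat_decay[OF g]])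
      have "norm x ^ k * norm (of_real (x \<bullet> c) * f x) \<le> C (Suc k)" for x
      proof -
        have "norm x ^ k * norm (of_real (x \<bullet> c) * f x) \<le> norm x ^ k * (norm x * norm (f x))"
          using Basis_le_norm[OF assms(2), of x] by (auto simp: norm_mult intro!: mult_left_mono mult_right_mono)
        also have "\<dots> \<le> C (Suc k)" using C[where x=x and k="Suc k"] by (simp add: mult.assoc mult.left_commute)
        finally show ?thesis .
      qed
      then show "\<exists>C. \<forall>x. norm x ^ k * norm (of_real (x \<bullet> c) * f x) \<le> C" by blast
    qed
    show "h x = 0" if "x \<in> Z" for x
      using that h schwartz_flat_zero[OF f] schwartz_flat_zero[OF g] by simp
  qed
qed

lemma norm_le_sum_Basis_linear:
  fixes L :: "'a::euclidean_space \<Rightarrow> complex"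
  assumes "linear L"
  shows "norm (L v) \<le> norm v * (\<Sum>b\<in>Basis. norm (L b))"
proof -
  have "L v = (\<Sum>b\<in>Basis. (v \<bullet> b) *\<^sub>R L b)"
    by (subst euclidean_representation[of v, symmetric]) (simp add: linear_sum[OF assms] linear_scale[OF assms])
  also have "norm \<dots> \<le> (\<Sum>b\<in>Basis. \<bar>v \<bullet> b\<bar> * norm (L b))"
    by (rule order_trans[OF norm_sum]) simp
  also have "\<dots> \<le> (\<Sum>b\<in>Basis. norm v * norm (L b))"
    by (intro sum_mono mult_right_mono Basis_le_norm) auto
  finally show ?thesis by (simp add: sum_distrib_left)
qed

text \<open>
  By induction on the order: all partial derivatives are again flat, so they are \<open>O(|x|\<^sup>k)\<close>, and
  integrating along the segment from \<open>0\<close> to \<open>x\<close> gains one more power of \<open>|x|\<close>.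
\<close>

lemma flat_bound_norm_power:
  assumes "f \<in> schwartz_flat {0}"
  shows "\<exists>C. \<forall>x. norm (f x) \<le> C * norm x ^ k"
  using assms
proof (induction k arbitrary: f)
  case 0
  then show ?case using schwartz_flat_decay[of f _ 0] by simp
next
  case (Suc k)
  note f = Suc.prems
  have "\<forall>b\<in>Basis. \<exists>C. \<forall>x. norm (dderiv b f x) \<le> C * norm x ^ k"
    using Suc.IH schwartz_flat_deriv[OF f] by blast
  then obtain C where C: "\<And>b x. b \<in> Basis \<Longrightarrow> norm (dderiv b f x) \<le> C b * norm x ^ k"
    by metis
  have "norm (f x) \<le> (\<Sum>b\<in>Basis. C b) * norm x ^ Suc k" for x
  proof -
    have "norm (f x - f 0) \<le> ((\<Sum>b\<in>Basis. C b) * norm x ^ k) * norm (x - 0)"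
    proof (rule differentiable_bound[of "cball 0 (norm x)" f "\<lambda>y. frechet_derivative f (at y)"])
      fix y :: 'a assume y: "y \<in> cball 0 (norm x)"
      show "(f has_derivative frechet_derivative f (at y)) (at y within cball 0 (norm x))"
        using schwartz_flat_has_derivative[OF f] has_derivative_at_withinI by blast
      show "onorm (frechet_derivative f (at y)) \<le> (\<Sum>b\<in>Basis. C b) * norm x ^ k"
      proof (rule onorm_le)
        fix v
        have "norm (frechet_derivative f (at y) v) \<le> norm v * (\<Sum>b\<in>Basis. norm (frechet_derivative f (at y) b))"
          by (rule norm_le_sum_Basis_linear[OF has_derivative_linear[OF schwartz_flat_has_derivative[OF f]]])
        also have "\<dots> \<le> norm v * (\<Sum>b\<in>Basis. C b * norm x ^ k)"
        proof (intro mult_left_mono sum_mono)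
          fix b :: 'a assume b: "b \<in> Basis"
          have 0: "0 \<le> C b" using C[OF b, of b] b order_trans[OF norm_ge_zero] by fastforce
          show "norm (dderiv b f y) \<le> C b * norm x ^ k"
            by (rule order_trans[OF C[OF b]]) (use y 0 in \<open>auto intro!: mult_left_mono power_mono\<close>)
        qed auto
        finally show "norm (frechet_derivative f (at y) v) \<le> (\<Sum>b\<in>Basis. C b) * norm x ^ k * norm v"
          by (simp add: sum_distrib_right ac_simps)
      qed
    qed auto
    then show ?thesis using schwartz_flat_zero[OF f, of 0] by (simp add: ac_simps)
  qed
  then show ?case by blast
qed

section \<open>Multiplication of flat functions by the logarithm\<close>

lemma schwartz_flat_sum:
  assumes "finite I" "\<And>i. i \<in> I \<Longrightarrow> f i \<in> schwartz_flat Z"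
  shows "(\<lambda>x. \<Sum>i\<in>I. f i x) \<in> schwartz_flat Z"
  using assms by (induction I rule: finite_induct) (auto simp: zero_schwartz_flat intro!: schwartz_flat_add)

lemma schwartz_flat_norm_sq:
  assumes "f \<in> schwartz_flat Z"
  shows "(\<lambda>x. of_real (x \<bullet> x) * f x) \<in> schwartz_flat Z"
proof -
  have "(\<lambda>x. \<Sum>b\<in>Basis. of_real (x \<bullet> b) * (of_real (x \<bullet> b) * f x)) \<in> schwartz_flat Z"
    by (intro schwartz_flat_sum schwartz_flat_coord assms finite_Basis)
  moreover have "(\<Sum>b\<in>Basis. of_real (x \<bullet> b) * (of_real (x \<bullet> b) * f x)) = of_real (x \<bullet> x) * f x" for x
    unfolding euclidean_inner[of x x] by (simp add: sum_distrib_right mult.assoc)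
  ultimately show ?thesis by simp
qed

lemmas schwartz_has_derivative = schwartz_flat_has_derivative[where Z = "{}", folded schwartz_eq_flat]
  and schwartz_deriv = schwartz_flat_deriv[where Z = "{}", folded schwartz_eq_flat]
  and schwartz_decay = schwartz_flat_decay[where Z = "{}", folded schwartz_eq_flat]
  and schwartz_lincomb = schwartz_flat_lincomb[where Z = "{}", folded schwartz_eq_flat]
  and schwartz_add = schwartz_flat_add[where Z = "{}", folded schwartz_eq_flat]
  and schwartz_scale = schwartz_flat_scale[where Z = "{}", folded schwartz_eq_flat]
  and schwartz_coord = schwartz_flat_coord[where Z = "{}", folded schwartz_eq_flat]
  and schwartz_sum = schwartz_flat_sum[where Z = "{}", folded schwartz_eq_flat]
  and schwartz_norm_sq = schwartz_flat_norm_sq[where Z = "{}", folded schwartz_eq_flat]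
  and schwartz_coinduct = schwartz_flat_coinduct[where Z = "{}", folded schwartz_eq_flat]

text \<open>
  Flatness at the origin and rapid decay at infinity together compensate any positive or negative power
  of \<open>|x|\<close>.
\<close>

lemma flat_bound_weighted:
  assumes "f \<in> schwartz_flat {0}"
  shows "\<exists>C. \<forall>x. norm x ^ k * norm (f x) \<le> C * norm x ^ m"
proof -
  have "(\<lambda>x. of_real (x \<bullet> x) ^ k * f x) \<in> schwartz_flat {0}"
  proof (induction k)
    case (Suc k)
    then show ?case using schwartz_flat_norm_sq[OF Suc] by (simp add: mult.assoc)
  qed (simp add: assms)
  from flat_bound_norm_power[OF this, of m] obtain C where
    C: "\<And>x. norm (of_real (x \<bullet> x) ^ k * f x) \<le> C * norm x ^ m" by blast
  obtain D where D: "\<And>x. norm (f x) \<le> D * norm x ^ m"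
    using flat_bound_norm_power[OF assms] by blast
  have "norm x ^ k * norm (f x) \<le> (C + D) * norm x ^ m" for x
  proof -
    have "norm x ^ k \<le> norm x ^ (2 * k) + 1"
    proof (cases "norm x \<le> 1")
      case True
      then show ?thesis by (smt (verit) norm_ge_zero power_le_one zero_le_power)
    next
      case False
      then have "norm x ^ k \<le> norm x ^ (2 * k)" by (intro power_increasing) auto
      then show ?thesis by simp
    qed
    then have "norm x ^ k * norm (f x) \<le> norm x ^ (2 * k) * norm (f x) + norm (f x)"
      using mult_right_mono[of "norm x ^ k" "norm x ^ (2 * k) + 1" "norm (f x)"] by (simp add: algebra_simps)
    also have "norm x ^ (2 * k) * norm (f x) \<le> C * norm x ^ m"
      using C[of x] by (simp add: norm_mult norm_power dot_square_norm power_mult)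
    finally show ?thesis using D[of x] by (simp add: algebra_simps)
  qed
  then show ?thesis by blast
qed

lemma has_derivative_if_quadratic:
  fixes f :: "'a::real_normed_vector \<Rightarrow> 'b::real_normed_vector"
  assumes "bounded_linear D" "\<And>h. norm (f (x + h) - f x - D h) \<le> C * norm h ^ 2"
  shows "(f has_derivative D) (at x)"
proof -
  have "((\<lambda>h. norm (f (x + h) - f x - D h) / norm h) \<longlongrightarrow> 0) (at 0)"
  proof (rule Lim_null_comparison[where g = "\<lambda>h. C * norm h"])
    show "((\<lambda>h. C * norm h) \<longlongrightarrow> 0) (at (0::'a))"
      by (rule tendsto_eq_intros refl | simp)+
    have "norm (norm (f (x + h) - f x - D h) / norm h) \<le> C * norm h" if "h \<noteq> 0" for h
      using assms(2)[of h] that by (simp add: divide_le_eq power2_eq_square mult.assoc)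
    then show "\<forall>\<^sub>F h in at 0. norm (norm (f (x + h) - f x - D h) / norm h) \<le> C * norm h"
      by (simp add: eventually_at_filter)
  qed
  then show ?thesis using assms(1) by (simp add: has_derivative_at)
qed

lemma abs_ln_le: "\<bar>ln s\<bar> \<le> s + 1 / s" if "s > 0" for s :: real
proof -
  have "ln s \<le> s - 1" by (rule ln_le_minus_one[OF that])
  moreover have "ln (1 / s) \<le> 1 / s - 1" using that by (intro ln_le_minus_one) simp
  ultimately show ?thesis using that by (simp add: ln_div abs_le_iff) (smt (verit) divide_pos_pos)
qed

text \<open>
  The functions \<open>(log(|x|\<^sup>2) f + g) / |x|\<^sup>2\<^sup>n\<close> with flat \<open>f\<close> and \<open>g\<close> form a stable family. Away from the
  origin a derivative only raises \<open>n\<close> and changes \<open>f\<close> and \<open>g\<close>; at the origin every member is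
  \<open>O(|x|\<^sup>2)\<close>, so its derivative there is \<open>0\<close>, which is also the value of the formula because division by
  zero gives \<open>0\<close>.
\<close>

lemma schwartz_flat_ln_mult:
  assumes "f \<in> schwartz_flat {0}"
  shows "(\<lambda>x. of_real (ln (x \<bullet> x)) * f x) \<in> schwartz_flat {0}"
proof -
  let ?F = "schwartz_flat {0 :: 'a}"
  define H where "H f g n = (\<lambda>x. (of_real (ln (x \<bullet> x)) * f x + g x) / of_real (x \<bullet> x) ^ n)"
    for f g :: "'a \<Rightarrow> complex" and n :: nat
  define A where "A = {H f g n | f g n. f \<in> ?F \<and> g \<in> ?F}"
  have bound: "\<exists>C. \<forall>x. norm x ^ k * norm (H f g n x) \<le> C * norm x ^ m"
    if f: "f \<in> ?F" and g: "g \<in> ?F" for f g n k m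
  proof -
    obtain C1 where C1: "\<And>x. norm x ^ (k + 2) * norm (f x) \<le> C1 * norm x ^ (m + 2 * n)"
      using flat_bound_weighted[OF f] by blast
    obtain C2 where C2: "\<And>x. norm x ^ k * norm (f x) \<le> C2 * norm x ^ (m + 2 * n + 2)"
      using flat_bound_weighted[OF f] by blast
    obtain C3 where C3: "\<And>x. norm x ^ k * norm (g x) \<le> C3 * norm x ^ (m + 2 * n)"
      using flat_bound_weighted[OF g] by blast
    have "norm x ^ k * norm (H f g n x) \<le> (\<bar>C1\<bar> + \<bar>C2\<bar> + \<bar>C3\<bar>) * norm x ^ m" for x
    proof (cases "x = 0")
      case True
      then have "H f g n x = 0" using schwartz_flat_zero[OF f, of 0] schwartz_flat_zero[OF g, of 0] by (simp add: H_def)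
      then show ?thesis by simp
    next
      case False
      define r where "r = norm x"
      have r: "r > 0" using False by (simp add: r_def)
      have xx: "x \<bullet> x = r ^ 2" by (simp add: r_def dot_square_norm)
      have 1: "norm (of_real (ln (x \<bullet> x)) * f x + g x) \<le> (r ^ 2 + 1 / r ^ 2) * norm (f x) + norm (g x)"
        using abs_ln_le[of "r ^ 2"] r unfolding xx
        by (intro order_trans[OF norm_triangle_ineq] add_mono) (auto simp: norm_mult intro!: mult_right_mono)
      have 2: "r ^ k * ((r ^ 2 + 1 / r ^ 2) * norm (f x) + norm (g x))
        = r ^ (k + 2) * norm (f x) + r ^ k * norm (f x) / r ^ 2 + r ^ k * norm (g x)"
        by (simp add: algebra_simps power_add power2_eq_square)
      have 3: "r ^ k * norm (f x) / r ^ 2 \<le> C2 * r ^ (m + 2 * n)"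
        using C2[of x] r by (simp add: r_def[symmetric] divide_le_eq power_add power2_eq_square ac_simps)
      have "r ^ k * norm (of_real (ln (x \<bullet> x)) * f x + g x) \<le> (C1 + C2 + C3) * r ^ (m + 2 * n)"
        using mult_left_mono[OF 1, of "r ^ k"] r 3 C1[of x] C3[of x] unfolding 2
        by (simp add: r_def[symmetric] algebra_simps)
      also have "\<dots> \<le> (\<bar>C1\<bar> + \<bar>C2\<bar> + \<bar>C3\<bar>) * r ^ (m + 2 * n)"
        using r by (intro mult_right_mono) auto
      finally show ?thesis
        using r by (simp add: H_def norm_divide norm_power xx r_def[symmetric] divide_le_eq power_add power_mult mult.assoc)
    qed
    then show ?thesis by blast
  qed
  have "(\<lambda>x. of_real (ln (x \<bullet> x)) * f x) = H f (\<lambda>x. 0) 0" by (simp add: H_def)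
  then have "(\<lambda>x. of_real (ln (x \<bullet> x)) * f x) \<in> A"
    unfolding A_def using assms zero_schwartz_flat[of "{0}"] by blast
  then show ?thesis
  proof (rule schwartz_flat_coinduct)
    fix h assume "h \<in> A"
    then obtain f g n where h: "h = H f g n" and f: "f \<in> ?F" and g: "g \<in> ?F" unfolding A_def by blast
    let ?f' = "\<lambda>b x. of_real (x \<bullet> x) * dderiv b f x + (- (2 * of_nat n)) * (of_real (x \<bullet> b) * f x)"
    let ?g' = "\<lambda>b x. 2 * (of_real (x \<bullet> b) * f x) + (of_real (x \<bullet> x) * dderiv b g x
        + (- (2 * of_nat n)) * (of_real (x \<bullet> b) * g x))"
    obtain C where C: "\<And>x. norm (h x) \<le> C * norm x ^ 2"
      using bound[OF f g, of 0 n 2] unfolding h by auto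
    have der: "(h has_derivative (\<lambda>v. H (?f' v) (?g' v) (Suc n) x)) (at x)" for x
    proof (cases "x = 0")
      case True
      have "h 0 = 0" using C[of 0] by simp
      then have "(h has_derivative (\<lambda>v. 0)) (at 0)"
        using C by (intro has_derivative_if_quadratic[where C = C]) auto
      moreover have "H (?f' v) (?g' v) (Suc n) 0 = 0" for v by (simp add: H_def)
      ultimately show ?thesis using True by simp
    next
      case False
      then have xx: "x \<bullet> x > 0" by simp
      have ip: "((\<lambda>x. x \<bullet> x) has_derivative (\<lambda>v. 2 * (x \<bullet> v))) (at x)"
        by (rule has_derivative_eq_rhs, rule has_derivative_inner[OF has_derivative_ident has_derivative_ident])
           (simp add: fun_eq_iff inner_commute)
      have "((\<lambda>x. ln (x \<bullet> x)) has_derivative (\<lambda>v. 2 * (x \<bullet> v) / (x \<bullet> x))) (at x)"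
        by (rule has_derivative_eq_rhs, rule has_derivative_ln[OF xx ip]) (simp add: fun_eq_iff divide_inverse)
      from has_derivative_add[OF has_derivative_mult[OF has_derivative_of_real[OF this] schwartz_flat_has_derivative[OF f]]
          schwartz_flat_has_derivative[OF g]]
      have num: "((\<lambda>x. of_real (ln (x \<bullet> x)) * f x + g x) has_derivative
        (\<lambda>v. (of_real (ln (x \<bullet> x)) * frechet_derivative f (at x) v + of_real (2 * (x \<bullet> v) / (x \<bullet> x)) * f x)
          + frechet_derivative g (at x) v)) (at x)" .
      have den: "((\<lambda>x. complex_of_real (x \<bullet> x) ^ n) has_derivative
        (\<lambda>v. of_nat n * of_real (2 * (x \<bullet> v)) * of_real (x \<bullet> x) ^ (n - 1))) (at x)"
        by (rule has_derivative_power[OF has_derivative_of_real[OF ip]])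
      have "(h has_derivative (\<lambda>v.
         - (of_real (ln (x \<bullet> x)) * f x + g x) * (inverse (of_real (x \<bullet> x) ^ n)
            * (of_nat n * of_real (2 * (x \<bullet> v)) * of_real (x \<bullet> x) ^ (n - 1)) * inverse (of_real (x \<bullet> x) ^ n))
         + ((of_real (ln (x \<bullet> x)) * frechet_derivative f (at x) v + of_real (2 * (x \<bullet> v) / (x \<bullet> x)) * f x)
          + frechet_derivative g (at x) v) / (of_real (x \<bullet> x) ^ n))) (at x)"
        unfolding h H_def
        by (rule has_derivative_divide[OF num den]) (use xx in simp)
      moreover have "- (L * F + G) * (inverse (S ^ n) * (of_nat n * (2 * V) * S ^ (n - 1)) * inverse (S ^ n))
          + ((L * F' + 2 * V / S * F) + G') / S ^ n
        = (L * (S * F' + (- (2 * of_nat n)) * (V * F)) + (2 * (V * F) + (S * G' + (- (2 * of_nat n)) * (V * G)))) / S ^ Suc n"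
        if "S \<noteq> 0" for L F G S F' G' V :: complex
      proof (cases n)
        case 0
        then show ?thesis using that by (simp add: field_simps)
      next
        case (Suc m)
        then show ?thesis using that by (simp add: field_simps)
      qed
      ultimately show ?thesis using xx by (simp add: H_def inner_commute)
    qed
    show "h differentiable (at x)" for x using der differentiable_def by blast
    show "dderiv b h \<in> A" if b: "b \<in> Basis" for b
    proof -
      have "?f' b \<in> ?F"
        by (intro schwartz_flat_add schwartz_flat_scale schwartz_flat_norm_sq schwartz_flat_coord
            schwartz_flat_deriv f b)
      moreover have "?g' b \<in> ?F"
        by (intro schwartz_flat_add schwartz_flat_scale schwartz_flat_norm_sq schwartz_flat_coord
            schwartz_flat_deriv f g b)
      moreover have "dderiv b h = H (?f' b) (?g' b) (Suc n)"
        using frechet_derivative_at[OF der, symmetric] by auto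
      ultimately show ?thesis unfolding A_def by blast
    qed
    show "\<exists>C. \<forall>x. norm x ^ k * norm (h x) \<le> C" for k
      using bound[OF f g, of k n 0] unfolding h by simp
    show "h x = 0" if "x \<in> {0}" for x
      using that h schwartz_flat_zero[OF f, of 0] schwartz_flat_zero[OF g, of 0] by (simp add: H_def)
  qed
qed

section \<open>Integrals over Euclidean space and the heat kernel\<close>

lemma
  fixes F :: "'a::euclidean_space \<Rightarrow> real \<Rightarrow> 'b::{real_normed_field,banach,second_countable_topology}"
  assumes F: "\<And>b. b \<in> Basis \<Longrightarrow> integrable lborel (F b)"
  shows integrable_prod_coords: "integrable lborel (\<lambda>x::'a. \<Prod>b\<in>Basis. F b (x \<bullet> b))"
    and integral_prod_coords:
      "(LINT x|lborel. (\<Prod>b\<in>Basis. F b (x \<bullet> b))) = (\<Prod>b\<in>Basis. LINT t|lborel. F b t)"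
proof -
  interpret product_sigma_finite "\<lambda>_::'a. lborel :: real measure" ..
  have [measurable]: "F b \<in> borel_measurable borel" if "b \<in> Basis" for b
    using borel_measurable_integrable[OF F[OF that]] by simp
  have coord: "(\<Prod>b\<in>Basis. F b ((\<Sum>i\<in>Basis. f i *\<^sub>R i) \<bullet> b)) = (\<Prod>b\<in>Basis. F b (f b))" for f
    by (intro prod.cong refl) (simp add: inner_sum_left_Basis)
  have meas: "(\<lambda>x::'a. \<Prod>b\<in>Basis. F b (x \<bullet> b)) \<in> borel_measurable borel"
    by measurable
  show "integrable lborel (\<lambda>x::'a. \<Prod>b\<in>Basis. F b (x \<bullet> b))"
    by (subst lborel_eq, subst integrable_distr_eq[OF _ meas])
       (simp_all add: coord product_integrable_prod F)
  show "(LINT x|lborel. (\<Prod>b\<in>Basis. F b (x \<bullet> b))) = (\<Prod>b\<in>Basis. LINT t|lborel. F b t)"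
    by (subst lborel_eq, subst integral_distr[OF _ meas])
       (simp_all add: coord product_integral_prod F)
qed

lemma
  fixes f :: "'a::euclidean_space \<Rightarrow> 'b::{banach,second_countable_topology}"
  assumes [measurable]: "f \<in> borel_measurable borel" and c: "c \<noteq> 0"
  shows lborel_integrable_affine: "integrable lborel f \<longleftrightarrow> integrable lborel (\<lambda>x. f (t + c *\<^sub>R x))"
    and lborel_integral_affine:
      "(LINT x|lborel. f x) = \<bar>c\<bar> ^ DIM('a) *\<^sub>R (LINT x|lborel. f (t + c *\<^sub>R x))"
proof -
  show "integrable lborel f \<longleftrightarrow> integrable lborel (\<lambda>x. f (t + c *\<^sub>R x))"
  proof -
    have "integrable lborel f \<longleftrightarrow> integrable lborel (\<lambda>x. \<bar>c\<bar> ^ DIM('a) *\<^sub>R f (t + c *\<^sub>R x))"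
      by (subst lborel_affine[OF c, of t]) (simp add: integrable_density integrable_distr_eq)
    also have "\<dots> \<longleftrightarrow> integrable lborel (\<lambda>x. f (t + c *\<^sub>R x))"
      using integrable_scaleR_right[of "inverse (\<bar>c\<bar> ^ DIM('a))" lborel "\<lambda>x. \<bar>c\<bar> ^ DIM('a) *\<^sub>R f (t + c *\<^sub>R x)"] c
      by auto
    finally show ?thesis .
  qed
  show "(LINT x|lborel. f x) = \<bar>c\<bar> ^ DIM('a) *\<^sub>R (LINT x|lborel. f (t + c *\<^sub>R x))"
    by (subst lborel_affine[OF c, of t]) (use c in \<open>simp add: integral_density integral_distr\<close>)
qed

definition heat_kernel :: "real \<Rightarrow> 'a::euclidean_space \<Rightarrow> real" where
  "heat_kernel \<sigma> x = exp (- ((x \<bullet> x) / (4 * \<sigma>))) / sqrt (4 * pi * \<sigma>) ^ DIM('a)"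

lemma heat_kernel_pair_measurable [measurable]:
  "(\<lambda>p. heat_kernel (fst p) (snd p :: 'a::euclidean_space)) \<in> borel_measurable (borel \<Otimes>\<^sub>M borel)"
  unfolding heat_kernel_def by measurable

lemma heat_kernel_measurable [measurable]: "heat_kernel \<sigma> \<in> borel_measurable borel"
  unfolding heat_kernel_def by measurable

text \<open>
  This is the characteristic function of the standard normal distribution after rescaling.
\<close>

lemma integral_gauss_1d:
  fixes \<sigma> u :: real
  assumes "\<sigma> > 0"
  shows "has_bochner_integral lborel (\<lambda>t. exp (- (\<i> * of_real (t * u))) * of_real (exp (- (\<sigma> * t\<^sup>2))))
     (of_real (sqrt (pi / \<sigma>) * exp (- (u\<^sup>2 / (4 * \<sigma>)))))"
proof -
  define c where "c = sqrt (2 * \<sigma>)"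
  have c: "c > 0" "c\<^sup>2 = 2 * \<sigma>" using assms by (auto simp: c_def)
  define v where "v = - (u / c)"
  have "integrable std_normal_distribution (\<lambda>x. iexp (v * x))"
  proof -
    interpret real_distribution std_normal_distribution by (rule real_dist_normal_dist)
    show ?thesis by (rule integrable_const_bound[of _ 1]) auto
  qed
  then have i: "integrable lborel (\<lambda>x. std_normal_density x *\<^sub>R iexp (v * x))"
    by (subst (asm) integrable_density) auto
  have "(LINT x|lborel. std_normal_density x *\<^sub>R iexp (v * x)) = of_real (exp (- (v\<^sup>2) / 2))"
    using char_std_normal_distribution[THEN fun_cong, of v]
    unfolding char_def by (subst (asm) integral_density) auto
  with i have "has_bochner_integral lborel (\<lambda>x. std_normal_density x *\<^sub>R iexp (v * x)) (of_real (exp (- (v\<^sup>2) / 2)))"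
    by (simp add: has_bochner_integral_iff)
  from lborel_has_bochner_integral_real_affine_iff[THEN iffD1, OF _ this, of c 0]
  have "has_bochner_integral lborel (\<lambda>t. std_normal_density (c * t) *\<^sub>R iexp (v * (c * t)))
      (of_real (exp (- (v\<^sup>2) / 2)) /\<^sub>R c)"
    using c by simp
  from has_bochner_integral_mult_right[OF this, of "of_real (sqrt (2 * pi))"]
  have "has_bochner_integral lborel (\<lambda>t. of_real (sqrt (2 * pi)) * (std_normal_density (c * t) *\<^sub>R iexp (v * (c * t))))
      (of_real (sqrt (2 * pi)) * (of_real (exp (- (v\<^sup>2) / 2)) /\<^sub>R c))" by simp
  moreover have "of_real (sqrt (2 * pi)) * (std_normal_density (c * t) *\<^sub>R iexp (v * (c * t)))
     = exp (- (\<i> * of_real (t * u))) * of_real (exp (- (\<sigma> * t\<^sup>2)))" for t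
  proof -
    have "v * (c * t) = - (t * u)" using c by (simp add: v_def)
    moreover have "sqrt (2 * pi) * std_normal_density (c * t) = exp (- (\<sigma> * t\<^sup>2))"
      unfolding std_normal_density_def using c by (simp add: power_mult_distrib)
    ultimately show ?thesis
      by (simp add: scaleR_conv_of_real flip: of_real_mult mult.assoc)
  qed
  moreover have "of_real (sqrt (2 * pi)) * (of_real (exp (- (v\<^sup>2) / 2)) /\<^sub>R c)
     = complex_of_real (sqrt (pi / \<sigma>) * exp (- (u\<^sup>2 / (4 * \<sigma>))))"
  proof -
    have "sqrt (2 * pi) / c = sqrt (pi / \<sigma>)"
      unfolding c_def by (simp flip: real_sqrt_divide)
    moreover have "- (v\<^sup>2) / 2 = - (u\<^sup>2 / (4 * \<sigma>))"
      using c by (simp add: v_def power_divide)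
    ultimately have "sqrt (2 * pi) * exp (- (v\<^sup>2) / 2) / c = sqrt (pi / \<sigma>) * exp (- (u\<^sup>2 / (4 * \<sigma>)))"
      by (metis times_divide_eq_left)
    moreover have "of_real (sqrt (2 * pi)) * (of_real (exp (- (v\<^sup>2) / 2)) /\<^sub>R c)
      = complex_of_real (sqrt (2 * pi) * exp (- (v\<^sup>2) / 2) / c)"
      by (simp only: scaleR_conv_of_real divide_inverse of_real_mult of_real_inverse ac_simps)
    ultimately show ?thesis by presburger
  qed
  ultimately show ?thesis by simp
qed

lemma exp_inner_prod:
  "exp (- (\<i> * of_real (x \<bullet> \<xi>))) = (\<Prod>b\<in>Basis. exp (- (\<i> * of_real ((x \<bullet> b) * (\<xi> \<bullet> b)))))"
  for x \<xi> :: "'a::euclidean_space"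
  by (simp add: euclidean_inner[of x \<xi>] exp_sum sum_distrib_left flip: sum_negf exp_sum)

lemma exp_inner_self_prod:
  "exp (- (\<sigma> * (x \<bullet> x))) = (\<Prod>b\<in>Basis. exp (- (\<sigma> * (x \<bullet> b)\<^sup>2)))" for x :: "'a::euclidean_space"
  by (simp add: euclidean_inner[of x x] exp_sum sum_distrib_left power2_eq_square flip: sum_negf exp_sum)

text \<open>
  Both the character and the Gaussian factor over the coordinates, which reduces the integral to
  dimension one.
\<close>

lemma fourier_gaussian:
  fixes x :: "'a::euclidean_space"
  assumes s: "\<sigma> > 0"
  shows "has_bochner_integral lborel (\<lambda>\<xi>. exp (- (\<i> * of_real (x \<bullet> \<xi>))) * of_real (exp (- (\<sigma> * (\<xi> \<bullet> \<xi>)))))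
     (of_real ((2 * pi) ^ DIM('a) * heat_kernel \<sigma> x))"
proof -
  define F where "F b t = exp (- (\<i> * of_real (t * (x \<bullet> b)))) * of_real (exp (- (\<sigma> * t\<^sup>2)))" for b and t :: real
  have F: "has_bochner_integral lborel (F b) (of_real (sqrt (pi / \<sigma>) * exp (- ((x \<bullet> b)\<^sup>2 / (4 * \<sigma>)))))" for b
    unfolding F_def by (rule integral_gauss_1d[OF s])
  have "exp (- (\<i> * of_real (x \<bullet> \<xi>))) * of_real (exp (- (\<sigma> * (\<xi> \<bullet> \<xi>)))) = (\<Prod>b\<in>Basis. F b (\<xi> \<bullet> b))" for \<xi>
    unfolding F_def exp_inner_prod exp_inner_self_prod
    by (simp add: prod.distrib mult.commute)
  moreover have "has_bochner_integral lborel (\<lambda>\<xi>. \<Prod>b\<in>Basis. F b (\<xi> \<bullet> b))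
     (\<Prod>b\<in>Basis. of_real (sqrt (pi / \<sigma>) * exp (- ((x \<bullet> b)\<^sup>2 / (4 * \<sigma>)))))"
    using integrable_prod_coords[of F] integral_prod_coords[of F] F
    by (simp add: has_bochner_integral_iff)
  moreover have "(\<Prod>b\<in>(Basis::'a set). sqrt (pi / \<sigma>) * exp (- ((x \<bullet> b)\<^sup>2 / (4 * \<sigma>)))) = (2 * pi) ^ DIM('a) * heat_kernel \<sigma> x"
  proof -
    have "sqrt (pi / \<sigma>) = 2 * pi / sqrt (4 * pi * \<sigma>)"
      using s by (simp add: real_sqrt_mult real_sqrt_divide field_simps)
    moreover have "exp (- ((x \<bullet> x) / (4 * \<sigma>))) = (\<Prod>b\<in>Basis. exp (- ((x \<bullet> b)\<^sup>2 / (4 * \<sigma>))))"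
      using exp_inner_self_prod[of "1 / (4 * \<sigma>)" x] by simp
    moreover have "(\<Prod>b\<in>(Basis::'a set). sqrt (pi / \<sigma>) * exp (- ((x \<bullet> b)\<^sup>2 / (4 * \<sigma>))))
      = sqrt (pi / \<sigma>) ^ DIM('a) * (\<Prod>b\<in>Basis. exp (- ((x \<bullet> b)\<^sup>2 / (4 * \<sigma>))))"
      by (simp add: prod.distrib)
    ultimately show ?thesis
      by (simp add: heat_kernel_def power_divide)
  qed
  ultimately show ?thesis by (simp only: of_real_prod[symmetric])
qed

lemma heat_kernel_nonneg: "\<sigma> \<ge> 0 \<Longrightarrow> heat_kernel \<sigma> x \<ge> 0"
  by (simp add: heat_kernel_def)

lemma heat_kernel_has_integral:
  assumes s: "\<sigma> > 0"
  shows "has_bochner_integral lborel (heat_kernel \<sigma> :: 'a::euclidean_space \<Rightarrow> real) 1"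
proof -
  have "has_bochner_integral lborel (\<lambda>\<xi>::'a. complex_of_real (exp (- (1 / (4 * \<sigma>) * (\<xi> \<bullet> \<xi>)))))
     (of_real ((2 * pi) ^ DIM('a) * heat_kernel (1 / (4 * \<sigma>)) (0::'a)))"
    using fourier_gaussian[of "1 / (4 * \<sigma>)" "0::'a", simplified inner_zero_left of_real_0 mult_zero_right
        minus_zero exp_zero mult_1_left] s by force
  then have "has_bochner_integral lborel (\<lambda>\<xi>::'a. exp (- ((\<xi> \<bullet> \<xi>) / (4 * \<sigma>))))
     ((2 * pi) ^ DIM('a) * heat_kernel (1 / (4 * \<sigma>)) (0::'a))"
    unfolding has_bochner_integral_iff complex_of_real_integrable_eq integral_complex_of_real of_real_eq_iff
    by (metis (no_types, lifting) Bochner_Integration.integral_cong mult_1 times_divide_eq_left Bochner_Integration.integrable_cong)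
  then have "has_bochner_integral lborel (heat_kernel \<sigma> :: 'a \<Rightarrow> real)
     ((2 * pi) ^ DIM('a) * heat_kernel (1 / (4 * \<sigma>)) (0::'a) / sqrt (4 * pi * \<sigma>) ^ DIM('a))"
    unfolding heat_kernel_def by (rule has_bochner_integral_divide_zero)
  moreover have "2 * pi / sqrt (4 * pi * (1 / (4 * \<sigma>))) / sqrt (4 * pi * \<sigma>) = 1"
    using s by (simp add: real_sqrt_mult real_sqrt_divide field_simps)
  then have "(2 * pi / sqrt (4 * pi * (1 / (4 * \<sigma>))) / sqrt (4 * pi * \<sigma>)) ^ DIM('a) = 1"
    by (simp only: power_one)
  then have "(2 * pi) ^ DIM('a) * heat_kernel (1 / (4 * \<sigma>)) (0::'a) / sqrt (4 * pi * \<sigma>) ^ DIM('a) = 1"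
    unfolding heat_kernel_def power_divide by simp
  ultimately show ?thesis by (simp only:)
qed

lemma integrable_powr_over_square:
  fixes a :: real
  assumes a: "0 \<le> a" "a < 1"
  shows "integrable lborel (\<lambda>t::real. \<bar>t\<bar> powr (- a) / (1 + t\<^sup>2))"
proof -
  define I where "I t = indicator {0..1} t * t powr (- a)" for t :: real
  have "(\<lambda>t. t powr (- a)) absolutely_integrable_on {0..1::real}"
    using a by (intro nonnegative_absolutely_integrable_1 integrable_on_powr_from_0) auto
  then have I: "integrable lborel I"
    unfolding I_def set_integrable_def by (subst (asm) integrable_completion) auto
  have I': "integrable lborel (\<lambda>t. I (- t))"
    using lborel_integrable_real_affine[OF I, of "-1" 0] by simp
  have J: "integrable lborel (\<lambda>t::real. 1 / (1 + t\<^sup>2))"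
    using integrable_inverse_1_plus_square by (simp add: set_integrable_def inverse_eq_divide)
  show ?thesis
  proof (rule Bochner_Integration.integrable_bound[OF
        Bochner_Integration.integrable_add[OF Bochner_Integration.integrable_add[OF I I'] J]])
    have "norm (\<bar>t\<bar> powr (- a) / (1 + t\<^sup>2)) \<le> norm (I t + I (- t) + 1 / (1 + t\<^sup>2))" for t
    proof (cases "\<bar>t\<bar> \<le> 1")
      case True
      have "\<bar>t\<bar> powr (- a) / (1 + t\<^sup>2) \<le> \<bar>t\<bar> powr (- a)"
        using divide_left_mono[of 1 "1 + t\<^sup>2" "\<bar>t\<bar> powr (- a)"] by (simp add: add_pos_nonneg)
      also have "\<dots> \<le> I t + I (- t)" using True by (auto simp: I_def indicator_def abs_if split: if_splits)
      finally have "\<bar>t\<bar> powr (- a) / (1 + t\<^sup>2) \<le> I t + I (- t)" .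
      moreover have "0 \<le> 1 / (1 + t\<^sup>2)" "0 \<le> \<bar>t\<bar> powr (- a) / (1 + t\<^sup>2)" by auto
      ultimately show ?thesis unfolding real_norm_def by linarith
    next
      case False
      then have "\<bar>t\<bar> powr (- a) \<le> 1 powr (- a)" using a by (intro powr_mono2') auto
      then show ?thesis by (simp add: I_def divide_right_mono add_increasing)
    qed
    then show "AE t in lborel. norm (\<bar>t\<bar> powr (- a) / (1 + t\<^sup>2)) \<le> norm (I t + I (- t) + 1 / (1 + t\<^sup>2))" by simp
  qed simp
qed

lemma lborel_AE_coord_nonzero: "b \<in> Basis \<Longrightarrow> AE x::'a::euclidean_space in lborel. x \<bullet> b \<noteq> 0"
proof -
  assume b: "b \<in> Basis"
  have "negligible {x. x \<bullet> b = 0}" using negligible_standard_hyperplane[OF b] .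
  moreover have "{x::'a. x \<bullet> b = 0} \<in> sets borel" by measurable
  ultimately have "{x. x \<bullet> b = 0} \<in> null_sets lborel"
    by (simp add: negligible_iff_null_sets null_sets_completion_iff)
  from AE_not_in[OF this] show ?thesis by simp
qed

text \<open>
  The majorant used for Schwartz functions and for kernels singular at the origin. The exponent is distributed evenly over the
  coordinates: from \<open>|x| \<ge> |x\<^sub>b|\<close> the function is bounded by a product of integrable functions of one
  variable. This bound fails on the coordinate hyperplanes, where a negative power of \<open>0\<close> has the value
  \<open>0\<close>, but they form a null set.
\<close>

lemma integrable_radial_weight:
  fixes a :: real
  assumes a: "0 \<le> a" "a < DIM('a)"
  shows "integrable lborel (\<lambda>x::'a::euclidean_space. norm x powr (- a) / (1 + (norm x)\<^sup>2) ^ DIM('a))"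
proof -
  define c where "c = a / DIM('a)"
  have c: "0 \<le> c" "c < 1" using a by (auto simp: c_def)
  show ?thesis
  proof (rule Bochner_Integration.integrable_bound[OF integrable_prod_coords[OF integrable_powr_over_square[OF c]]])
    have "AE x::'a in lborel. \<forall>b\<in>Basis. x \<bullet> b \<noteq> 0"
      by (simp add: AE_ball_countable countable_finite lborel_AE_coord_nonzero)
    then show "AE x::'a in lborel. norm (norm x powr (- a) / (1 + (norm x)\<^sup>2) ^ DIM('a)) \<le>
        norm (\<Prod>b\<in>Basis. \<bar>x \<bullet> b\<bar> powr (- c) / (1 + (x \<bullet> b)\<^sup>2))"
    proof (rule AE_mp, intro AE_I2 impI)
      fix x :: 'a assume x: "\<forall>b\<in>Basis. x \<bullet> b \<noteq> 0"
      obtain b0 :: 'a where "b0 \<in> Basis" using nonempty_Basis by blast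
      then have "x \<noteq> 0" using x by fastforce
      have "norm x powr (- a) = norm x powr (\<Sum>b\<in>(Basis::'a set). - c)"
        by (simp add: c_def)
      also have "\<dots> = (\<Prod>b\<in>(Basis::'a set). norm x powr (- c))"
        using \<open>x \<noteq> 0\<close> by (subst powr_sum) auto
      finally have "norm x powr (- a) / (1 + (norm x)\<^sup>2) ^ DIM('a) = (\<Prod>b\<in>(Basis::'a set). norm x powr (- c) / (1 + (norm x)\<^sup>2))"
        by (simp add: power_divide)
      also have "\<dots> \<le> (\<Prod>b\<in>Basis. \<bar>x \<bullet> b\<bar> powr (- c) / (1 + (x \<bullet> b)\<^sup>2))"
      proof (intro prod_mono conjI frac_le)
        fix b :: 'a assume b: "b \<in> Basis"
        show "norm x powr (- c) \<le> \<bar>x \<bullet> b\<bar> powr (- c)"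
          using x b c Basis_le_norm[OF b] by (intro powr_mono2') auto
        show "1 + (x \<bullet> b)\<^sup>2 \<le> 1 + (norm x)\<^sup>2"
          using Basis_le_norm[OF b, of x] by (simp add: abs_le_square_iff[symmetric])
      qed (auto simp: add_pos_nonneg)
      finally show "norm (norm x powr (- a) / (1 + (norm x)\<^sup>2) ^ DIM('a)) \<le>
        norm (\<Prod>b\<in>Basis. \<bar>x \<bullet> b\<bar> powr (- c) / (1 + (x \<bullet> b)\<^sup>2))"
        by (simp add: prod_nonneg abs_prod)
    qed
  qed simp
qed

section \<open>The Fourier transform on Schwartz functions\<close>

lemma schwartz_continuous:
  fixes f :: "'a::euclidean_space \<Rightarrow> complex"
  assumes "f \<in> schwartz"
  shows "continuous_on S f"
proof -
  have "isCont f x" for x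
    by (rule has_derivative_continuous[OF schwartz_has_derivative[OF assms]])
  then show ?thesis by (simp add: continuous_at_imp_continuous_on)
qed

lemma schwartz_borel_measurable:
  "f \<in> schwartz \<Longrightarrow> f \<in> borel_measurable borel"
  by (intro borel_measurable_continuous_onI schwartz_continuous)

lemma schwartz_weighted_bound:
  assumes "f \<in> schwartz"
  shows "\<exists>C\<ge>0. \<forall>x. norm (f x) \<le> C / (1 + (norm x)\<^sup>2) ^ k"
proof -
  have "(\<lambda>x. of_real (1 + x \<bullet> x) ^ k * f x) \<in> schwartz"
  proof (induction k)
    case (Suc k)
    show ?case
      using schwartz_add[OF Suc schwartz_norm_sq[OF Suc]] by (simp add: algebra_simps)
  qed (use assms in auto)
  from schwartz_decay[OF this, of 0] obtain C where
    C: "\<And>x. norm (of_real (1 + x \<bullet> x) ^ k * f x) \<le> C" by auto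
  have "norm (f x) \<le> C / (1 + (norm x)\<^sup>2) ^ k" for x
  proof -
    have "norm (complex_of_real (1 + x \<bullet> x)) = 1 + (norm x)\<^sup>2"
      unfolding norm_of_real dot_square_norm by simp
    then have "(1 + (norm x)\<^sup>2) ^ k * norm (f x) \<le> C"
      using C[of x] by (simp add: norm_mult norm_power)
    moreover have "(1 + (norm x)\<^sup>2) ^ k > 0" by (simp add: add_pos_nonneg)
    ultimately show ?thesis by (simp add: field_simps)
  qed
  moreover have "C \<ge> 0" using C[of 0] norm_ge_zero order_trans by blast
  ultimately show ?thesis by blast
qed

lemma lborel_AE_nonzero: "AE x::'a::euclidean_space in lborel. x \<noteq> 0"
  by (rule AE_lborel_singleton)

lemma schwartz_integrable_mult:
  fixes f :: "'a::euclidean_space \<Rightarrow> complex" and m :: "'a \<Rightarrow> complex"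
  assumes f: "f \<in> schwartz" and [measurable]: "m \<in> borel_measurable borel"
    and m: "\<And>x. x \<noteq> 0 \<Longrightarrow> norm (m x) \<le> M * norm x powr (- a)"
    and a: "0 \<le> a" "a < DIM('a)"
  shows "integrable lborel (\<lambda>x. m x * f x)"
proof -
  note [measurable] = schwartz_borel_measurable[OF f]
  obtain C where C: "C \<ge> 0" "\<And>x. norm (f x) \<le> C / (1 + (norm x)\<^sup>2) ^ DIM('a)"
    using schwartz_weighted_bound[OF f] by blast
  show ?thesis
  proof (rule Bochner_Integration.integrable_bound[OF integrable_mult_right[OF integrable_radial_weight[OF a], of "\<bar>M\<bar> * C"]])
    show "AE x in lborel. norm (m x * f x) \<le> norm (\<bar>M\<bar> * C * (norm x powr (- a) / (1 + (norm x)\<^sup>2) ^ DIM('a)))"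
      using lborel_AE_nonzero
    proof (rule AE_mp, intro AE_I2 impI)
      fix x :: 'a assume "x \<noteq> 0"
      have "norm (m x) \<le> \<bar>M\<bar> * norm x powr (- a)"
        by (rule order_trans[OF m[OF \<open>x \<noteq> 0\<close>]]) (intro mult_right_mono, auto)
      then have "norm (m x * f x) \<le> (\<bar>M\<bar> * norm x powr (- a)) * (C / (1 + (norm x)\<^sup>2) ^ DIM('a))"
        unfolding norm_mult using C by (intro mult_mono) auto
      also have "\<dots> = \<bar>M\<bar> * C * (norm x powr (- a) / (1 + (norm x)\<^sup>2) ^ DIM('a))" by simp
      finally show "norm (m x * f x) \<le> norm (\<bar>M\<bar> * C * (norm x powr (- a) / (1 + (norm x)\<^sup>2) ^ DIM('a)))"
        unfolding real_norm_def by linarith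
    qed
  qed measurable
qed

lemma schwartz_integrable:
  fixes f :: "'a::euclidean_space \<Rightarrow> complex"
  shows "f \<in> schwartz \<Longrightarrow> integrable lborel f"
  using schwartz_integrable_mult[of f "\<lambda>_. 1" 1 0] by simp

lemma exp_inner_measurable [measurable]:
  "(\<lambda>x::'a::euclidean_space. exp (- (\<i> * of_real (x \<bullet> \<xi>)))) \<in> borel_measurable borel"
  by (intro borel_measurable_continuous_onI continuous_intros)

lemma norm_exp_inner [simp]: "norm (exp (- (\<i> * complex_of_real t))) = 1"
  using norm_exp_i_times[of "- t"] by simp

lemma integrable_unimodular_mult:
  fixes f :: "'a::euclidean_space \<Rightarrow> complex"
  assumes f: "integrable lborel f"
  shows "integrable lborel (\<lambda>x. exp (- (\<i> * of_real (x \<bullet> \<xi>))) * f x)"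
proof (rule Bochner_Integration.integrable_bound[OF f])
  have [measurable]: "f \<in> borel_measurable borel" using f by simp
  show "(\<lambda>x. exp (- (\<i> * of_real (x \<bullet> \<xi>))) * f x) \<in> borel_measurable lborel" by simp
qed (simp add: norm_mult)

lemma norm_fourier_le:
  "norm (fourier f \<xi>) \<le> (LINT x|lborel. norm (f x))"
  unfolding fourier_def by (rule order_trans[OF integral_norm_bound]) (simp add: norm_mult)

lemma fourier_lincomb:
  assumes "integrable lborel f" "integrable lborel g"
  shows "fourier (\<lambda>x. c * f x + g x) \<xi> = c * fourier f \<xi> + fourier g \<xi>"
proof -
  have "fourier (\<lambda>x. c * f x + g x) \<xi> =
     (LINT x|lborel. c * (exp (- (\<i> * of_real (x \<bullet> \<xi>))) * f x) + exp (- (\<i> * of_real (x \<bullet> \<xi>))) * g x)"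
    unfolding fourier_def by (simp add: algebra_simps)
  also have "\<dots> = c * fourier f \<xi> + fourier g \<xi>"
    unfolding fourier_def using assms by (simp add: integrable_unimodular_mult)
  finally show ?thesis .
qed

lemma fourier_scale: "fourier (\<lambda>x. c * f x) \<xi> = c * fourier f \<xi>"
proof -
  have "fourier (\<lambda>x. c * f x) \<xi> = (LINT x|lborel. c * (exp (- (\<i> * of_real (x \<bullet> \<xi>))) * f x))"
    unfolding fourier_def by (simp add: algebra_simps)
  then show ?thesis unfolding fourier_def by simp
qed

lemma fourier_sum:
  assumes "finite I" "\<And>i. i \<in> I \<Longrightarrow> integrable lborel (f i)"
  shows "fourier (\<lambda>x. \<Sum>i\<in>I. f i x) \<xi> = (\<Sum>i\<in>I. fourier (f i) \<xi>)"
  unfolding fourier_def using assms by (simp add: sum_distrib_left integrable_unimodular_mult)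

text \<open>
  The second-order remainder of the character is at most \<open>(x \<bullet> h)\<^sup>2\<close>, and \<open>|x|\<^sup>2 f\<close> is integrable, so the
  error is quadratic in \<open>h\<close>.
\<close>

lemma fourier_has_derivative:
  fixes f :: "'a::euclidean_space \<Rightarrow> complex"
  assumes f: "f \<in> schwartz"
  shows "(fourier f has_derivative
    (\<lambda>h. \<Sum>b\<in>Basis. (h \<bullet> b) *\<^sub>R fourier (\<lambda>x. - \<i> * (of_real (x \<bullet> b) * f x)) \<xi>)) (at \<xi>)"
proof (rule has_derivative_if_quadratic)
  let ?g = "\<lambda>b x. - \<i> * (of_real (x \<bullet> b) * f x)"
  have g: "?g b \<in> schwartz" if "b \<in> Basis" for b
    by (intro schwartz_scale schwartz_coord f that)
  have f2: "integrable lborel (\<lambda>x. of_real (x \<bullet> x) * f x)"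
    by (intro schwartz_integrable schwartz_norm_sq f)
  show "bounded_linear (\<lambda>h. \<Sum>b\<in>Basis. (h \<bullet> b) *\<^sub>R fourier (?g b) \<xi>)"
    by (intro bounded_linear_intros)
  fix h
  define D where "D = (\<Sum>b\<in>Basis. (h \<bullet> b) *\<^sub>R fourier (?g b) \<xi>)"
  let ?e = "\<lambda>\<xi> x. exp (- (\<i> * complex_of_real (x \<bullet> \<xi>)))"
  have Dg: "D = fourier (\<lambda>x. \<Sum>b\<in>Basis. of_real (h \<bullet> b) * ?g b x) \<xi>"
  proof -
    have "integrable lborel (\<lambda>x. of_real (h \<bullet> b) * ?g b x)" if "b \<in> Basis" for b
      by (intro integrable_mult_right schwartz_integrable g that)
    then have "fourier (\<lambda>x. \<Sum>b\<in>Basis. of_real (h \<bullet> b) * ?g b x) \<xi>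
        = (\<Sum>b\<in>Basis. fourier (\<lambda>x. of_real (h \<bullet> b) * ?g b x) \<xi>)"
      by (rule fourier_sum[OF finite_Basis])
    also have "\<dots> = D"
      unfolding D_def fourier_scale scaleR_conv_of_real ..
    finally show ?thesis ..
  qed
  have sum_g: "(\<Sum>b\<in>Basis. of_real (h \<bullet> b) * ?g b x) = - \<i> * of_real (x \<bullet> h) * f x" for x
  proof -
    have "(\<Sum>b\<in>Basis. of_real (h \<bullet> b) * ?g b x) = - \<i> * (\<Sum>b\<in>Basis. of_real ((x \<bullet> b) * (h \<bullet> b))) * f x"
      by (simp add: sum_distrib_left sum_distrib_right algebra_simps)
    then show ?thesis by (simp only: euclidean_inner[of x h] of_real_sum)
  qed
  have i1: "integrable lborel (\<lambda>x. \<Sum>b\<in>Basis. of_real (h \<bullet> b) * ?g b x)"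
    by (intro Bochner_Integration.integrable_sum integrable_mult_right schwartz_integrable g)
  have "fourier f (\<xi> + h) - fourier f \<xi> - D =
     (LINT x|lborel. ?e (\<xi> + h) x * f x - ?e \<xi> x * f x - ?e \<xi> x * (\<Sum>b\<in>Basis. of_real (h \<bullet> b) * ?g b x))"
    unfolding Dg fourier_def
    by (simp only: Bochner_Integration.integral_diff integrable_unimodular_mult i1
        schwartz_integrable[OF f] Bochner_Integration.integrable_diff)
  also have "norm \<dots> \<le> (LINT x|lborel. (norm h)\<^sup>2 * norm (of_real (x \<bullet> x) * f x))"
  proof (rule Bochner_Integration.integral_norm_bound_integral)
    show "integrable lborel (\<lambda>x. ?e (\<xi> + h) x * f x - ?e \<xi> x * f x - ?e \<xi> x * (\<Sum>b\<in>Basis. of_real (h \<bullet> b) * ?g b x))"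
      by (intro Bochner_Integration.integrable_diff integrable_unimodular_mult i1 schwartz_integrable[OF f])
    show "integrable lborel (\<lambda>x. (norm h)\<^sup>2 * norm (of_real (x \<bullet> x) * f x))"
      using f2 by (intro integrable_mult_right integrable_norm)
    fix x :: 'a
    define t where "t = - (x \<bullet> h)"
    have "?e (\<xi> + h) x * f x - ?e \<xi> x * f x - ?e \<xi> x * (\<Sum>b\<in>Basis. of_real (h \<bullet> b) * ?g b x)
       = ?e \<xi> x * (iexp t - (1 + \<i> * t)) * f x"
    proof -
      have "?e (\<xi> + h) x = ?e \<xi> x * iexp t"
        unfolding t_def by (simp add: inner_add_right distrib_left flip: exp_add)
      then show ?thesis unfolding sum_g by (simp add: t_def algebra_simps)
    qed
    moreover have "norm (iexp t - (1 + \<i> * t)) \<le> t\<^sup>2"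
      using iexp_approx1[of t 1] by (simp add: numeral_2_eq_2) (smt (verit) power2_eq_square zero_le_power2 mult_nonneg_nonneg)
    moreover have "t\<^sup>2 \<le> (norm h)\<^sup>2 * (norm x)\<^sup>2"
      using Cauchy_Schwarz_ineq2[of x h] by (simp add: t_def flip: power_mult_distrib)
         (metis abs_le_square_iff abs_mult abs_norm_cancel mult.commute)
    ultimately have "norm (?e (\<xi> + h) x * f x - ?e \<xi> x * f x - ?e \<xi> x * (\<Sum>b\<in>Basis. of_real (h \<bullet> b) * ?g b x))
        \<le> ((norm h)\<^sup>2 * (norm x)\<^sup>2) * norm (f x)"
      by (simp only: norm_mult norm_exp_inner mult_1_left) (intro mult_right_mono, auto)
    then show "norm (?e (\<xi> + h) x * f x - ?e \<xi> x * f x - ?e \<xi> x * (\<Sum>b\<in>Basis. of_real (h \<bullet> b) * ?g b x))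
        \<le> (norm h)\<^sup>2 * norm (of_real (x \<bullet> x) * f x)"
      by (simp only: norm_mult norm_of_real dot_square_norm abs_power2 mult.assoc)
  qed
  also have "\<dots> = (LINT x|lborel. norm (of_real (x \<bullet> x) * f x)) * (norm h)\<^sup>2" by simp
  finally show "norm (fourier f (\<xi> + h) - fourier f \<xi> - (\<Sum>b\<in>Basis. (h \<bullet> b) *\<^sub>R fourier (?g b) \<xi>))
     \<le> (LINT x|lborel. norm (of_real (x \<bullet> x) * f x)) * (norm h)\<^sup>2"
    unfolding D_def .
qed

lemma dderiv_fourier:
  fixes f :: "'a::euclidean_space \<Rightarrow> complex"
  assumes f: "f \<in> schwartz" and b: "b \<in> Basis"
  shows "dderiv b (fourier f) = fourier (\<lambda>x. - \<i> * (of_real (x \<bullet> b) * f x))"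
proof
  fix \<xi>
  have "dderiv b (fourier f) \<xi> = (\<Sum>c\<in>Basis. (b \<bullet> c) *\<^sub>R fourier (\<lambda>x. - \<i> * (of_real (x \<bullet> c) * f x)) \<xi>)"
    using frechet_derivative_at[OF fourier_has_derivative[OF f], symmetric] by metis
  also have "\<dots> = (\<Sum>c\<in>Basis. if c = b then fourier (\<lambda>x. - \<i> * (of_real (x \<bullet> c) * f x)) \<xi> else 0)"
    using b by (intro sum.cong refl) (auto simp: inner_Basis)
  finally show "dderiv b (fourier f) \<xi> = fourier (\<lambda>x. - \<i> * (of_real (x \<bullet> b) * f x)) \<xi>"
    using b by simp
qed

text \<open>
  A majorant for passing to the limit under the integral in the next lemma: by the mean value theorem
  the quotient is controlled by the derivative at a point at distance at most \<open>1\<close> from \<open>x\<close>, and such a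
  shift changes the weight by at most a constant factor.
\<close>

lemma schwartz_difference_quotient_bound:
  fixes f :: "'a::euclidean_space \<Rightarrow> complex"
  assumes f: "f \<in> schwartz" and b: "b \<in> Basis"
  shows "\<exists>C. \<forall>x t. 0 < t \<and> t \<le> 1 \<longrightarrow>
     norm ((f (x + t *\<^sub>R b) - f x) / of_real t) \<le> C * (1 / (1 + (norm x)\<^sup>2) ^ DIM('a))"
proof -
  have "dderiv b f \<in> schwartz" by (rule schwartz_deriv[OF f b])
  from schwartz_weighted_bound[OF this, of "DIM('a)"] obtain C where
    C: "C \<ge> 0" "\<And>x. norm (dderiv b f x) \<le> C / (1 + (norm x)\<^sup>2) ^ DIM('a)" by blast
  define B where "B x = C * 3 ^ DIM('a) * (1 / (1 + (norm x)\<^sup>2) ^ DIM('a))" for x :: 'a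
  have "norm ((f (x + t *\<^sub>R b) - f x) / of_real t) \<le> B x"
    if t: "0 < t" "t \<le> 1" for x :: 'a and t :: real
  proof -
    have "norm (f (x + t *\<^sub>R b) - f (x + 0 *\<^sub>R b)) \<le> B x * norm (t - 0)"
    proof (rule differentiable_bound[of "{0..t}" "\<lambda>s. f (x + s *\<^sub>R b)"
          "\<lambda>s v. frechet_derivative f (at (x + s *\<^sub>R b)) (v *\<^sub>R b)"])
      fix s assume s: "s \<in> {0..t}"
      have "((\<lambda>s. x + s *\<^sub>R b) has_derivative (\<lambda>v. v *\<^sub>R b)) (at s within {0..t})"
        by (auto intro!: derivative_eq_intros)
      from has_derivative_compose[OF this schwartz_has_derivative[OF f]]
      show "((\<lambda>s. f (x + s *\<^sub>R b)) has_derivative (\<lambda>v. frechet_derivative f (at (x + s *\<^sub>R b)) (v *\<^sub>R b))) (at s within {0..t})" .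
      have lin: "linear (frechet_derivative f (at (x + s *\<^sub>R b)))"
        using has_derivative_linear[OF schwartz_has_derivative[OF f]] .
      have "norm (dderiv b f (x + s *\<^sub>R b)) \<le> B x"
      proof -
        let ?y = "x + s *\<^sub>R b"
        have "norm (s *\<^sub>R b) \<le> 1" using s t b by simp
        then have "norm x \<le> norm ?y + 1"
          using norm_triangle_ineq4[of ?y "s *\<^sub>R b"] by simp
        then have "(norm x)\<^sup>2 \<le> (norm ?y + 1)\<^sup>2" by (intro power_mono) auto
        also have "\<dots> \<le> 2 * (norm ?y)\<^sup>2 + 2"
          using zero_le_power2[of "norm ?y - 1"] by (simp add: power2_sum power2_diff)
        finally have "1 + (norm x)\<^sup>2 \<le> 3 * (1 + (norm ?y)\<^sup>2)" by (simp add: algebra_simps) (smt (verit) zero_le_power2)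
        then have "(1 + (norm x)\<^sup>2) ^ DIM('a) \<le> (3 * (1 + (norm ?y)\<^sup>2)) ^ DIM('a)"
          by (intro power_mono) (auto simp: add_nonneg_nonneg)
        then have "(1 + (norm x)\<^sup>2) ^ DIM('a) \<le> 3 ^ DIM('a) * (1 + (norm ?y)\<^sup>2) ^ DIM('a)"
          by (simp only: power_mult_distrib)
        moreover have "(1 + (norm x)\<^sup>2) ^ DIM('a) > 0" "(1 + (norm ?y)\<^sup>2) ^ DIM('a) > 0"
          by (simp_all add: add_pos_nonneg)
        ultimately have "C / (1 + (norm ?y)\<^sup>2) ^ DIM('a) \<le> B x"
          unfolding B_def using C(1) by (simp add: field_simps mult_left_mono)
        then show ?thesis using C(2)[of ?y] by linarith
      qed
      then show "onorm (\<lambda>v. frechet_derivative f (at (x + s *\<^sub>R b)) (v *\<^sub>R b)) \<le> B x"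
        by (intro onorm_le) (simp add: linear_scale[OF lin], metis mult.commute mult_right_mono abs_ge_zero)
    qed (use t in auto)
    then show ?thesis using t by (simp add: norm_divide divide_le_eq)
  qed
  then show ?thesis unfolding B_def by blast
qed

lemma integrable_weight: "integrable lborel (\<lambda>x::'a::euclidean_space. 1 / (1 + (norm x)\<^sup>2) ^ DIM('a))"
proof -
  have "integrable lborel (\<lambda>x::'a. norm x powr (- 0) / (1 + (norm x)\<^sup>2) ^ DIM('a))"
    by (rule integrable_radial_weight) auto
  then show ?thesis
  proof (rule integrable_cong_AE_imp)
    show "AE x::'a in lborel. norm x powr - 0 / (1 + (norm x)\<^sup>2) ^ DIM('a) = 1 / (1 + (norm x)\<^sup>2) ^ DIM('a)"
      using lborel_AE_nonzero by (rule AE_mp) (intro AE_I2, simp)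
  qed measurable
qed

text \<open>
  Translation becomes multiplication by a character; dividing the difference by the step and letting it
  tend to \<open>0\<close> replaces an integration by parts.
\<close>

lemma fourier_dderiv:
  fixes f :: "'a::euclidean_space \<Rightarrow> complex"
  assumes f: "f \<in> schwartz" and b: "b \<in> Basis"
  shows "fourier (dderiv b f) \<xi> = \<i> * of_real (\<xi> \<bullet> b) * fourier f \<xi>"
proof -
  note [measurable] = schwartz_borel_measurable[OF f]
  have [measurable]: "dderiv b f \<in> borel_measurable borel"
    by (intro schwartz_borel_measurable schwartz_deriv f b)
  let ?e = "\<lambda>x. exp (- (\<i> * complex_of_real (x \<bullet> \<xi>)))"
  define t where "t n = inverse (real (Suc n))" for n
  have t: "0 < t n" "t n \<le> 1" "t n \<noteq> 0" for n by (auto simp: t_def inverse_le_1_iff)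
  have t0: "t \<longlonglongrightarrow> 0" unfolding t_def by (rule LIMSEQ_inverse_real_of_nat)
  then have t_at: "filterlim t (at 0) sequentially" using t by (simp add: filterlim_at)
  obtain C where C: "\<And>x t. 0 < t \<Longrightarrow> t \<le> 1 \<Longrightarrow>
     norm ((f (x + t *\<^sub>R b) - f x) / of_real t) \<le> C * (1 / (1 + (norm x)\<^sup>2) ^ DIM('a))"
    using schwartz_difference_quotient_bound[OF f b] by blast
  have "(\<lambda>n. LINT x|lborel. ?e x * ((f (x + t n *\<^sub>R b) - f x) / of_real (t n))) \<longlonglongrightarrow> (LINT x|lborel. ?e x * dderiv b f x)"
  proof (rule integral_dominated_convergence)
    show "integrable lborel (\<lambda>x::'a. C * (1 / (1 + (norm x)\<^sup>2) ^ DIM('a)))"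
      by (intro integrable_mult_right integrable_weight)
    show "AE x in lborel. norm (?e x * ((f (x + t n *\<^sub>R b) - f x) / of_real (t n))) \<le> C * (1 / (1 + (norm x)\<^sup>2) ^ DIM('a))" for n
      by (intro AE_I2, subst norm_mult, subst norm_exp_inner, subst mult_1_left, rule C[OF t(1,2)])
    show "AE x in lborel. (\<lambda>n. ?e x * ((f (x + t n *\<^sub>R b) - f x) / of_real (t n))) \<longlonglongrightarrow> ?e x * dderiv b f x"
    proof (intro AE_I2 tendsto_mult tendsto_const)
      fix x
      have "((\<lambda>s. x + s *\<^sub>R b) has_derivative (\<lambda>v. v *\<^sub>R b)) (at 0)"
        by (auto intro!: derivative_eq_intros)
      from has_derivative_compose[OF this, of f "frechet_derivative f (at x)"]
      have d: "((\<lambda>s. f (x + s *\<^sub>R b)) has_derivative (\<lambda>v. frechet_derivative f (at x) (v *\<^sub>R b))) (at 0)"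
        using schwartz_has_derivative[OF f] by simp
      have "(\<lambda>s. norm ((f (x + s *\<^sub>R b) - f x) /\<^sub>R s - dderiv b f x)) \<midarrow>0\<rightarrow> 0"
      proof (rule Lim_transform_eventually)
        show "(\<lambda>s. norm (f (x + s *\<^sub>R b) - f x - frechet_derivative f (at x) (s *\<^sub>R b)) / norm s) \<midarrow>0\<rightarrow> 0"
          using d by (simp add: has_derivative_at)
        have "norm (f (x + s *\<^sub>R b) - f x - frechet_derivative f (at x) (s *\<^sub>R b)) / norm s
            = norm ((f (x + s *\<^sub>R b) - f x) /\<^sub>R s - dderiv b f x)" if "s \<noteq> 0" for s
        proof -
          have "(f (x + s *\<^sub>R b) - f x) /\<^sub>R s - dderiv b f x
              = (f (x + s *\<^sub>R b) - f x - frechet_derivative f (at x) (s *\<^sub>R b)) /\<^sub>R s"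
            using that linear_scale[OF has_derivative_linear[OF schwartz_has_derivative[OF f]], of x s b]
            by (simp add: algebra_simps)
          then show ?thesis by (simp add: divide_inverse)
        qed
        then show "\<forall>\<^sub>F s in at 0. norm (f (x + s *\<^sub>R b) - f x - frechet_derivative f (at x) (s *\<^sub>R b)) / norm s
            = norm ((f (x + s *\<^sub>R b) - f x) /\<^sub>R s - dderiv b f x)"
          by (simp add: eventually_at_filter)
      qed
      then have "(\<lambda>s. (f (x + s *\<^sub>R b) - f x) /\<^sub>R s) \<midarrow>0\<rightarrow> dderiv b f x"
        by (rule LIM_zero_cancel[OF tendsto_norm_zero_cancel])
      from filterlim_compose[OF this t_at]
      show "(\<lambda>n. (f (x + t n *\<^sub>R b) - f x) / of_real (t n)) \<longlonglongrightarrow> dderiv b f x"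
        by (simp add: scaleR_conv_of_real divide_inverse mult.commute)
    qed
  qed measurable
  moreover have "(LINT x|lborel. ?e x * ((f (x + t n *\<^sub>R b) - f x) / of_real (t n)))
      = (exp (\<i> * of_real (\<xi> \<bullet> b) * of_real (t n)) - 1) / of_real (t n) * fourier f \<xi>" for n
  proof -
    have i: "integrable lborel (\<lambda>x. ?e x * f x)"
      by (rule integrable_unimodular_mult[OF schwartz_integrable[OF f]])
    let ?u = "exp (\<i> * of_real (\<xi> \<bullet> b) * of_real (t n))"
    have sh: "?e x * f (x + t n *\<^sub>R b) = ?u * (?e (t n *\<^sub>R b + 1 *\<^sub>R x) * f (t n *\<^sub>R b + 1 *\<^sub>R x))" for x
    proof -
      have "?e x = ?u * ?e (t n *\<^sub>R b + 1 *\<^sub>R x)"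
        by (simp add: inner_add_left distrib_left inner_commute[of b] flip: exp_add)
      then show ?thesis by (simp add: add.commute mult.assoc)
    qed
    have "integrable lborel (\<lambda>x. ?e (t n *\<^sub>R b + 1 *\<^sub>R x) * f (t n *\<^sub>R b + 1 *\<^sub>R x))"
      using lborel_integrable_affine[of "\<lambda>x. ?e x * f x" 1 "t n *\<^sub>R b"] i by simp
    then have i2: "integrable lborel (\<lambda>x. ?e x * f (x + t n *\<^sub>R b))" unfolding sh by simp
    have "(LINT x|lborel. ?e x * f (x + t n *\<^sub>R b)) = ?u * fourier f \<xi>"
      unfolding sh fourier_def
      using lborel_integral_affine[of "\<lambda>x. ?e x * f x" 1 "t n *\<^sub>R b"] by simp
    moreover have "(LINT x|lborel. ?e x * ((f (x + t n *\<^sub>R b) - f x) / of_real (t n)))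
       = ((LINT x|lborel. ?e x * f (x + t n *\<^sub>R b)) - (LINT x|lborel. ?e x * f x)) / of_real (t n)"
      using i i2 by (simp add: right_diff_distrib diff_divide_distrib)
    ultimately show ?thesis by (simp add: fourier_def algebra_simps)
  qed
  moreover have "(\<lambda>n. (exp (\<i> * of_real (\<xi> \<bullet> b) * of_real (t n)) - 1) / of_real (t n) * fourier f \<xi>)
      \<longlonglongrightarrow> \<i> * of_real (\<xi> \<bullet> b) * fourier f \<xi>"
  proof (intro tendsto_mult tendsto_const)
    have "((\<lambda>z. exp (\<i> * of_real (\<xi> \<bullet> b) * z)) has_field_derivative \<i> * of_real (\<xi> \<bullet> b)) (at 0)"
      by (auto intro!: derivative_eq_intros)
    then have "((\<lambda>z. (exp (\<i> * of_real (\<xi> \<bullet> b) * z) - 1) / z) \<longlongrightarrow> \<i> * of_real (\<xi> \<bullet> b)) (at 0)"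
      by (simp add: has_field_derivative_iff)
    moreover have "filterlim (\<lambda>n. complex_of_real (t n)) (at 0) sequentially"
      using tendsto_of_real[OF t0] t by (simp add: filterlim_at)
    ultimately show "(\<lambda>n. (exp (\<i> * of_real (\<xi> \<bullet> b) * of_real (t n)) - 1) / of_real (t n)) \<longlonglongrightarrow> \<i> * of_real (\<xi> \<bullet> b)"
      by (rule filterlim_compose)
  qed
  ultimately show ?thesis
    unfolding fourier_def[of "dderiv b f"] by (simp only: LIMSEQ_unique)
qed

text \<open>
  The image of the Schwartz space is itself a stable family. Its members decay because
  \<open>(1 + |\<xi>|\<^sup>2)\<^sup>k\<close> times the Fourier transform of \<open>f\<close> is the Fourier transform of \<open>(1 - \<Delta>)\<^sup>k f\<close>, hence
  bounded.
\<close>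

lemma fourier_schwartz:
  fixes f :: "'a::euclidean_space \<Rightarrow> complex"
  assumes "f \<in> schwartz"
  shows "fourier f \<in> schwartz"
proof (rule schwartz_coinduct[where A = "fourier ` schwartz"])
    fix F :: "'a \<Rightarrow> complex" assume "F \<in> fourier ` schwartz"
    then obtain f where F: "F = fourier f" and f: "f \<in> schwartz" by blast
      show "F differentiable (at x)" for x
      unfolding F using fourier_has_derivative[OF f] differentiable_def by blast
    show "dderiv b F \<in> fourier ` schwartz" if b: "b \<in> Basis" for b
      unfolding F dderiv_fourier[OF f b]
      by (intro imageI schwartz_scale schwartz_coord f b)
    show "\<exists>C. \<forall>x. norm x ^ k * norm (F x) \<le> C" for k
    proof -
      have "\<exists>g\<in>schwartz. \<forall>\<xi>. fourier g \<xi> = of_real (1 + \<xi> \<bullet> \<xi>) ^ k * fourier f \<xi>"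
      proof (induction k)
        case (Suc k)
        then obtain g where g: "g \<in> schwartz" "\<And>\<xi>. fourier g \<xi> = of_real (1 + \<xi> \<bullet> \<xi>) ^ k * fourier f \<xi>" by blast
        let ?l = "\<lambda>x. \<Sum>b\<in>Basis. dderiv b (dderiv b g) x"
        have dd: "dderiv b g \<in> schwartz" "dderiv b (dderiv b g) \<in> schwartz" if "b \<in> Basis" for b
          by (intro schwartz_deriv g that)+
        have l: "?l \<in> schwartz"
          by (intro schwartz_sum finite_Basis dd)
        have "fourier ?l \<xi> = - (of_real (\<xi> \<bullet> \<xi>) * fourier g \<xi>)" for \<xi>
        proof -
          have "fourier ?l \<xi> = (\<Sum>b\<in>Basis. fourier (dderiv b (dderiv b g)) \<xi>)"
            by (rule fourier_sum) (auto simp: dd schwartz_integrable)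
          also have "\<dots> = (\<Sum>b\<in>Basis. - (of_real ((\<xi> \<bullet> b) * (\<xi> \<bullet> b)) * fourier g \<xi>))"
          proof (intro sum.cong refl)
            fix b :: 'a assume b: "b \<in> Basis"
            have "fourier (dderiv b (dderiv b g)) \<xi> = (\<i> * \<i>) * (of_real (\<xi> \<bullet> b) * of_real (\<xi> \<bullet> b) * fourier g \<xi>)"
              unfolding fourier_dderiv[OF dd(1)[OF b] b] fourier_dderiv[OF g(1) b] by (simp only: ac_simps)
            then show "fourier (dderiv b (dderiv b g)) \<xi> = - (of_real ((\<xi> \<bullet> b) * (\<xi> \<bullet> b)) * fourier g \<xi>)"
              by (simp only: i_squared of_real_mult) simp
          qed
          finally show ?thesis by (simp add: euclidean_inner[of \<xi> \<xi>] sum_negf sum_distrib_right)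
        qed
        then have "fourier (\<lambda>x. -1 * ?l x + g x) \<xi> = of_real (1 + \<xi> \<bullet> \<xi>) ^ Suc k * fourier f \<xi>" for \<xi>
          using fourier_lincomb[OF schwartz_integrable[OF l] schwartz_integrable[OF g(1)], of "-1" \<xi>]
          by (simp add: g(2) algebra_simps)
        moreover have "(\<lambda>x. -1 * ?l x + g x) \<in> schwartz"
          by (intro schwartz_lincomb l g)
        ultimately show ?case by blast
      qed (use f in auto)
      then obtain g where g: "g \<in> schwartz" "\<And>\<xi>. fourier g \<xi> = of_real (1 + \<xi> \<bullet> \<xi>) ^ k * fourier f \<xi>" by blast
      have "norm \<xi> ^ k * norm (F \<xi>) \<le> (LINT x|lborel. norm (g x))" for \<xi>
      proof -
        have "norm \<xi> \<le> 1 + \<xi> \<bullet> \<xi>"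
        proof -
          have "2 * norm \<xi> \<le> (norm \<xi>)\<^sup>2 + 1"
            using zero_le_power2[of "norm \<xi> - 1"] by (simp add: power2_diff)
          then show ?thesis using zero_le_power2[of "norm \<xi>"] unfolding dot_square_norm by linarith
        qed
        then have "norm \<xi> ^ k * norm (F \<xi>) \<le> (1 + \<xi> \<bullet> \<xi>) ^ k * norm (F \<xi>)"
          by (intro mult_right_mono power_mono) auto
        also have "\<dots> = norm (fourier g \<xi>)"
        proof -
          have "norm (complex_of_real (1 + \<xi> \<bullet> \<xi>)) = 1 + \<xi> \<bullet> \<xi>"
            unfolding norm_of_real by simp
          then show ?thesis by (simp only: g(2) F norm_mult norm_power)
        qed
        finally show ?thesis using norm_fourier_le[of g \<xi>] by linarith
      qed
      then show ?thesis by blast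
    qed
qed (use assms in auto)

section \<open>Fourier inversion\<close>

lemma
  fixes K :: "'a::euclidean_space \<Rightarrow> 'b::euclidean_space \<Rightarrow> 'c::{banach,second_countable_topology}"
  assumes meas: "case_prod K \<in> borel_measurable (borel \<Otimes>\<^sub>M borel)"
    and int: "\<And>x. integrable lborel (K x)"
    and bound: "\<And>x. (LINT y|lborel. norm (K x y)) \<le> B x"
    and B: "integrable lborel B"
  shows lborel_fubini_dominated: "(LINT x|lborel. LINT y|lborel. K x y) = (LINT y|lborel. LINT x|lborel. K x y)"
    and lborel_integrable_fubini_dominated: "integrable lborel (\<lambda>y. LINT x|lborel. K x y)"
proof -
  have meas': "case_prod K \<in> borel_measurable (lborel \<Otimes>\<^sub>M lborel)"
    using meas by (simp cong: measurable_cong_sets)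
  have I: "integrable (lborel \<Otimes>\<^sub>M lborel) (case_prod K)"
  proof (rule lborel_pair.Fubini_integrable[OF meas'])
    show "AE x in lborel. integrable lborel (\<lambda>y. case_prod K (x, y))" using int by simp
    have "(\<lambda>x. LINT y|lborel. norm (K x y)) \<in> borel_measurable lborel"
      using meas' by (intro lborel.borel_measurable_lebesgue_integral) (simp add: split_beta')
    moreover have "0 \<le> (LINT y|lborel. norm (K x y))" for x by simp
    ultimately have "integrable lborel (\<lambda>x. LINT y|lborel. norm (K x y))"
      by (intro Bochner_Integration.integrable_bound[OF B] AE_I2)
         (use bound in \<open>auto intro!: order_trans[OF _ abs_ge_self]\<close>)
    then show "integrable lborel (\<lambda>x. LINT y|lborel. norm (case_prod K (x, y)))" by simp
  qed
  from lborel_pair.Fubini_integral[OF I]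
  show "(LINT x|lborel. LINT y|lborel. K x y) = (LINT y|lborel. LINT x|lborel. K x y)" by simp
  from lborel_pair.integrable_snd[OF I]
  show "integrable lborel (\<lambda>y. LINT x|lborel. K x y)" by simp
qed

lemma exp_inner_add_left:
  "exp (- (\<i> * of_real ((x + y) \<bullet> \<xi>))) = exp (- (\<i> * of_real (x \<bullet> \<xi>))) * exp (- (\<i> * of_real (y \<bullet> \<xi>)))"
  by (simp add: inner_add_left distrib_left flip: exp_add)

text \<open>
  Gaussian damping makes the double integral absolutely convergent, so that the integrations can be
  exchanged.
\<close>

lemma integral_fourier_gaussian:
  fixes f :: "'a::euclidean_space \<Rightarrow> complex"
  assumes f: "integrable lborel f" and s: "\<sigma> > 0"
  shows "(LINT \<xi>|lborel. exp (- (\<i> * of_real (\<xi> \<bullet> x))) * of_real (exp (- (\<sigma> * (\<xi> \<bullet> \<xi>)))) * fourier f \<xi>)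
    = (2 * pi) ^ DIM('a) * (LINT y|lborel. of_real (heat_kernel \<sigma> (x + y)) * f y)"
proof -
  have [measurable]: "f \<in> borel_measurable borel" using f by simp
  define K where "K y \<xi> = exp (- (\<i> * of_real ((x + y) \<bullet> \<xi>))) * of_real (exp (- (\<sigma> * (\<xi> \<bullet> \<xi>)))) * f y"
    for y \<xi> :: 'a
  have cont: "continuous_on UNIV (\<lambda>p::'a \<times> 'a. exp (- (\<i> * complex_of_real ((x + fst p) \<bullet> snd p))) * complex_of_real (exp (- (\<sigma> * (snd p \<bullet> snd p)))))"
    by (intro continuous_intros)
  have meas: "case_prod K \<in> borel_measurable (borel \<Otimes>\<^sub>M borel)"
  proof -
    have [measurable]: "(\<lambda>p::'a \<times> 'a. exp (- (\<i> * complex_of_real ((x + fst p) \<bullet> snd p))) * complex_of_real (exp (- (\<sigma> * (snd p \<bullet> snd p))))) \<in> borel_measurable (borel \<Otimes>\<^sub>M borel)"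
      using borel_measurable_continuous_onI[OF cont] by (simp add: borel_prod)
    show ?thesis unfolding K_def split_beta' by measurable
  qed
  have "(LINT \<xi>|lborel. exp (- (\<i> * of_real (\<xi> \<bullet> x))) * of_real (exp (- (\<sigma> * (\<xi> \<bullet> \<xi>)))) * fourier f \<xi>)
    = (LINT \<xi>|lborel. LINT y|lborel. K y \<xi>)"
  proof (rule Bochner_Integration.integral_cong[OF refl])
    fix \<xi> :: 'a
    have "exp (- (\<i> * of_real (\<xi> \<bullet> x))) * of_real (exp (- (\<sigma> * (\<xi> \<bullet> \<xi>)))) * fourier f \<xi>
      = (LINT y|lborel. (exp (- (\<i> * of_real (\<xi> \<bullet> x))) * of_real (exp (- (\<sigma> * (\<xi> \<bullet> \<xi>))))) * (exp (- (\<i> * of_real (y \<bullet> \<xi>))) * f y))"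
      unfolding fourier_def by (rule integral_mult_right_zero[symmetric])
    then show "exp (- (\<i> * of_real (\<xi> \<bullet> x))) * of_real (exp (- (\<sigma> * (\<xi> \<bullet> \<xi>)))) * fourier f \<xi> = (LINT y|lborel. K y \<xi>)"
      unfolding K_def exp_inner_add_left by (simp only: ac_simps inner_commute[of \<xi> x])
  qed
  also have "\<dots> = (LINT y|lborel. LINT \<xi>|lborel. K y \<xi>)"
  proof (rule lborel_fubini_dominated[symmetric, OF meas])
    have g: "integrable lborel (\<lambda>\<xi>::'a. exp (- (\<i> * of_real (z \<bullet> \<xi>))) * of_real (exp (- (\<sigma> * (\<xi> \<bullet> \<xi>)))))" for z :: 'a
      using fourier_gaussian[OF s, of z] by (simp add: has_bochner_integral_iff)
    then show "integrable lborel (K y)" for y unfolding K_def by simp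
    show "(LINT \<xi>|lborel. norm (K y \<xi>)) \<le> (LINT \<xi>::'a|lborel. exp (- (\<sigma> * (\<xi> \<bullet> \<xi>)))) * norm (f y)" for y
      unfolding K_def by (simp add: norm_mult)
    show "integrable lborel (\<lambda>y. (LINT \<xi>::'a|lborel. exp (- (\<sigma> * (\<xi> \<bullet> \<xi>)))) * norm (f y))"
      using f by simp
  qed
  also have "\<dots> = (LINT y|lborel. of_real ((2 * pi) ^ DIM('a) * heat_kernel \<sigma> (x + y)) * f y)"
  proof (rule Bochner_Integration.integral_cong[OF refl])
    fix y :: 'a
    show "(LINT \<xi>|lborel. K y \<xi>) = of_real ((2 * pi) ^ DIM('a) * heat_kernel \<sigma> (x + y)) * f y"
      using fourier_gaussian[OF s, of "x + y"] unfolding K_def by (simp add: has_bochner_integral_iff)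
  qed
  finally show ?thesis by (simp add: mult.assoc)
qed

text \<open>
  The rescaling \<open>y = - x + z / (n + 1)\<close> makes the kernel independent of \<open>n\<close>; continuity of \<open>f\<close> and dominated
  convergence then give the limit.
\<close>

lemma integral_heat_kernel_tendsto:
  fixes f :: "'a::euclidean_space \<Rightarrow> complex"
  assumes cont: "continuous_on UNIV f" and bound: "\<And>x. norm (f x) \<le> M"
  shows "(\<lambda>n. LINT y|lborel. of_real (heat_kernel ((inverse (real (Suc n)))\<^sup>2) (x + y)) * f y) \<longlonglongrightarrow> f (- x)"
proof -
  have [measurable]: "f \<in> borel_measurable borel" by (rule borel_measurable_continuous_onI[OF cont])
  have hk: "has_bochner_integral lborel (heat_kernel 1 :: 'a \<Rightarrow> real) 1"
    by (rule heat_kernel_has_integral) simp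
  let ?r = "\<lambda>n. inverse (real (Suc n))"
  have eq: "(LINT y|lborel. of_real (heat_kernel ((?r n)\<^sup>2) (x + y)) * f y)
     = (LINT z|lborel. of_real (heat_kernel 1 z) * f (- x + ?r n *\<^sub>R z))" for n
  proof -
    have r: "?r n > 0" by simp
    have scale: "?r n ^ DIM('a) * heat_kernel ((?r n)\<^sup>2) (?r n *\<^sub>R z) = heat_kernel 1 z" for z :: 'a
    proof -
      have "sqrt (4 * pi * (?r n)\<^sup>2) = ?r n * sqrt (4 * pi)"
        by (simp add: real_sqrt_mult)
      moreover have "(?r n *\<^sub>R z) \<bullet> (?r n *\<^sub>R z) / (4 * (?r n)\<^sup>2) = z \<bullet> z / 4"
        using r by (simp add: power2_eq_square field_simps del: of_nat_Suc)
      ultimately show ?thesis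
        unfolding heat_kernel_def using r by (simp add: power_mult_distrib del: of_nat_Suc)
    qed
    have "(LINT y|lborel. of_real (heat_kernel ((?r n)\<^sup>2) (x + y)) * f y)
      = ?r n ^ DIM('a) *\<^sub>R (LINT z|lborel. of_real (heat_kernel ((?r n)\<^sup>2) (x + (- x + ?r n *\<^sub>R z))) * f (- x + ?r n *\<^sub>R z))"
      using r by (subst lborel_integral_affine[of _ "?r n" "- x"]) (auto simp del: of_nat_Suc)
    also have "\<dots> = (LINT z|lborel. ?r n ^ DIM('a) *\<^sub>R (of_real (heat_kernel ((?r n)\<^sup>2) (?r n *\<^sub>R z)) * f (- x + ?r n *\<^sub>R z)))"
      by simp
    also have "\<dots> = (LINT z|lborel. of_real (heat_kernel 1 z) * f (- x + ?r n *\<^sub>R z))"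
      unfolding scale[symmetric] by (simp add: scaleR_conv_of_real mult.assoc)
    finally show ?thesis .
  qed
  have "(\<lambda>n. LINT z|lborel. of_real (heat_kernel 1 z) * f (- x + ?r n *\<^sub>R z)) \<longlonglongrightarrow> (LINT z::'a|lborel. of_real (heat_kernel 1 z) * f (- x))"
  proof (rule integral_dominated_convergence)
    show "integrable lborel (\<lambda>z::'a. M * heat_kernel 1 z)"
      using hk by (simp add: has_bochner_integral_iff)
    show "AE z in lborel. (\<lambda>n. of_real (heat_kernel 1 z) * f (- x + ?r n *\<^sub>R z)) \<longlonglongrightarrow> of_real (heat_kernel 1 z) * f (- x)"
    proof (intro AE_I2 tendsto_mult tendsto_const)
      fix z
      have "(\<lambda>n. - x + ?r n *\<^sub>R z) \<longlonglongrightarrow> - x + 0 *\<^sub>R z"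
        by (intro tendsto_intros LIMSEQ_inverse_real_of_nat)
      then show "(\<lambda>n. f (- x + ?r n *\<^sub>R z)) \<longlonglongrightarrow> f (- x)"
        using continuous_on_tendsto_compose[OF cont] by simp
    qed
    show "AE z in lborel. norm (of_real (heat_kernel 1 z) * f (- x + ?r n *\<^sub>R z)) \<le> M * heat_kernel 1 z" for n
    proof (intro AE_I2)
      fix z
      have "heat_kernel 1 z * norm (f (- x + ?r n *\<^sub>R z)) \<le> heat_kernel 1 z * M"
        by (intro mult_left_mono bound heat_kernel_nonneg) simp
      then show "norm (of_real (heat_kernel 1 z) * f (- x + ?r n *\<^sub>R z)) \<le> M * heat_kernel 1 z"
        by (simp only: norm_mult norm_of_real abs_of_nonneg[OF heat_kernel_nonneg[OF zero_le_one]] mult.commute[of M])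
    qed
  qed measurable
  moreover have "(LINT z::'a|lborel. of_real (heat_kernel 1 z) * f (- x)) = f (- x)"
    using hk by (simp add: has_bochner_integral_iff)
  ultimately show ?thesis unfolding eq by (simp only:)
qed

text \<open>
  With the convention used here the Fourier transform applied twice is \<open>(2 \<pi>)\<^sup>d\<close> times the reflection. In this
  form no separate inverse transform has to be introduced: up to a constant, the inverse is the third
  power.
\<close>

theorem fourier_inversion:
  fixes f :: "'a::euclidean_space \<Rightarrow> complex"
  assumes f: "f \<in> schwartz"
  shows "fourier (fourier f) x = (2 * pi) ^ DIM('a) * f (- x)"
proof -
  let ?s = "\<lambda>n. (inverse (real (Suc n)))\<^sup>2"
  have F: "integrable lborel (fourier f)" by (intro schwartz_integrable fourier_schwartz f)
  have [measurable]: "fourier f \<in> borel_measurable borel" using F by simp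
  have spos: "?s n > 0" for n by simp
  have s0: "?s \<longlonglongrightarrow> 0" using tendsto_power[OF LIMSEQ_inverse_real_of_nat, of 2] by simp
  have "(\<lambda>n. LINT \<xi>|lborel. exp (- (\<i> * of_real (\<xi> \<bullet> x))) * of_real (exp (- (?s n * (\<xi> \<bullet> \<xi>)))) * fourier f \<xi>)
     \<longlonglongrightarrow> (LINT \<xi>|lborel. exp (- (\<i> * of_real (\<xi> \<bullet> x))) * of_real 1 * fourier f \<xi>)"
  proof (rule integral_dominated_convergence)
    show "integrable lborel (\<lambda>\<xi>. norm (fourier f \<xi>))" using F by simp
    show "AE \<xi> in lborel. norm (exp (- (\<i> * of_real (\<xi> \<bullet> x))) * of_real (exp (- (?s n * (\<xi> \<bullet> \<xi>)))) * fourier f \<xi>) \<le> norm (fourier f \<xi>)" for n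
      by (intro AE_I2) (simp add: norm_mult mult_left_le_one_le)
    show "AE \<xi> in lborel. (\<lambda>n. exp (- (\<i> * of_real (\<xi> \<bullet> x))) * of_real (exp (- (?s n * (\<xi> \<bullet> \<xi>)))) * fourier f \<xi>)
       \<longlonglongrightarrow> exp (- (\<i> * of_real (\<xi> \<bullet> x))) * of_real 1 * fourier f \<xi>"
    proof (intro AE_I2 tendsto_mult tendsto_const tendsto_of_real)
      fix \<xi> :: 'a
      have "(\<lambda>n. exp (- (?s n * (\<xi> \<bullet> \<xi>)))) \<longlonglongrightarrow> exp (- (0 * (\<xi> \<bullet> \<xi>)))"
        by (intro tendsto_intros s0)
      then show "(\<lambda>n. exp (- (?s n * (\<xi> \<bullet> \<xi>)))) \<longlonglongrightarrow> 1" by simp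
    qed
  qed measurable
  then have 1: "(\<lambda>n. (2 * pi) ^ DIM('a) * (LINT y|lborel. of_real (heat_kernel (?s n) (x + y)) * f y)) \<longlonglongrightarrow> fourier (fourier f) x"
    unfolding integral_fourier_gaussian[OF schwartz_integrable[OF f] spos]
    by (simp only: of_real_1 mult_1_right fourier_def[of "fourier f"])
  obtain M where "\<And>x. norm (f x) \<le> M" using schwartz_decay[OF f, of 0] by auto
  from tendsto_mult_left[OF integral_heat_kernel_tendsto[OF schwartz_continuous[OF f] this], of "(2 * pi) ^ DIM('a)"]
  have "(\<lambda>n. (2 * pi) ^ DIM('a) * (LINT y|lborel. of_real (heat_kernel (?s n) (x + y)) * f y)) \<longlonglongrightarrow> (2 * pi) ^ DIM('a) * f (- x)" .
  from LIMSEQ_unique[OF 1 this] show ?thesis .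
qed

section \<open>Vanishing moments and the logarithmic Laplacian\<close>

lemma partial_deriv_fourier:
  fixes f :: "'a::euclidean_space \<Rightarrow> complex"
  assumes "f \<in> schwartz" "bs \<in> lists Basis"
  shows "partial_deriv bs (fourier f) = fourier (\<lambda>x. (\<Prod>b\<leftarrow>bs. - \<i> * of_real (x \<bullet> b)) * f x)"
    and "(\<lambda>x. (\<Prod>b\<leftarrow>bs. - \<i> * of_real (x \<bullet> b)) * f x) \<in> schwartz"
proof -
  have "partial_deriv bs (fourier f) = fourier (\<lambda>x. (\<Prod>b\<leftarrow>bs. - \<i> * of_real (x \<bullet> b)) * f x)
     \<and> (\<lambda>x. (\<Prod>b\<leftarrow>bs. - \<i> * of_real (x \<bullet> b)) * f x) \<in> schwartz"
    using assms(2)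
  proof (induction bs)
    case (Cons b bs)
    let ?g = "\<lambda>x. (\<Prod>b\<leftarrow>bs. - \<i> * of_real (x \<bullet> b)) * f x"
    have g: "?g \<in> schwartz" and b: "b \<in> Basis"
      and IH: "partial_deriv bs (fourier f) = fourier ?g" using Cons by auto
    have eq: "(\<lambda>x. - \<i> * (of_real (x \<bullet> b) * ?g x)) = (\<lambda>x. (\<Prod>b\<leftarrow>b # bs. - \<i> * of_real (x \<bullet> b)) * f x)"
      by (simp add: mult.assoc)
    have "(\<lambda>x. - \<i> * (of_real (x \<bullet> b) * ?g x)) \<in> schwartz"
      by (intro schwartz_scale schwartz_coord g b)
    moreover have "partial_deriv (b # bs) (fourier f) = fourier (\<lambda>x. - \<i> * (of_real (x \<bullet> b) * ?g x))"
      unfolding partial_deriv.simps IH by (rule dderiv_fourier[OF g b])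
    ultimately show ?case unfolding eq by blast
  qed (use assms(1) in auto)
  then show "partial_deriv bs (fourier f) = fourier (\<lambda>x. (\<Prod>b\<leftarrow>bs. - \<i> * of_real (x \<bullet> b)) * f x)"
    and "(\<lambda>x. (\<Prod>b\<leftarrow>bs. - \<i> * of_real (x \<bullet> b)) * f x) \<in> schwartz" by auto
qed

lemma prod_list_coords_monomial:
  assumes "bs \<in> lists Basis"
  shows "(\<Prod>b\<leftarrow>bs. - \<i> * of_real (x \<bullet> b)) = (- \<i>) ^ length bs * of_real (monomial (count_list bs) x)"
  using assms
proof (induction bs)
  case Nil
  then show ?case by (simp add: monomial_def)
next
  case (Cons c bs)
  have c: "c \<in> Basis" using Cons by auto
  have "monomial (count_list (c # bs)) x = (\<Prod>b\<in>Basis. (if b = c then x \<bullet> c else 1) * (x \<bullet> b) ^ count_list bs b)"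
    unfolding monomial_def by (intro prod.cong refl) auto
  also have "\<dots> = (x \<bullet> c) * monomial (count_list bs) x"
    unfolding prod.distrib monomial_def using c by simp
  finally have M: "monomial (count_list (c # bs)) x = (x \<bullet> c) * monomial (count_list bs) x" .
  show ?case using Cons by (simp add: M del: count_list.simps)
qed

text \<open>
  This translates between the monomials in the
  definition of the Lizorkin space and the lists that index partial derivatives.
\<close>

lemma ex_list_count:
  fixes \<alpha> :: "'b \<Rightarrow> nat"
  assumes "finite B"
  shows "\<exists>bs\<in>lists B. \<forall>b\<in>B. count_list bs b = \<alpha> b"
  using assms
proof (induction B rule: finite_induct)
  case (insert c B)
  then obtain bs where bs: "bs \<in> lists B" "\<forall>b\<in>B. count_list bs b = \<alpha> b" by blast
  have "c \<notin> set bs" using bs(1) insert(2) by auto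
  then have "count_list bs c = 0" by (simp add: count_notin)
  moreover have "replicate (\<alpha> c) c @ bs \<in> lists (insert c B)"
    using bs(1) by (auto simp: in_lists_conv_set)
  moreover have "count_list (replicate n c) b = (if b = c then n else 0)" for n b
    by (induction n) auto
  ultimately show ?case
    using bs insert(2) by (intro bexI[of _ "replicate (\<alpha> c) c @ bs"]) auto
qed simp

text \<open>
  Up to powers of \<open>- \<i>\<close>, the moments of \<open>f\<close> are the derivatives of its Fourier transform at the origin.
\<close>

lemma lizorkin_iff_fourier_flat:
  "f \<in> lizorkin \<longleftrightarrow> f \<in> schwartz \<and> fourier f \<in> schwartz_flat {0}" for f :: "'a::euclidean_space \<Rightarrow> complex"
proof -
  have key: "partial_deriv bs (fourier f) 0 = (- \<i>) ^ length bs * (LINT x|lborel. of_real (monomial (count_list bs) x) * f x)"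
    if f: "f \<in> schwartz" and bs: "bs \<in> lists Basis" for bs
    unfolding partial_deriv_fourier(1)[OF f bs] prod_list_coords_monomial[OF bs]
    by (simp add: fourier_def mult.assoc)
  show ?thesis
  proof
    assume "f \<in> lizorkin"
    then have f: "f \<in> schwartz" and z: "\<And>\<alpha>. (LINT x|lborel. of_real (monomial \<alpha> x) * f x) = 0"
      by (auto simp: lizorkin_def)
    have "partial_deriv bs (fourier f) 0 = 0" if "bs \<in> lists Basis" for bs
      using key[OF f that] z by simp
    then show "f \<in> schwartz \<and> fourier f \<in> schwartz_flat {0}"
      using f fourier_schwartz[OF f] by (simp add: schwartz_flat_def)
  next
    assume "f \<in> schwartz \<and> fourier f \<in> schwartz_flat {0}"
    then have f: "f \<in> schwartz" and z: "\<And>bs. bs \<in> lists Basis \<Longrightarrow> partial_deriv bs (fourier f) 0 = 0"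
      by (auto simp: schwartz_flat_def)
    have "(LINT x|lborel. of_real (monomial \<alpha> x) * f x) = 0" for \<alpha>
    proof -
      obtain bs where bs: "bs \<in> lists (Basis::'a set)" "\<And>b. b \<in> Basis \<Longrightarrow> count_list bs b = \<alpha> b"
        using ex_list_count[OF finite_Basis] by metis
      have "monomial (count_list bs) = monomial \<alpha>"
        unfolding monomial_def by (intro ext prod.cong) (auto simp: bs(2))
      then show ?thesis using key[OF f bs(1)] z[OF bs(1)] by simp
    qed
    then show "f \<in> lizorkin" using f by (simp add: lizorkin_def)
  qed
qed

lemma fourier_fourth:
  fixes f :: "'a::euclidean_space \<Rightarrow> complex"
  assumes "f \<in> schwartz"
  shows "fourier (fourier (fourier (fourier f))) \<xi> = (2 * pi) ^ DIM('a) * ((2 * pi) ^ DIM('a) * f \<xi>)"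
  using assms by (simp add: fourier_inversion fourier_schwartz)

text \<open>
  Existence comes from \<open>schwartz_flat_ln_mult\<close>, and uniqueness from the injectivity of the Fourier
  transform. Two candidates can be compared at \<open>\<xi> = 0\<close> as well, because both transforms are flat there;
  for the same reason the formula for the transform holds at \<open>\<xi> = 0\<close>.
\<close>

lemma log_laplacian:
  fixes f :: "'a::euclidean_space \<Rightarrow> complex"
  assumes f: "f \<in> lizorkin"
  shows "log_laplacian f \<in> lizorkin"
    and "fourier (log_laplacian f) \<xi> = of_real (ln (\<xi> \<bullet> \<xi>)) * fourier f \<xi>"
proof -
  let ?P = "\<lambda>g. g \<in> lizorkin \<and> (\<forall>\<xi>. \<xi> \<noteq> 0 \<longrightarrow> fourier g \<xi> = of_real (2 * ln (norm \<xi>)) * fourier f \<xi>)"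
  define \<psi> where "\<psi> = (\<lambda>\<xi>. of_real (ln (\<xi> \<bullet> \<xi>)) * fourier f \<xi>)"
  have ln: "ln (\<xi> \<bullet> \<xi>) = 2 * ln (norm \<xi>)" if "\<xi> \<noteq> 0" for \<xi> :: 'a
    using that by (simp add: dot_square_norm ln_realpow)
  have \<psi>: "\<psi> \<in> schwartz_flat {0}"
    unfolding \<psi>_def using f by (intro schwartz_flat_ln_mult) (simp add: lizorkin_iff_fourier_flat)
  then have \<psi>S: "\<psi> \<in> schwartz" by (rule schwartz_flat_sub)
  \<comment> \<open>the fourth power of the Fourier transform is a scalar, so the third power is an inverse up to that scalar\<close>
  define c where "c = (1 / ((2 * pi) ^ DIM('a) * (2 * pi) ^ DIM('a)) :: complex)"
  define g where "g = (\<lambda>x. c * fourier (fourier (fourier \<psi>)) x)"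
  have gS: "g \<in> schwartz"
    unfolding g_def by (intro schwartz_scale fourier_schwartz \<psi>S)
  have Fg: "fourier g = \<psi>"
    unfolding g_def fourier_scale by (rule ext) (simp add: fourier_fourth[OF \<psi>S] c_def)
  have g: "g \<in> lizorkin"
    using gS \<psi> Fg by (simp add: lizorkin_iff_fourier_flat)
  have Pg: "?P g" using g ln by (auto simp: Fg \<psi>_def)
  have uniq: "h = g" if h: "?P h" for h
  proof -
    have hF: "fourier h \<in> schwartz_flat {0}" "h \<in> schwartz" using h by (auto simp: lizorkin_iff_fourier_flat)
    have "fourier h \<xi> = fourier g \<xi>" for \<xi>
    proof (cases "\<xi> = 0")
      case True
      then show ?thesis using schwartz_flat_zero[OF hF(1), of 0] schwartz_flat_zero[OF \<psi>, of 0] Fg by simp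
    next
      case False
      then show ?thesis using h ln by (simp add: Fg \<psi>_def)
    qed
    then have "fourier h = fourier g" ..
    then have "fourier (fourier h) (- x) = fourier (fourier g) (- x)" for x by simp
    then show ?thesis by (simp add: fourier_inversion hF gS fun_eq_iff)
  qed
  have "log_laplacian f = g"
    unfolding log_laplacian_def by (rule the_equality[of ?P, OF Pg uniq])
  then show "log_laplacian f \<in> lizorkin" "fourier (log_laplacian f) \<xi> = of_real (ln (\<xi> \<bullet> \<xi>)) * fourier f \<xi>"
    using g Fg by (auto simp: \<psi>_def)
qed

section \<open>The inverse logarithm without its pole as a Laplace transform\<close>

lemma nn_integral_Gamma_scaled:
  fixes s u :: real
  assumes s: "s > 0" and u: "u > 0"
  shows "(\<integral>\<^sup>+t. ennreal (indicator {0<..} t * (t powr (s - 1) * exp (- (u * t)))) \<partial>lborel) = ennreal (Gamma s * u powr (- s))"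
proof -
  define h where "h t = indicator {0<..} t * (t powr (s - 1) * exp (- t))" for t :: real
  have [measurable]: "h \<in> borel_measurable borel" unfolding h_def by measurable
  have "ennreal (Gamma s) = (\<integral>\<^sup>+t. ennreal (h t) \<partial>lborel)"
    unfolding Gamma_conv_nn_integral_real[OF s] h_def
    by (intro nn_integral_cong) (auto simp: indicator_def exp_minus divide_inverse)
  also have "\<dots> = ennreal u * (\<integral>\<^sup>+t. ennreal (h (0 + u * t)) \<partial>lborel)"
    using u by (subst nn_integral_real_affine[of _ u 0]) auto
  also have "(\<integral>\<^sup>+t. ennreal (h (0 + u * t)) \<partial>lborel)
      = (\<integral>\<^sup>+t. ennreal (u powr (s - 1)) * ennreal (indicator {0<..} t * (t powr (s - 1) * exp (- (u * t)))) \<partial>lborel)"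
    unfolding h_def using u
    by (intro nn_integral_cong) (auto simp: indicator_def powr_mult zero_less_mult_iff ac_simps simp flip: ennreal_mult)
  also have "\<dots> = ennreal (u powr (s - 1)) * (\<integral>\<^sup>+t. ennreal (indicator {0<..} t * (t powr (s - 1) * exp (- (u * t)))) \<partial>lborel)"
    by (intro nn_integral_cmult) measurable
  finally have "ennreal (Gamma s) = ennreal (u powr s) * (\<integral>\<^sup>+t. ennreal (indicator {0<..} t * (t powr (s - 1) * exp (- (u * t)))) \<partial>lborel)"
    using u by (simp add: powr_diff flip: mult.assoc ennreal_mult)
  then have "ennreal (u powr (- s)) * ennreal (Gamma s)
      = (ennreal (u powr (- s)) * ennreal (u powr s)) * (\<integral>\<^sup>+t. ennreal (indicator {0<..} t * (t powr (s - 1) * exp (- (u * t)))) \<partial>lborel)"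
    by (simp add: mult.assoc)
  moreover have "ennreal (u powr (- s)) * ennreal (u powr s) = 1"
    using u by (simp add: powr_minus flip: ennreal_mult)
  ultimately show ?thesis
    using Gamma_real_pos[OF s] by (simp add: ennreal_mult mult.commute)
qed

lemma nn_integral_exp_decay:
  fixes u :: real
  assumes u: "u > 0"
  shows "(\<integral>\<^sup>+t. ennreal (indicator {0<..} t * exp (- (u * t))) \<partial>lborel) = ennreal (1 / u)"
proof -
  have "(\<integral>\<^sup>+t. ennreal (indicator {0<..} t * exp (- (u * t))) \<partial>lborel)
    = (\<integral>\<^sup>+t. ennreal (indicator {0<..} t * (t powr (1 - 1) * exp (- (u * t)))) \<partial>lborel)"
    by (intro nn_integral_cong) (auto simp: indicator_def)
  also have "\<dots> = ennreal (1 / u)"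
    using u by (subst nn_integral_Gamma_scaled) (auto simp: powr_minus_divide)
  finally show ?thesis .
qed

lemma Gamma_reflection_real:
  fixes \<tau> :: real
  shows "Gamma \<tau> * Gamma (1 - \<tau>) = pi / sin (pi * \<tau>)"
proof -
  have "complex_of_real (Gamma \<tau> * Gamma (1 - \<tau>)) = complex_of_real (pi / sin (pi * \<tau>))"
    using Gamma_reflection_complex[of "of_real \<tau>"] Gamma_complex_of_real[of \<tau>] Gamma_complex_of_real[of "1 - \<tau>"]
    by (simp flip: sin_of_real)
  then show ?thesis by (simp only: of_real_eq_iff)
qed

text \<open>
  Writing \<open>1 / (1 + t)\<close> as a Laplace integral and exchanging the integrations gives
  \<open>\<Gamma>(\<tau>) \<Gamma>(1 - \<tau>)\<close>, which the reflection formula evaluates.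
\<close>

lemma nn_integral_Mellin:
  fixes \<tau> :: real
  assumes t: "0 < \<tau>" "\<tau> < 1"
  shows "(\<integral>\<^sup>+t. ennreal (indicator {0<..} t * (t powr (\<tau> - 1) / (1 + t))) \<partial>lborel) = ennreal (pi / sin (pi * \<tau>))"
proof -
  define K where "K t u = indicator {0<..} t * indicator {0<..} u * (t powr (\<tau> - 1) * exp (- (u * (1 + t))))" for t u :: real
  have [measurable]: "case_prod K \<in> borel_measurable (borel \<Otimes>\<^sub>M borel)"
    unfolding K_def by measurable
  have "(\<integral>\<^sup>+t. ennreal (indicator {0<..} t * (t powr (\<tau> - 1) / (1 + t))) \<partial>lborel) = (\<integral>\<^sup>+t. \<integral>\<^sup>+u. ennreal (K t u) \<partial>lborel \<partial>lborel)"
  proof (intro nn_integral_cong)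
    fix t :: real
    show "ennreal (indicator {0<..} t * (t powr (\<tau> - 1) / (1 + t))) = (\<integral>\<^sup>+u. ennreal (K t u) \<partial>lborel)"
    proof (cases "t > 0")
      case True
      have "(\<integral>\<^sup>+u. ennreal (K t u) \<partial>lborel) = (\<integral>\<^sup>+u. ennreal (t powr (\<tau> - 1)) * ennreal (indicator {0<..} u * exp (- ((1 + t) * u))) \<partial>lborel)"
        using True by (intro nn_integral_cong) (auto simp: K_def indicator_def mult.commute simp flip: ennreal_mult)
      also have "\<dots> = ennreal (t powr (\<tau> - 1)) * ennreal (1 / (1 + t))"
        using True by (subst nn_integral_cmult) (auto simp: nn_integral_exp_decay)
      finally show ?thesis using True by (simp flip: ennreal_mult)
    qed (simp add: K_def)
  qed
  also have "\<dots> = (\<integral>\<^sup>+u. \<integral>\<^sup>+t. ennreal (K t u) \<partial>lborel \<partial>lborel)"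
    by (rule lborel_pair.Fubini'[symmetric]) measurable
  also have "\<dots> = (\<integral>\<^sup>+u. ennreal (Gamma \<tau>) * ennreal (indicator {0<..} u * (u powr ((1 - \<tau>) - 1) * exp (- (1 * u)))) \<partial>lborel)"
  proof (intro nn_integral_cong)
    fix u :: real
    show "(\<integral>\<^sup>+t. ennreal (K t u) \<partial>lborel) = ennreal (Gamma \<tau>) * ennreal (indicator {0<..} u * (u powr ((1 - \<tau>) - 1) * exp (- (1 * u))))"
    proof (cases "u > 0")
      case True
      have "(\<integral>\<^sup>+t. ennreal (K t u) \<partial>lborel) = (\<integral>\<^sup>+t. ennreal (exp (- u)) * ennreal (indicator {0<..} t * (t powr (\<tau> - 1) * exp (- (u * t)))) \<partial>lborel)"
        using True by (intro nn_integral_cong) (auto simp: K_def indicator_def exp_add[symmetric] algebra_simps simp flip: ennreal_mult)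
      also have "\<dots> = ennreal (exp (- u)) * ennreal (Gamma \<tau> * u powr (- \<tau>))"
        using True t by (subst nn_integral_cmult) (auto simp: nn_integral_Gamma_scaled)
      finally show ?thesis using True Gamma_real_pos[OF t(1)] by (simp add: ac_simps flip: ennreal_mult)
    qed (simp add: K_def)
  qed
  also have "\<dots> = ennreal (Gamma \<tau>) * ennreal (Gamma (1 - \<tau>) * 1 powr (- (1 - \<tau>)))"
    using t by (subst nn_integral_cmult) (auto simp: nn_integral_Gamma_scaled[of "1 - \<tau>" 1, simplified])
  also have "\<dots> = ennreal (pi / sin (pi * \<tau>))"
    using Gamma_real_pos[OF t(1)] Gamma_real_pos[of "1 - \<tau>"] t
    by (simp add: Gamma_reflection_real flip: ennreal_mult)
  finally show ?thesis .
qed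

lemma sin_pi_pos: "0 < \<tau> \<Longrightarrow> \<tau> < 1 \<Longrightarrow> sin (pi * \<tau>) > 0" for \<tau> :: real
  by (rule sin_gt_zero) auto

lemma ennreal_mult3:
  "0 \<le> a \<Longrightarrow> 0 \<le> b \<Longrightarrow> 0 \<le> c \<Longrightarrow> ennreal a * (ennreal b * ennreal c) = ennreal (a * (b * c))"
  by (simp add: ennreal_mult)

lemma has_bochner_integral_Mellin:
  fixes \<tau> s :: real
  assumes t: "0 < \<tau>" "\<tau> < 1" and s: "s \<ge> 0"
  shows "has_bochner_integral lborel (\<lambda>t. indicator {0<..} t * (t powr (\<tau> - 1) * (s / (s + t)))) (s powr \<tau> * (pi / sin (pi * \<tau>)))"
proof (cases "s = 0")
  case True
  then show ?thesis by (simp add: has_bochner_integral_zero)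
next
  case False
  with s have s: "s > 0" by simp
  have nn: "0 \<le> pi / sin (pi * \<tau>)" using sin_pi_pos[OF t] by simp
  show ?thesis
  proof (rule has_bochner_integral_nn_integral)
    have "(\<integral>\<^sup>+t. ennreal (indicator {0<..} t * (t powr (\<tau> - 1) * (s / (s + t)))) \<partial>lborel)
       = ennreal s * (\<integral>\<^sup>+t. ennreal (indicator {0<..} (0 + s * t) * ((0 + s * t) powr (\<tau> - 1) * (s / (s + (0 + s * t))))) \<partial>lborel)"
      using s by (subst nn_integral_real_affine[of _ s 0]) auto
    also have "(\<integral>\<^sup>+t. ennreal (indicator {0<..} (0 + s * t) * ((0 + s * t) powr (\<tau> - 1) * (s / (s + (0 + s * t))))) \<partial>lborel)
       = (\<integral>\<^sup>+t. ennreal (s powr (\<tau> - 1)) * ennreal (indicator {0<..} t * (t powr (\<tau> - 1) / (1 + t))) \<partial>lborel)"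
    proof (intro nn_integral_cong)
      fix t :: real
      have "s / (s + s * t) = 1 / (1 + t)" using s by (metis distrib_left mult.right_neutral mult_divide_mult_cancel_left nless_le)
      then show "ennreal (indicator {0<..} (0 + s * t) * ((0 + s * t) powr (\<tau> - 1) * (s / (s + (0 + s * t)))))
        = ennreal (s powr (\<tau> - 1)) * ennreal (indicator {0<..} t * (t powr (\<tau> - 1) / (1 + t)))"
        using s by (auto simp: indicator_def powr_mult zero_less_mult_iff simp flip: ennreal_mult)
    qed
    also have "\<dots> = ennreal (s powr (\<tau> - 1)) * ennreal (pi / sin (pi * \<tau>))"
      by (subst nn_integral_cmult) (measurable, simp only: nn_integral_Mellin[OF t])
    also have "ennreal s * \<dots> = ennreal (s powr \<tau> * (pi / sin (pi * \<tau>)))"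
    proof -
      have "s * (s powr (\<tau> - 1) * c) = s powr \<tau> * c" for c
        using s by (simp add: powr_diff)
      then show ?thesis using s nn by (subst ennreal_mult3) (simp_all only: powr_ge_zero less_imp_le)
    qed
    finally show "(\<integral>\<^sup>+t. ennreal (indicator {0<..} t * (t powr (\<tau> - 1) * (s / (s + t)))) \<partial>lborel) = ennreal (s powr \<tau> * (pi / sin (pi * \<tau>)))" .
    show "AE t in lborel. 0 \<le> indicator {0<..} t * (t powr (\<tau> - 1) * (s / (s + t)))"
      using s by (auto simp: indicator_def)
    show "0 \<le> s powr \<tau> * (pi / sin (pi * \<tau>))" by (intro mult_nonneg_nonneg nn) simp
  qed measurable
qed

text \<open>
  Since \<open>s / (s + t) - 1 / (1 + t) = t (s - 1) / ((1 + t) (s + t))\<close>, this is the difference of the Mellin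
  integrals at \<open>s\<close> and at \<open>1\<close>. The subtraction removes the singularity at \<open>s = 1\<close>.
\<close>

lemma nn_integral_Mellin_quotient:
  fixes \<tau> s :: real
  assumes t: "0 < \<tau>" "\<tau> < 1" and s: "s \<ge> 0" "s \<noteq> 1"
  shows "(\<integral>\<^sup>+t. ennreal (indicator {0<..} t * (t powr \<tau> / ((1 + t) * (s + t)))) \<partial>lborel)
     = ennreal ((s powr \<tau> - 1) / (s - 1) * (pi / sin (pi * \<tau>)))"
proof -
  have "has_bochner_integral lborel (\<lambda>t. (indicator {0<..} t * (t powr (\<tau> - 1) * (s / (s + t))) - indicator {0<..} t * (t powr (\<tau> - 1) * (1 / (1 + t)))) / (s - 1))
     ((s powr \<tau> * (pi / sin (pi * \<tau>)) - 1 powr \<tau> * (pi / sin (pi * \<tau>))) / (s - 1))"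
    by (intro has_bochner_integral_divide_zero has_bochner_integral_diff has_bochner_integral_Mellin t s(1)) simp
  moreover have "(indicator {0<..} t * (t powr (\<tau> - 1) * (s / (s + t))) - indicator {0<..} t * (t powr (\<tau> - 1) * (1 / (1 + t)))) / (s - 1)
     = indicator {0<..} t * (t powr \<tau> / ((1 + t) * (s + t)))" for t :: real
  proof (cases "t > 0")
    case True
    define p where "p = t powr (\<tau> - 1)"
    define D where "D = (1 + t) * (s + t)"
    have tp: "t powr \<tau> = t * p" using True by (simp add: p_def powr_diff)
    have "s / (s + t) - 1 / (1 + t) = t * (s - 1) / D"
      using True s by (simp add: D_def field_simps)
    then have "p * (s / (s + t)) - p * (1 / (1 + t)) = p * (t * (s - 1) / D)"
      by (metis right_diff_distrib)
    also have "\<dots> = (s - 1) * (t * p / D)" by simp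
    finally have "(p * (s / (s + t)) - p * (1 / (1 + t))) / (s - 1) = t * p / D"
      using s by simp
    then show ?thesis using True by (simp add: tp flip: p_def D_def)
  qed simp
  moreover have "(s powr \<tau> * (pi / sin (pi * \<tau>)) - 1 powr \<tau> * (pi / sin (pi * \<tau>))) / (s - 1) = (s powr \<tau> - 1) / (s - 1) * (pi / sin (pi * \<tau>))"
  proof -
    have "(a * c - 1 powr \<tau> * c) / (s - 1) = (a - 1) / (s - 1) * c" for a c :: real
      by (simp add: left_diff_distrib)
    then show ?thesis .
  qed
  ultimately have hb: "has_bochner_integral lborel (\<lambda>t. indicator {0<..} t * (t powr \<tau> / ((1 + t) * (s + t)))) ((s powr \<tau> - 1) / (s - 1) * (pi / sin (pi * \<tau>)))"
    by simp
  then show ?thesis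
    using s by (subst nn_integral_eq_integral) (auto simp: has_bochner_integral_iff indicator_def intro!: AE_I2)
qed

lemma nn_integral_sin_powr:
  fixes t :: real
  assumes t: "t > 0"
  shows "(\<integral>\<^sup>+\<tau>. ennreal (indicator {0<..<1} \<tau> * (sin (pi * \<tau>) * t powr \<tau>)) \<partial>lborel) = ennreal (pi * (1 + t) / (pi\<^sup>2 + (ln t)\<^sup>2))"
proof -
  define F where "F \<tau> = exp (ln t * \<tau>) * (ln t * sin (pi * \<tau>) - pi * cos (pi * \<tau>)) / (pi\<^sup>2 + (ln t)\<^sup>2)" for \<tau> :: real
  have pos: "pi\<^sup>2 + (ln t)\<^sup>2 > 0" by (simp add: add_pos_nonneg)
  have der: "(F has_real_derivative sin (pi * \<tau>) * t powr \<tau>) (at \<tau>)" for \<tau>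
  proof -
    have "(F has_real_derivative (exp (ln t * \<tau>) * ln t * (ln t * sin (pi * \<tau>) - pi * cos (pi * \<tau>))
        + exp (ln t * \<tau>) * (ln t * (cos (pi * \<tau>) * pi) + pi * (sin (pi * \<tau>) * pi))) / (pi\<^sup>2 + (ln t)\<^sup>2)) (at \<tau>)"
      unfolding F_def by (intro DERIV_cdivide) (auto intro!: derivative_eq_intros simp: algebra_simps)
    moreover have "exp (ln t * \<tau>) * ln t * (ln t * sin (pi * \<tau>) - pi * cos (pi * \<tau>))
        + exp (ln t * \<tau>) * (ln t * (cos (pi * \<tau>) * pi) + pi * (sin (pi * \<tau>) * pi))
        = (sin (pi * \<tau>) * exp (ln t * \<tau>)) * (pi\<^sup>2 + (ln t)\<^sup>2)"
      by (simp add: algebra_simps power2_eq_square)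
    moreover have "t powr \<tau> = exp (ln t * \<tau>)" using t by (simp add: powr_def mult.commute)
    moreover have "pi\<^sup>2 + (ln t)\<^sup>2 \<noteq> 0" using pos by simp
    ultimately show ?thesis by (metis nonzero_mult_div_cancel_right)
  qed
  have "(\<integral>\<^sup>+\<tau>. ennreal (indicator {0<..<1} \<tau> * (sin (pi * \<tau>) * t powr \<tau>)) \<partial>lborel)
     = (\<integral>\<^sup>+\<tau>. ennreal (sin (pi * \<tau>) * t powr \<tau>) * indicator {0..1} \<tau> \<partial>lborel)"
  proof (rule nn_integral_cong)
    fix \<tau> :: real
    have "sin (pi * \<tau>) = 0" if "\<tau> = 0 \<or> \<tau> = 1" using that by auto
    then show "ennreal (indicator {0<..<1} \<tau> * (sin (pi * \<tau>) * t powr \<tau>)) = ennreal (sin (pi * \<tau>) * t powr \<tau>) * indicator {0..1} \<tau>"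
      by (cases "\<tau> = 0 \<or> \<tau> = 1") (auto simp: indicator_def)
  qed
  also have "\<dots> = ennreal (F 1 - F 0)"
  proof (rule nn_integral_FTC_Icc)
    show "0 \<le> sin (pi * \<tau>) * t powr \<tau>" if "\<tau> \<in> {0..1}" for \<tau>
      using that by (auto intro!: mult_nonneg_nonneg sin_ge_zero simp: mult_le_cancel_left1)
  qed (use der in auto)
  also have "F 1 - F 0 = pi * (1 + t) / (pi\<^sup>2 + (ln t)\<^sup>2)"
    using t by (simp add: F_def algebra_simps add_divide_distrib)
  finally show ?thesis .
qed

text \<open>
  The value at \<open>0\<close> is the limit; it turns into the total mass of the density below.
\<close>

definition log_multiplier :: "real \<Rightarrow> real" where
  "log_multiplier s = (if s = 0 then 1 else 1 / ln s - 1 / (s - 1))"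

text \<open>
  The logarithmic mean \<open>(s - 1) / log s\<close> equals \<open>\<integral>\<^sub>0\<^sup>1 s\<^sup>\<tau> d\<tau>\<close>, so \<open>1 / log s - 1 / (s - 1)\<close> is the
  average of \<open>(s\<^sup>\<tau> - 1) / (s - 1)\<close> over \<open>\<tau>\<close>.
\<close>

lemma nn_integral_powr_quotient:
  fixes s :: real
  assumes s: "s \<ge> 0" "s \<noteq> 1"
  shows "(\<integral>\<^sup>+\<tau>. ennreal (indicator {0<..<1} \<tau> * ((s powr \<tau> - 1) / (s - 1))) \<partial>lborel) = ennreal (log_multiplier s)"
proof (cases "s = 0")
  case True
  then have "(\<integral>\<^sup>+\<tau>. ennreal (indicator {0<..<1} \<tau> * ((s powr \<tau> - 1) / (s - 1))) \<partial>lborel) = (\<integral>\<^sup>+\<tau>. indicator {0<..<1::real} \<tau> \<partial>lborel)"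
    by (intro nn_integral_cong) (auto simp: indicator_def)
  then show ?thesis using True by (simp add: log_multiplier_def)
next
  case False
  with s have s0: "s > 0" by simp
  then have ln: "ln s \<noteq> 0" using s by simp
  define F where "F \<tau> = (exp (ln s * \<tau>) / ln s - \<tau>) / (s - 1)" for \<tau> :: real
  have pw: "s powr \<tau> = exp (ln s * \<tau>)" for \<tau> using s0 by (simp add: powr_def mult.commute)
  have der: "(F has_real_derivative (s powr \<tau> - 1) / (s - 1)) (at \<tau>)" for \<tau>
    unfolding F_def pw using ln by (auto intro!: derivative_eq_intros)
  have nn: "0 \<le> (s powr \<tau> - 1) / (s - 1)" if "\<tau> \<ge> 0" for \<tau>
  proof (cases "s > 1")
    case True
    then show ?thesis using that by (simp add: ge_one_powr_ge_zero)
  next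
    case False
    then have "s powr \<tau> \<le> 1" using that s0 s by (intro powr_le1) auto
    then show ?thesis using False s by (intro divide_nonpos_neg) auto
  qed
  have "(\<integral>\<^sup>+\<tau>. ennreal (indicator {0<..<1} \<tau> * ((s powr \<tau> - 1) / (s - 1))) \<partial>lborel)
     = (\<integral>\<^sup>+\<tau>. ennreal ((s powr \<tau> - 1) / (s - 1)) * indicator {0..1} \<tau> \<partial>lborel)"
  proof (rule nn_integral_cong_AE)
    have "AE \<tau> in lborel. \<tau> \<noteq> (0::real) \<and> \<tau> \<noteq> 1"
      using AE_lborel_singleton[of "0::real"] AE_lborel_singleton[of "1::real"] by eventually_elim simp
    then show "AE \<tau> in lborel. ennreal (indicator {0<..<1} \<tau> * ((s powr \<tau> - 1) / (s - 1))) = ennreal ((s powr \<tau> - 1) / (s - 1)) * indicator {0..1} \<tau>"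
      by eventually_elim (auto simp: indicator_def)
  qed
  also have "\<dots> = ennreal (F 1 - F 0)"
  proof (rule nn_integral_FTC_Icc)
  qed (use nn der in auto)
  also have "F 1 - F 0 = 1 / ln s - 1 / (s - 1)"
  proof -
    have "((c + 1) / L - 1) / c - 1 / L / c = 1 / L - 1 / c" if "c \<noteq> 0" "L \<noteq> 0" for c L :: real
      using that by (simp add: field_simps)
    from this[of "s - 1" "ln s"] show ?thesis using s s0 ln by (simp add: F_def)
  qed
  finally show ?thesis using False by (simp add: log_multiplier_def)
qed

text \<open>
  Insert the Mellin integral for \<open>(s\<^sup>\<tau> - 1) / (s - 1)\<close> into the average over \<open>\<tau>\<close>; exchanging the
  integrations leaves an elementary integral over \<open>\<tau>\<close>, whose value is \<open>nn_integral_sin_powr\<close>. All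
  integrands are nonnegative, so no integrability has to be checked on the way.
\<close>

lemma nn_integral_log_density:
  fixes s :: real
  assumes s: "s \<ge> 0" "s \<noteq> 1"
  shows "(\<integral>\<^sup>+t. ennreal (indicator {0<..} t * (1 / ((s + t) * (pi\<^sup>2 + (ln t)\<^sup>2)))) \<partial>lborel) = ennreal (log_multiplier s)"
proof -
  define K where "K t \<tau> = indicator {0<..} t * indicator {0<..<1} \<tau> * (sin (pi * \<tau>) / pi * (t powr \<tau> / ((1 + t) * (s + t))))" for t \<tau> :: real
  have [measurable]: "case_prod K \<in> borel_measurable (borel \<Otimes>\<^sub>M borel)"
    unfolding K_def by measurable
  have "(\<integral>\<^sup>+t. ennreal (indicator {0<..} t * (1 / ((s + t) * (pi\<^sup>2 + (ln t)\<^sup>2)))) \<partial>lborel) = (\<integral>\<^sup>+t. \<integral>\<^sup>+\<tau>. ennreal (K t \<tau>) \<partial>lborel \<partial>lborel)"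
  proof (intro nn_integral_cong)
    fix t :: real
    show "ennreal (indicator {0<..} t * (1 / ((s + t) * (pi\<^sup>2 + (ln t)\<^sup>2)))) = (\<integral>\<^sup>+\<tau>. ennreal (K t \<tau>) \<partial>lborel)"
    proof (cases "t > 0")
      case True
      have "(\<integral>\<^sup>+\<tau>. ennreal (K t \<tau>) \<partial>lborel) = (\<integral>\<^sup>+\<tau>. ennreal (1 / (pi * (1 + t) * (s + t))) * ennreal (indicator {0<..<1} \<tau> * (sin (pi * \<tau>) * t powr \<tau>)) \<partial>lborel)"
      proof (intro nn_integral_cong)
        fix \<tau> :: real
        show "ennreal (K t \<tau>) = ennreal (1 / (pi * (1 + t) * (s + t))) * ennreal (indicator {0<..<1} \<tau> * (sin (pi * \<tau>) * t powr \<tau>))"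
          using True s sin_pi_pos[of \<tau>] by (auto simp: K_def indicator_def mult.assoc simp flip: ennreal_mult)
      qed
      also have "\<dots> = ennreal (1 / (pi * (1 + t) * (s + t))) * ennreal (pi * (1 + t) / (pi\<^sup>2 + (ln t)\<^sup>2))"
        by (subst nn_integral_cmult) (auto simp: nn_integral_sin_powr[OF True])
      also have "\<dots> = ennreal (1 / ((s + t) * (pi\<^sup>2 + (ln t)\<^sup>2)))"
      proof -
        have "pi\<^sup>2 + (ln t)\<^sup>2 > 0" by (simp add: add_pos_nonneg)
        then have "1 / (pi * (1 + t) * (s + t)) * (pi * (1 + t) / (pi\<^sup>2 + (ln t)\<^sup>2)) = 1 / ((s + t) * (pi\<^sup>2 + (ln t)\<^sup>2))"
          using True s by (simp add: divide_simps)
        moreover have "0 \<le> 1 / (pi * (1 + t) * (s + t))" "0 \<le> pi * (1 + t) / (pi\<^sup>2 + (ln t)\<^sup>2)" using True s by auto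
        ultimately show ?thesis by (metis ennreal_mult)
      qed
      finally show ?thesis using True by simp
    qed (simp add: K_def)
  qed
  also have "\<dots> = (\<integral>\<^sup>+\<tau>. \<integral>\<^sup>+t. ennreal (K t \<tau>) \<partial>lborel \<partial>lborel)"
    by (rule lborel_pair.Fubini'[symmetric]) measurable
  also have "\<dots> = (\<integral>\<^sup>+\<tau>. ennreal (indicator {0<..<1} \<tau> * ((s powr \<tau> - 1) / (s - 1))) \<partial>lborel)"
  proof (intro nn_integral_cong)
    fix \<tau> :: real
    show "(\<integral>\<^sup>+t. ennreal (K t \<tau>) \<partial>lborel) = ennreal (indicator {0<..<1} \<tau> * ((s powr \<tau> - 1) / (s - 1)))"
    proof (cases "0 < \<tau> \<and> \<tau> < 1")
      case True
      then have sp: "sin (pi * \<tau>) > 0" using sin_pi_pos by blast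
      have "(\<integral>\<^sup>+t. ennreal (K t \<tau>) \<partial>lborel) = (\<integral>\<^sup>+t. ennreal (sin (pi * \<tau>) / pi) * ennreal (indicator {0<..} t * (t powr \<tau> / ((1 + t) * (s + t)))) \<partial>lborel)"
        using True s sp by (intro nn_integral_cong) (auto simp: K_def indicator_def simp flip: ennreal_mult)
      also have "\<dots> = ennreal (sin (pi * \<tau>) / pi) * ennreal ((s powr \<tau> - 1) / (s - 1) * (pi / sin (pi * \<tau>)))"
        by (subst nn_integral_cmult)
          (measurable, simp only: nn_integral_Mellin_quotient[OF conjunct1[OF True] conjunct2[OF True] s])
      also have "\<dots> = ennreal (sin (pi * \<tau>) / pi * ((s powr \<tau> - 1) / (s - 1) * (pi / sin (pi * \<tau>))))"
        using sp by (subst ennreal_mult'[symmetric]) auto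
      also have "sin (pi * \<tau>) / pi * ((s powr \<tau> - 1) / (s - 1) * (pi / sin (pi * \<tau>))) = (s powr \<tau> - 1) / (s - 1)"
        using sp by simp
      finally show ?thesis using True by simp
    qed (simp add: K_def)
  qed
  finally show ?thesis using nn_integral_powr_quotient[OF s] by simp
qed

text \<open>
  The Laplace transform of \<open>1 / (\<pi>\<^sup>2 + log\<^sup>2 t)\<close>. Its own Laplace transform is the Stieltjes transform
  of that function, which is \<open>log_multiplier\<close> by the preceding lemma.
\<close>

definition log_density :: "real \<Rightarrow> real" where
  "log_density \<sigma> = indicator {0<..} \<sigma> * (LINT t|lborel. indicator {0<..} t * (exp (- (\<sigma> * t)) / (pi\<^sup>2 + (ln t)\<^sup>2)))"

lemma log_density_nonneg: "log_density \<sigma> \<ge> 0"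
  unfolding log_density_def by (auto simp: indicator_def intro!: Bochner_Integration.integral_nonneg)

lemma log_density_measurable [measurable]: "log_density \<in> borel_measurable borel"
proof -
  have [measurable]: "(\<lambda>\<sigma>. LINT t|lborel. indicator {0<..} t * (exp (- (\<sigma> * t)) / (pi\<^sup>2 + (ln t)\<^sup>2))) \<in> borel_measurable borel"
    by (rule lborel.borel_measurable_lebesgue_integral) measurable
  show ?thesis unfolding log_density_def by measurable
qed

lemma ennreal_log_density:
  assumes \<sigma>: "\<sigma> > 0"
  shows "ennreal (log_density \<sigma>) = (\<integral>\<^sup>+t. ennreal (indicator {0<..} t * (exp (- (\<sigma> * t)) / (pi\<^sup>2 + (ln t)\<^sup>2))) \<partial>lborel)"
proof -
  have "(\<integral>\<^sup>+t. ennreal (indicator {0<..} t * (exp (- (\<sigma> * t)) / (pi\<^sup>2 + (ln t)\<^sup>2))) \<partial>lborel)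
     \<le> (\<integral>\<^sup>+t. ennreal (1 / pi\<^sup>2) * ennreal (indicator {0<..} t * exp (- (\<sigma> * t))) \<partial>lborel)"
  proof (intro nn_integral_mono)
    fix t :: real
    have "exp (- (\<sigma> * t)) / (pi\<^sup>2 + (ln t)\<^sup>2) \<le> exp (- (\<sigma> * t)) / pi\<^sup>2"
      by (intro divide_left_mono) (auto simp: add_pos_nonneg)
    then show "ennreal (indicator {0<..} t * (exp (- (\<sigma> * t)) / (pi\<^sup>2 + (ln t)\<^sup>2))) \<le> ennreal (1 / pi\<^sup>2) * ennreal (indicator {0<..} t * exp (- (\<sigma> * t)))"
      by (auto simp: indicator_def simp flip: ennreal_mult)
  qed
  also have "\<dots> = ennreal (1 / pi\<^sup>2) * ennreal (1 / \<sigma>)"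
    using \<sigma> by (subst nn_integral_cmult) (auto simp: nn_integral_exp_decay)
  also have "\<dots> < \<infinity>" by (simp add: ennreal_mult_less_top)
  finally have fin: "(\<integral>\<^sup>+t. ennreal (indicator {0<..} t * (exp (- (\<sigma> * t)) / (pi\<^sup>2 + (ln t)\<^sup>2))) \<partial>lborel) < \<infinity>" .
  have "integrable lborel (\<lambda>t. indicator {0<..} t * (exp (- (\<sigma> * t)) / (pi\<^sup>2 + (ln t)\<^sup>2)))"
    using fin by (intro integrableI_nonneg) auto
  then show ?thesis
    using \<sigma> by (subst nn_integral_eq_integral) (auto simp: log_density_def)
qed

text \<open>
  Here \<open>1 / (s + t)\<close> is written as a Laplace integral in \<open>\<sigma>\<close>. The case \<open>s = 0\<close> says that the density has
  total mass \<open>1\<close>; in particular it is integrable.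
\<close>

lemma has_bochner_integral_log_density:
  fixes s :: real
  assumes s: "s \<ge> 0" "s \<noteq> 1"
  shows "has_bochner_integral lborel (\<lambda>\<sigma>. log_density \<sigma> * exp (- (\<sigma> * s))) (log_multiplier s)"
proof (rule has_bochner_integral_nn_integral)
  define K where "K \<sigma> t = indicator {0<..} \<sigma> * indicator {0<..} t * (exp (- ((s + t) * \<sigma>)) / (pi\<^sup>2 + (ln t)\<^sup>2))" for \<sigma> t :: real
  have [measurable]: "case_prod K \<in> borel_measurable (borel \<Otimes>\<^sub>M borel)"
    unfolding K_def by measurable
  have "(\<integral>\<^sup>+\<sigma>. ennreal (log_density \<sigma> * exp (- (\<sigma> * s))) \<partial>lborel) = (\<integral>\<^sup>+\<sigma>. \<integral>\<^sup>+t. ennreal (K \<sigma> t) \<partial>lborel \<partial>lborel)"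
  proof (intro nn_integral_cong)
    fix \<sigma> :: real
    show "ennreal (log_density \<sigma> * exp (- (\<sigma> * s))) = (\<integral>\<^sup>+t. ennreal (K \<sigma> t) \<partial>lborel)"
    proof (cases "\<sigma> > 0")
      case True
      have "(\<integral>\<^sup>+t. ennreal (K \<sigma> t) \<partial>lborel) = (\<integral>\<^sup>+t. ennreal (exp (- (\<sigma> * s))) * ennreal (indicator {0<..} t * (exp (- (\<sigma> * t)) / (pi\<^sup>2 + (ln t)\<^sup>2))) \<partial>lborel)"
      proof (intro nn_integral_cong)
        fix t :: real
        have "exp (- ((s + t) * \<sigma>)) = exp (- (\<sigma> * s)) * exp (- (\<sigma> * t))"
          by (simp add: algebra_simps flip: exp_add)
        then show "ennreal (K \<sigma> t) = ennreal (exp (- (\<sigma> * s))) * ennreal (indicator {0<..} t * (exp (- (\<sigma> * t)) / (pi\<^sup>2 + (ln t)\<^sup>2)))"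
          using True by (auto simp: K_def indicator_def simp flip: ennreal_mult)
      qed
      also have "\<dots> = ennreal (exp (- (\<sigma> * s))) * ennreal (log_density \<sigma>)"
        unfolding ennreal_log_density[OF True] by (intro nn_integral_cmult) measurable
      finally show ?thesis using log_density_nonneg[of \<sigma>] by (simp add: mult.commute flip: ennreal_mult)
    qed (simp add: K_def log_density_def)
  qed
  also have "\<dots> = (\<integral>\<^sup>+t. \<integral>\<^sup>+\<sigma>. ennreal (K \<sigma> t) \<partial>lborel \<partial>lborel)"
    by (rule lborel_pair.Fubini'[symmetric]) measurable
  also have "\<dots> = (\<integral>\<^sup>+t. ennreal (indicator {0<..} t * (1 / ((s + t) * (pi\<^sup>2 + (ln t)\<^sup>2)))) \<partial>lborel)"
  proof (intro nn_integral_cong)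
    fix t :: real
    show "(\<integral>\<^sup>+\<sigma>. ennreal (K \<sigma> t) \<partial>lborel) = ennreal (indicator {0<..} t * (1 / ((s + t) * (pi\<^sup>2 + (ln t)\<^sup>2))))"
    proof (cases "t > 0")
      case True
      have "(\<integral>\<^sup>+\<sigma>. ennreal (K \<sigma> t) \<partial>lborel) = (\<integral>\<^sup>+\<sigma>. ennreal (1 / (pi\<^sup>2 + (ln t)\<^sup>2)) * ennreal (indicator {0<..} \<sigma> * exp (- ((s + t) * \<sigma>))) \<partial>lborel)"
        using True by (intro nn_integral_cong) (auto simp: K_def indicator_def simp flip: ennreal_mult)
      also have "\<dots> = ennreal (1 / (pi\<^sup>2 + (ln t)\<^sup>2)) * ennreal (1 / (s + t))"
        using True s by (subst nn_integral_cmult) (auto simp: nn_integral_exp_decay)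
      finally show ?thesis using True s by (simp add: mult.commute flip: ennreal_mult)
    qed (simp add: K_def)
  qed
  also have "\<dots> = ennreal (log_multiplier s)" by (rule nn_integral_log_density[OF s])
  finally show "(\<integral>\<^sup>+\<sigma>. ennreal (log_density \<sigma> * exp (- (\<sigma> * s))) \<partial>lborel) = ennreal (log_multiplier s)" .
  show "AE \<sigma> in lborel. 0 \<le> log_density \<sigma> * exp (- (\<sigma> * s))"
    by (simp add: log_density_nonneg)
  show "0 \<le> log_multiplier s"
  proof (cases "s = 0")
    case False
    with s have s0: "s > 0" by simp
    show ?thesis
    proof (cases "s > 1")
      case True
      then have "ln s > 0" "ln s \<le> s - 1" using ln_le_minus_one[OF s0] by auto
      then have "1 / (s - 1) \<le> 1 / ln s" by (intro divide_left_mono) auto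
      then show ?thesis using s0 by (simp add: log_multiplier_def)
    next
      case False
      then have "ln s < 0" "ln s \<le> s - 1" "s - 1 < 0" using ln_le_minus_one[OF s0] s s0 by auto
      then have "1 / (s - 1) \<le> 1 / ln s" by (simp add: divide_simps)
      then show ?thesis using s0 by (simp add: log_multiplier_def)
    qed
  qed (simp add: log_multiplier_def)
qed measurable

lemma log_density_integrable: "integrable lborel log_density"
  using has_bochner_integral_log_density[of 0] by (simp add: has_bochner_integral_iff)

section \<open>Superpositions of heat kernels\<close>

text \<open>
  In the variable \<open>u = |x|\<^sup>2 / (4 \<sigma>)\<close> the kernel is \<open>(u / \<pi>)\<^sup>d\<^sup>/\<^sup>2 exp (- u) |x|\<^sup>-\<^sup>d\<close>, and the function of \<open>u\<close> is
  bounded. So the bound is uniform in \<open>\<sigma>\<close> and passes to superpositions.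
\<close>

lemma heat_kernel_bound:
  fixes x :: "'a::euclidean_space"
  assumes "\<sigma> > 0" "x \<noteq> 0"
  shows "heat_kernel \<sigma> x \<le> real DIM('a) ^ DIM('a) * (1 / norm x) ^ DIM('a)"
proof -
  define d where "d = real DIM('a)"
  have d: "d \<ge> 1" by (simp add: d_def Suc_leI)
  define r where "r = norm x"
  have r: "r > 0" using assms by (simp add: r_def)
  define u where "u = r\<^sup>2 / (4 * \<sigma>)"
  have u: "u > 0" using r assms by (simp add: u_def)
  have "sqrt u ^ DIM('a) \<le> (d * (1 + u / d)) ^ DIM('a)"
  proof (intro power_mono)
    \<comment> \<open>this crude bound allows (1 + u / d) ^ d to be compared with exp u\<close>
    have "sqrt u \<le> 1 + u"
      using zero_le_power2[of "sqrt u - 1"] u by (simp add: power2_diff)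
    also have "\<dots> \<le> d * (1 + u / d)" using d by (simp add: distrib_left)
    finally show "sqrt u \<le> d * (1 + u / d)" .
  qed (use u in simp)
  also have "\<dots> = d ^ DIM('a) * (1 + u / d) ^ DIM('a)" by (simp only: power_mult_distrib)
  also have "\<dots> \<le> d ^ DIM('a) * exp u"
  proof (intro mult_left_mono)
    have "(1 + u / d) ^ DIM('a) \<le> exp (u / d) ^ DIM('a)"
      using u d by (intro power_mono exp_ge_add_one_self) auto
    also have "\<dots> = exp u" using d by (simp add: d_def flip: exp_of_nat_mult)
    finally show "(1 + u / d) ^ DIM('a) \<le> exp u" .
  qed (use d in auto)
  finally have 1: "sqrt u ^ DIM('a) * exp (- u) \<le> d ^ DIM('a)"
    by (simp add: exp_minus field_simps)
  have "sqrt (4 * pi * \<sigma>) = sqrt pi * r / sqrt u"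
    using r assms by (simp add: u_def real_sqrt_mult real_sqrt_divide)
  then have "heat_kernel \<sigma> x = exp (- u) / (sqrt pi * r / sqrt u) ^ DIM('a)"
    by (simp add: heat_kernel_def u_def r_def dot_square_norm)
  also have "\<dots> = (sqrt u ^ DIM('a) * exp (- u)) * (1 / (sqrt pi * r)) ^ DIM('a)"
    by (simp add: power_divide)
  also have "\<dots> \<le> d ^ DIM('a) * (1 / r) ^ DIM('a)"
  proof (intro mult_mono 1 power_mono)
    have "1 \<le> sqrt pi" using pi_gt3 by simp
    then show "1 / (sqrt pi * r) \<le> 1 / r" using r by (intro divide_left_mono) auto
  qed (use r d in auto)
  finally show ?thesis by (simp add: d_def r_def)
qed

definition gaussian_mixture :: "(real \<Rightarrow> real) \<Rightarrow> 'a::euclidean_space \<Rightarrow> real" where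
  "gaussian_mixture \<omega> x = (LINT \<sigma>|lborel. \<omega> \<sigma> * heat_kernel \<sigma> x)"

lemma gaussian_mixture_bound:
  fixes x :: "'a::euclidean_space"
  assumes \<omega>: "integrable lborel \<omega>" "\<And>\<sigma>. \<sigma> \<le> 0 \<Longrightarrow> \<omega> \<sigma> = 0" and x: "x \<noteq> 0"
  shows "\<bar>gaussian_mixture \<omega> x\<bar> \<le> (LINT \<sigma>|lborel. \<bar>\<omega> \<sigma>\<bar>) * (real DIM('a) ^ DIM('a) * (1 / norm x) ^ DIM('a))"
proof -
  let ?B = "real DIM('a) ^ DIM('a) * (1 / norm x) ^ DIM('a)"
  have b: "norm (\<omega> \<sigma> * heat_kernel \<sigma> x) \<le> \<bar>\<omega> \<sigma>\<bar> * ?B" for \<sigma>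
  proof (cases "\<sigma> > 0")
    case True
    then show ?thesis
      using heat_kernel_bound[OF True x] heat_kernel_nonneg[of \<sigma> x] by (simp add: abs_mult mult_left_mono)
  qed (simp add: \<omega>)
  have i: "integrable lborel (\<lambda>\<sigma>. \<bar>\<omega> \<sigma>\<bar> * ?B)" using \<omega>(1) by simp
  have [measurable]: "\<omega> \<in> borel_measurable borel" using \<omega>(1) by simp
  have [measurable]: "(\<lambda>\<sigma>. heat_kernel \<sigma> x) \<in> borel_measurable borel" unfolding heat_kernel_def by measurable
  have "norm (gaussian_mixture \<omega> x) \<le> (LINT \<sigma>|lborel. \<bar>\<omega> \<sigma>\<bar> * ?B)"
    unfolding gaussian_mixture_def
  proof (rule Bochner_Integration.integral_norm_bound_integral)
    show "integrable lborel (\<lambda>\<sigma>. \<omega> \<sigma> * heat_kernel \<sigma> x)"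
      by (rule Bochner_Integration.integrable_bound[OF i]) (use b in \<open>auto intro!: AE_I2 order_trans[OF _ abs_ge_self]\<close>)
  qed (use i b in auto)
  then show ?thesis by simp
qed

lemma gaussian_mixture_integrable:
  assumes \<omega>: "integrable lborel \<omega>" "\<And>\<sigma>. \<sigma> \<le> 0 \<Longrightarrow> \<omega> \<sigma> = 0"
  shows "integrable lborel (gaussian_mixture \<omega> :: 'a::euclidean_space \<Rightarrow> real)"
  unfolding gaussian_mixture_def
proof (rule lborel_integrable_fubini_dominated)
  have [measurable]: "\<omega> \<in> borel_measurable borel" using \<omega>(1) by simp
  show "(\<lambda>(\<sigma>, x::'a). \<omega> \<sigma> * heat_kernel \<sigma> x) \<in> borel_measurable (borel \<Otimes>\<^sub>M borel)"
    unfolding split_beta' by measurable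
  have hk: "integrable lborel (heat_kernel \<sigma> :: 'a \<Rightarrow> real)" "(LINT x::'a|lborel. heat_kernel \<sigma> x) = 1" if "\<sigma> > 0" for \<sigma>
    using heat_kernel_has_integral[OF that, where 'a = 'a] by (auto simp: has_bochner_integral_iff)
  show "integrable lborel (\<lambda>x::'a. \<omega> \<sigma> * heat_kernel \<sigma> x)" for \<sigma>
    by (cases "\<sigma> > 0") (simp_all add: hk \<omega>)
  show "(LINT x::'a|lborel. norm (\<omega> \<sigma> * heat_kernel \<sigma> x)) \<le> \<bar>\<omega> \<sigma>\<bar>" for \<sigma>
    by (cases "\<sigma> > 0") (simp_all add: hk \<omega> abs_mult heat_kernel_nonneg)
  show "integrable lborel (\<lambda>\<sigma>. \<bar>\<omega> \<sigma>\<bar>)" using \<omega>(1) by simp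
qed

text \<open>
  The Fourier transform of a superposition of heat kernels is the Laplace transform of its weight,
  evaluated at \<open>|\<xi>|\<^sup>2\<close>. The identity is used for the density of the regular part of \<open>1 / log s\<close> and for the
  resolvent of the Laplacian.
\<close>

lemma gaussian_mixture_pairing:
  fixes g :: "'a::euclidean_space \<Rightarrow> complex"
  assumes \<omega>: "integrable lborel \<omega>" "\<And>\<sigma>. \<sigma> \<le> 0 \<Longrightarrow> \<omega> \<sigma> = 0" and g: "g \<in> schwartz"
  shows "(2 * pi) ^ DIM('a) * (LINT x|lborel. of_real (gaussian_mixture \<omega> x) * g x)
    = (LINT \<xi>|lborel. of_real (LINT \<sigma>|lborel. \<omega> \<sigma> * exp (- (\<sigma> * (\<xi> \<bullet> \<xi>)))) * fourier g \<xi>)"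
proof -
  have [measurable]: "\<omega> \<in> borel_measurable borel" using \<omega>(1) by simp
  have gi: "integrable lborel g" by (rule schwartz_integrable[OF g])
  have Gi: "integrable lborel (fourier g)" by (intro schwartz_integrable fourier_schwartz g)
  have [measurable]: "g \<in> borel_measurable borel" "fourier g \<in> borel_measurable borel" using gi Gi by auto
  obtain M where M: "\<And>x. norm (g x) \<le> M" using schwartz_decay[OF g, of 0] by auto
  have hk: "integrable lborel (heat_kernel \<sigma> :: 'a \<Rightarrow> real)" "(LINT x::'a|lborel. heat_kernel \<sigma> x) = 1" if "\<sigma> > 0" for \<sigma>
    using heat_kernel_has_integral[OF that, where 'a = 'a] by (auto simp: has_bochner_integral_iff)
  have hkg: "integrable lborel (\<lambda>x. of_real (heat_kernel \<sigma> x) * g x)" if "\<sigma> > 0" for \<sigma>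
  proof (rule Bochner_Integration.integrable_bound[OF integrable_mult_right[OF hk(1)[OF that], of M]])
    show "AE x in lborel. norm (of_real (heat_kernel \<sigma> x) * g x) \<le> norm (M * heat_kernel \<sigma> x)"
    proof (intro AE_I2)
      fix x :: 'a
      have "norm (g x) * heat_kernel \<sigma> x \<le> M * heat_kernel \<sigma> x"
        using that by (intro mult_right_mono M heat_kernel_nonneg) simp
      then show "norm (of_real (heat_kernel \<sigma> x) * g x) \<le> norm (M * heat_kernel \<sigma> x)"
        using heat_kernel_nonneg[of \<sigma> x] that by (simp add: norm_mult mult.commute)
    qed
  qed measurable
  define K where "K \<sigma> x = of_real (\<omega> \<sigma> * heat_kernel \<sigma> x) * g x" for \<sigma> x
  define L where "L \<sigma> \<xi> = of_real (\<omega> \<sigma> * exp (- (\<sigma> * (\<xi> \<bullet> \<xi>)))) * fourier g \<xi>" for \<sigma> \<xi>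
  have KL: "(2 * pi) ^ DIM('a) * (LINT x|lborel. K \<sigma> x) = (LINT \<xi>|lborel. L \<sigma> \<xi>)" for \<sigma>
  proof (cases "\<sigma> > 0")
    case True
    have "(LINT \<xi>|lborel. L \<sigma> \<xi>) = of_real (\<omega> \<sigma>) * (LINT \<xi>|lborel. exp (- (\<i> * of_real (\<xi> \<bullet> 0))) * of_real (exp (- (\<sigma> * (\<xi> \<bullet> \<xi>)))) * fourier g \<xi>)"
      unfolding L_def by (subst integral_mult_right_zero[symmetric]) (simp add: mult.assoc)
    also have "\<dots> = of_real (\<omega> \<sigma>) * ((2 * pi) ^ DIM('a) * (LINT y|lborel. of_real (heat_kernel \<sigma> (0 + y)) * g y))"
      unfolding integral_fourier_gaussian[OF gi True] ..
    also have "\<dots> = (2 * pi) ^ DIM('a) * (LINT x|lborel. K \<sigma> x)"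
      unfolding K_def by (simp add: mult.assoc mult.left_commute)
    finally show ?thesis ..
  qed (simp add: K_def L_def \<omega>)
  have "(LINT x|lborel. of_real (gaussian_mixture \<omega> x) * g x) = (LINT x|lborel. LINT \<sigma>|lborel. K \<sigma> x)"
    unfolding gaussian_mixture_def K_def by (simp only: integral_mult_left_zero integral_complex_of_real)
  also have "\<dots> = (LINT \<sigma>|lborel. LINT x|lborel. K \<sigma> x)"
  proof (rule lborel_fubini_dominated[symmetric])
    show "case_prod K \<in> borel_measurable (borel \<Otimes>\<^sub>M borel)"
      unfolding K_def split_beta' by measurable
    show "integrable lborel (K \<sigma>)" for \<sigma>
      unfolding K_def using hkg[of \<sigma>] \<omega> by (cases "\<sigma> > 0") (simp_all add: mult.assoc)
    show "(LINT x|lborel. norm (K \<sigma> x)) \<le> \<bar>\<omega> \<sigma>\<bar> * M" for \<sigma>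
    proof (cases "\<sigma> > 0")
      case True
      have "(LINT x|lborel. norm (K \<sigma> x)) \<le> (LINT x::'a|lborel. (\<bar>\<omega> \<sigma>\<bar> * M) * heat_kernel \<sigma> x)"
      proof (rule integral_mono)
        show "integrable lborel (\<lambda>x. norm (K \<sigma> x))"
          unfolding K_def using hkg[OF True] by (simp add: mult.assoc)
        show "integrable lborel (\<lambda>x::'a. (\<bar>\<omega> \<sigma>\<bar> * M) * heat_kernel \<sigma> x)" using hk[OF True] by simp
        fix x :: 'a
        have "norm (K \<sigma> x) = \<bar>\<omega> \<sigma>\<bar> * heat_kernel \<sigma> x * norm (g x)"
          using heat_kernel_nonneg[of \<sigma> x] True by (simp add: K_def norm_mult)
        also have "\<dots> \<le> \<bar>\<omega> \<sigma>\<bar> * heat_kernel \<sigma> x * M"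
          using heat_kernel_nonneg[of \<sigma> x] True by (intro mult_left_mono M) auto
        finally show "norm (K \<sigma> x) \<le> (\<bar>\<omega> \<sigma>\<bar> * M) * heat_kernel \<sigma> x" by (simp add: ac_simps)
      qed
      then show ?thesis using hk[OF True] by simp
    qed (simp add: K_def \<omega>)
    show "integrable lborel (\<lambda>\<sigma>. \<bar>\<omega> \<sigma>\<bar> * M)" using \<omega>(1) by simp
  qed
  finally have "(2 * pi) ^ DIM('a) * (LINT x|lborel. of_real (gaussian_mixture \<omega> x) * g x)
     = (LINT \<sigma>|lborel. LINT \<xi>|lborel. L \<sigma> \<xi>)"
    unfolding KL[symmetric] by simp
  also have "\<dots> = (LINT \<xi>|lborel. LINT \<sigma>|lborel. L \<sigma> \<xi>)"
  proof (rule lborel_fubini_dominated)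
    show "case_prod L \<in> borel_measurable (borel \<Otimes>\<^sub>M borel)"
      unfolding L_def split_beta' by measurable
    have nL: "norm (L \<sigma> \<xi>) \<le> \<bar>\<omega> \<sigma>\<bar> * norm (fourier g \<xi>)" for \<sigma> \<xi>
    proof (cases "\<sigma> > 0")
      case True
      have "\<bar>\<omega> \<sigma>\<bar> * exp (- (\<sigma> * (\<xi> \<bullet> \<xi>))) \<le> \<bar>\<omega> \<sigma>\<bar> * 1"
        using True by (intro mult_left_mono) auto
      then show ?thesis unfolding L_def by (simp add: norm_mult abs_mult mult_right_mono)
    qed (simp add: L_def \<omega>)
    have [measurable]: "L \<sigma> \<in> borel_measurable borel" for \<sigma> unfolding L_def by measurable
    have i: "integrable lborel (\<lambda>\<xi>. \<bar>\<omega> \<sigma>\<bar> * norm (fourier g \<xi>))" for \<sigma> using Gi by simp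
    show iL: "integrable lborel (L \<sigma>)" for \<sigma>
      by (rule Bochner_Integration.integrable_bound[OF i[of \<sigma>]]) (use nL[of \<sigma>] in \<open>auto intro!: AE_I2\<close>)
    show "(LINT \<xi>|lborel. norm (L \<sigma> \<xi>)) \<le> \<bar>\<omega> \<sigma>\<bar> * (LINT \<xi>|lborel. norm (fourier g \<xi>))" for \<sigma>
      using integral_mono[OF integrable_norm[OF iL[of \<sigma>]] i[of \<sigma>] nL] by simp
    show "integrable lborel (\<lambda>\<sigma>. \<bar>\<omega> \<sigma>\<bar> * (LINT \<xi>|lborel. norm (fourier g \<xi>)))" using \<omega>(1) by simp
  qed
  also have "\<dots> = (LINT \<xi>|lborel. of_real (LINT \<sigma>|lborel. \<omega> \<sigma> * exp (- (\<sigma> * (\<xi> \<bullet> \<xi>)))) * fourier g \<xi>)"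
    unfolding L_def by (simp only: integral_mult_left_zero integral_complex_of_real)
  finally show ?thesis .
qed

section \<open>Holomorphic dependence of integrals on a parameter\<close>

text \<open>
  A local majorant of the integrand bounds its derivative by Cauchy's inequality, hence also its
  difference quotients, and dominated convergence applies to the latter.
\<close>

lemma holomorphic_on_parametric_integral:
  fixes f :: "complex \<Rightarrow> 'b \<Rightarrow> complex"
  assumes U: "open U"
    and meas: "\<And>z. z \<in> U \<Longrightarrow> f z \<in> borel_measurable M"
    and hol: "AE x in M. (\<lambda>z. f z x) holomorphic_on U"
    and bound: "\<And>z. z \<in> U \<Longrightarrow> \<exists>\<delta>>0. \<exists>B. cball z \<delta> \<subseteq> U \<and> integrable M B \<and> (AE x in M. \<forall>w\<in>cball z \<delta>. norm (f w x) \<le> B x)"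
  shows "(\<lambda>z. LINT x|M. f z x) holomorphic_on U"
  unfolding holomorphic_on_def
proof
  fix z assume z: "z \<in> U"
  obtain \<delta> B where \<delta>: "\<delta> > 0" "cball z \<delta> \<subseteq> U" and B: "integrable M B"
    and bd: "AE x in M. \<forall>w\<in>cball z \<delta>. norm (f w x) \<le> B x"
    using bound[OF z] by blast
  define \<epsilon> where "\<epsilon> = \<delta> / 2"
  have \<epsilon>: "\<epsilon> > 0" using \<delta> by (simp add: \<epsilon>_def)
  have int: "integrable M (f w)" if "w \<in> cball z \<delta>" for w
  proof (rule Bochner_Integration.integrable_bound[OF B meas])
    show "AE x in M. norm (f w x) \<le> norm (B x)" using bd by eventually_elim (use that in force)
  qed (use that \<delta> in auto)
  have quot: "AE x in M. \<forall>w\<in>cball z \<epsilon>. norm (f w x - f z x) \<le> B x / \<epsilon> * norm (w - z)"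
    using bd hol
  proof eventually_elim
    case (elim x)
    show ?case
    proof
      fix w assume w: "w \<in> cball z \<epsilon>"
      show "norm (f w x - f z x) \<le> B x / \<epsilon> * norm (w - z)"
      proof (rule field_differentiable_bound[of "cball z \<epsilon>" "\<lambda>w. f w x" "deriv (\<lambda>w. f w x)"])
        fix v assume v: "v \<in> cball z \<epsilon>"
        then have vU: "v \<in> U" and sub: "cball v \<epsilon> \<subseteq> cball z \<delta>"
          using \<delta> \<epsilon> by (auto simp: \<epsilon>_def subset_iff dist_commute) (smt (verit) dist_triangle dist_commute field_sum_of_halves)+
        show "((\<lambda>w. f w x) has_field_derivative deriv (\<lambda>w. f w x) v) (at v within cball z \<epsilon>)"
          using holomorphic_derivI[OF elim(2) U vU] by (rule has_field_derivative_at_within)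
        have "(\<lambda>w. f w x) holomorphic_on cball v \<epsilon>"
          by (rule holomorphic_on_subset[OF elim(2)]) (use sub \<delta> in blast)
        then have "norm ((deriv ^^ 1) (\<lambda>w. f w x) v) \<le> fact 1 * B x / \<epsilon> ^ 1"
          using \<epsilon> elim(1) sub
          by (intro Cauchy_inequality) (auto intro: holomorphic_on_subset holomorphic_on_imp_continuous_on simp: dist_norm)
        then show "norm (deriv (\<lambda>w. f w x) v) \<le> B x / \<epsilon>" by simp
      qed (use w \<epsilon> in auto)
    qed
  qed
  have sub: "cball z \<epsilon> \<subseteq> cball z \<delta>" using \<delta> by (auto simp: \<epsilon>_def)
  let ?q = "\<lambda>w x. (f w x - f z x) / (w - z)"
  have lim_q: "AE x in M. (\<lambda>i. ?q (Y i) x) \<longlonglongrightarrow> deriv (\<lambda>w. f w x) z"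
    if "Y \<longlonglongrightarrow> z" "\<And>i. Y i \<noteq> z" for Y
    using hol
  proof eventually_elim
    case (elim x)
    have "((\<lambda>w. ?q w x) \<longlongrightarrow> deriv (\<lambda>w. f w x) z) (at z)"
      using holomorphic_derivI[OF elim U z, of UNIV] unfolding has_field_derivative_iff .
    moreover have "filterlim Y (at z) sequentially" using that by (simp add: filterlim_at)
    ultimately show ?case by (rule filterlim_compose)
  qed
  have meas_q: "?q w \<in> borel_measurable M" if "w \<in> cball z \<epsilon>" for w
    using int[of w] int[of z] that sub \<delta>
    by (intro borel_measurable_integrable integrable_divide Bochner_Integration.integrable_diff) auto
  \<comment> \<open>the derivative of the integrand, chosen as a pointwise limit of quotients so that it is measurable\<close>
  define Y0 where "Y0 i = z + of_real (\<epsilon> * inverse (real (Suc i)))" for i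
  have Y0: "Y0 i \<in> cball z \<epsilon>" "Y0 i \<noteq> z" for i
  proof -
    have "norm (complex_of_real (\<epsilon> * inverse (real (Suc i)))) = \<epsilon> * inverse (real (Suc i))"
      unfolding norm_of_real using \<epsilon> by simp
    also have "\<dots> \<le> \<epsilon> * 1" using \<epsilon> by (intro mult_left_mono) (auto simp: inverse_le_1_iff)
    finally show "Y0 i \<in> cball z \<epsilon>" by (simp add: Y0_def dist_norm)
    show "Y0 i \<noteq> z" using \<epsilon> by (simp add: Y0_def del: of_nat_Suc)
  qed
  have Y0_lim: "Y0 \<longlonglongrightarrow> z"
  proof -
    have "Y0 \<longlonglongrightarrow> z + of_real (\<epsilon> * 0)"
      unfolding Y0_def by (intro tendsto_intros LIMSEQ_inverse_real_of_nat)
    then show ?thesis by simp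
  qed
  define D where "D x = lim (\<lambda>i. ?q (Y0 i) x)" for x
  have D_meas: "D \<in> borel_measurable M"
    unfolding D_def using meas_q[OF Y0(1)] by measurable
  have D_eq: "AE x in M. D x = deriv (\<lambda>w. f w x) z"
    using lim_q[OF Y0_lim Y0(2)] by eventually_elim (simp add: D_def limI)
  have "((\<lambda>w. ((LINT x|M. f w x) - (LINT x|M. f z x)) / (w - z)) \<longlongrightarrow> (LINT x|M. D x)) (at z)"
    unfolding tendsto_at_iff_sequentially comp_def
  proof (intro allI impI)
    fix X :: "nat \<Rightarrow> complex" assume X: "\<forall>i. X i \<in> UNIV - {z}" and lim: "X \<longlonglongrightarrow> z"
    have "\<forall>\<^sub>F i in sequentially. dist (X i) z < \<epsilon>" using lim \<epsilon> by (rule tendstoD)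
    then obtain N where N: "\<And>i. i \<ge> N \<Longrightarrow> dist (X i) z < \<epsilon>" unfolding eventually_sequentially by blast
    define Y where "Y i = X (i + N)" for i
    have Y: "Y i \<in> cball z \<epsilon>" "Y i \<noteq> z" for i
      using N[of "i + N"] X by (auto simp: Y_def dist_commute)
    have Yl: "Y \<longlonglongrightarrow> z" unfolding Y_def using lim by (rule LIMSEQ_ignore_initial_segment)
    have "(\<lambda>i. LINT x|M. ?q (Y i) x) \<longlonglongrightarrow> (LINT x|M. D x)"
    proof (rule integral_dominated_convergence)
      show "integrable M (\<lambda>x. B x / \<epsilon>)" using B by simp
      show "AE x in M. (\<lambda>i. ?q (Y i) x) \<longlonglongrightarrow> D x"
        using lim_q[OF Yl Y(2)] D_eq by eventually_elim simp
      show "AE x in M. norm (?q (Y i) x) \<le> B x / \<epsilon>" for i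
        using quot
      proof eventually_elim
        case (elim x)
        have "norm (f (Y i) x - f z x) \<le> B x / \<epsilon> * norm (Y i - z)" using elim Y(1) by blast
        then show ?case using Y(2)[of i] by (simp add: norm_divide divide_le_eq)
      qed
    qed (use D_meas meas_q[OF Y(1)] in auto)
    moreover have "(LINT x|M. ?q (Y i) x) = ((LINT x|M. f (Y i) x) - (LINT x|M. f z x)) / (Y i - z)" for i
    proof -
      have "integrable M (f (Y i))" "integrable M (f z)"
        using int[OF subsetD[OF sub Y(1)]] int[of z] \<delta> by auto
      then show ?thesis by (simp only: integral_divide_zero Bochner_Integration.integral_diff)
    qed
    ultimately have "(\<lambda>i. ((LINT x|M. f (Y i) x) - (LINT x|M. f z x)) / (Y i - z)) \<longlonglongrightarrow> (LINT x|M. D x)"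
      by (simp only:)
    then show "(\<lambda>i. ((LINT x|M. f (X i) x) - (LINT x|M. f z x)) / (X i - z)) \<longlonglongrightarrow> (LINT x|M. D x)"
      unfolding Y_def by (rule LIMSEQ_offset)
  qed
  then have "((\<lambda>z. LINT x|M. f z x) has_field_derivative (LINT x|M. D x)) (at z)"
    unfolding has_field_derivative_iff .
  then show "(\<lambda>z. LINT x|M. f z x) field_differentiable at z within U"
    using field_differentiable_at_within field_differentiable_def by blast
qed

section \<open>The Helmholtz kernel\<close>

lemma measurable_csqrt [measurable]: "csqrt \<in> borel_measurable borel"
  unfolding borel_measurable_complex_iff csqrt.simps sgn_if by measurable

lemma norm_add_square_ge:
  assumes "Re a \<ge> 0"
  shows "norm a \<le> norm (a + of_real (w\<^sup>2))"
proof -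
  have "(Re a)\<^sup>2 \<le> (Re a + w\<^sup>2)\<^sup>2" using assms by (intro power_mono) auto
  then show ?thesis by (simp add: cmod_def)
qed

text \<open>
  In terms of the Macdonald function this is \<open>exp a K\<^sub>0(a)\<close>. In this representation the argument of the
  square root has modulus at least \<open>|a|\<close> as long as \<open>Re a \<ge> 0\<close>, so that it remains valid on
  the imaginary axis, where \<open>K\<^sub>0\<close> becomes a Hankel function, and immediately yields the decay
  \<open>|a|\<close> to the power \<open>- 1 / 2\<close>.
\<close>

definition bessel_integral :: "complex \<Rightarrow> complex" where
  "bessel_integral a = (LINT w|lborel. of_real (exp (- (2 * w\<^sup>2))) * inverse (csqrt (a + of_real (w\<^sup>2))))"

lemma gauss_1d_integral:
  "has_bochner_integral lborel (\<lambda>w::real. exp (- (2 * w\<^sup>2))) (sqrt (pi / 2))"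
  using integral_gauss_1d[of 2 0]
  by (simp add: has_bochner_integral_iff complex_of_real_integrable_eq integral_complex_of_real)

lemma bessel_integrand_bound:
  assumes "Re a \<ge> 0" "a \<noteq> 0"
  shows "norm (of_real (exp (- (2 * w\<^sup>2))) * inverse (csqrt (a + of_real (w\<^sup>2)))) \<le> inverse (sqrt (norm a)) * exp (- (2 * w\<^sup>2))"
proof -
  have "inverse (sqrt (norm (a + of_real (w\<^sup>2)))) \<le> inverse (sqrt (norm a))"
    using norm_add_square_ge[OF assms(1), of w] assms(2) by (intro le_imp_inverse_le) auto
  from mult_right_mono[OF this, of "exp (- (2 * w\<^sup>2))"]
  show ?thesis by (simp only: norm_mult norm_of_real norm_inverse norm_csqrt abs_exp_cancel exp_ge_zero mult.commute)
qed

lemma norm_bessel_integral_le: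
  assumes "Re a \<ge> 0" "a \<noteq> 0"
  shows "norm (bessel_integral a) \<le> sqrt (pi / 2) * inverse (sqrt (norm a))"
proof -
  have i: "integrable lborel (\<lambda>w. inverse (sqrt (norm a)) * exp (- (2 * w\<^sup>2)))"
    using gauss_1d_integral by (simp add: has_bochner_integral_iff)
  have "norm (bessel_integral a) \<le> (LINT w|lborel. inverse (sqrt (norm a)) * exp (- (2 * w\<^sup>2)))"
    unfolding bessel_integral_def
  proof (rule Bochner_Integration.integral_norm_bound_integral[OF _ i])
    show "integrable lborel (\<lambda>w. of_real (exp (- (2 * w\<^sup>2))) * inverse (csqrt (a + of_real (w\<^sup>2))))"
      by (rule Bochner_Integration.integrable_bound[OF i])
         (use bessel_integrand_bound[OF assms] in \<open>auto intro!: AE_I2\<close>)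
  qed (rule bessel_integrand_bound[OF assms])
  then show ?thesis using gauss_1d_integral by (simp add: has_bochner_integral_iff mult.commute)
qed

lemma bessel_arg_not_nonpos:
  assumes "Re a \<ge> 0" "a \<noteq> 0"
  shows "a + of_real (w\<^sup>2) \<notin> \<real>\<^sub>\<le>\<^sub>0"
proof
  assume "a + of_real (w\<^sup>2) \<in> \<real>\<^sub>\<le>\<^sub>0"
  then have "Im a = 0" "Re a + w\<^sup>2 \<le> 0" by (auto simp: complex_nonpos_Reals_iff)
  then have "Re a = 0" using assms(1) zero_le_power2[of w] by linarith
  with \<open>Im a = 0\<close> assms(2) show False by (simp add: complex_eq_iff)
qed

lemma bessel_integral_holomorphic: "bessel_integral holomorphic_on {a. Re a > 0}"
  unfolding bessel_integral_def
proof (rule holomorphic_on_parametric_integral)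
  show "open {a. Re a > 0}" by (rule open_halfspace_Re_gt)
  show "AE w in lborel. (\<lambda>a. of_real (exp (- (2 * w\<^sup>2))) * inverse (csqrt (a + of_real (w\<^sup>2)))) holomorphic_on {a. Re a > 0}"
  proof (intro AE_I2 holomorphic_intros)
    fix w :: real and a assume a: "a \<in> {a. Re a > 0}"
    then have "a + of_real (w\<^sup>2) \<notin> \<real>\<^sub>\<le>\<^sub>0" by (intro bessel_arg_not_nonpos) auto
    then show "a + of_real (w\<^sup>2) \<notin> \<real>\<^sub>\<le>\<^sub>0" .
    from \<open>a + of_real (w\<^sup>2) \<notin> \<real>\<^sub>\<le>\<^sub>0\<close> show "csqrt (a + of_real (w\<^sup>2)) \<noteq> 0" by (metis csqrt_eq_0 nonpos_Reals_zero_I)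
  qed
  fix a assume a: "a \<in> {a. Re a > 0}"
  define \<delta> where "\<delta> = Re a / 2"
  have \<delta>: "\<delta> > 0" using a by (simp add: \<delta>_def)
  have re: "Re b \<ge> \<delta>" if "b \<in> cball a \<delta>" for b
    using that abs_Re_le_cmod[of "a - b"] by (simp add: dist_norm \<delta>_def)
  show "\<exists>\<delta>>0. \<exists>B. cball a \<delta> \<subseteq> {a. Re a > 0} \<and> integrable lborel B \<and>
     (AE w in lborel. \<forall>b\<in>cball a \<delta>. norm (of_real (exp (- (2 * w\<^sup>2))) * inverse (csqrt (b + of_real (w\<^sup>2)))) \<le> B w)"
  proof (intro exI[of _ \<delta>] exI[of _ "\<lambda>w. inverse (sqrt \<delta>) * exp (- (2 * w\<^sup>2))"] conjI \<delta> AE_I2 ballI)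
    show "cball a \<delta> \<subseteq> {a. Re a > 0}" using re \<delta> by force
    show "integrable lborel (\<lambda>w. inverse (sqrt \<delta>) * exp (- (2 * w\<^sup>2)))"
      using gauss_1d_integral by (simp add: has_bochner_integral_iff)
    fix w :: real and b assume b: "b \<in> cball a \<delta>"
    have 1: "Re b \<ge> \<delta>" "\<delta> \<le> norm b" using re[OF b] abs_Re_le_cmod[of b] by auto
    then have "inverse (sqrt (norm b)) \<le> inverse (sqrt \<delta>)" using \<delta> by (intro le_imp_inverse_le) auto
    then have "inverse (sqrt (norm b)) * exp (- (2 * w\<^sup>2)) \<le> inverse (sqrt \<delta>) * exp (- (2 * w\<^sup>2))"
      by (intro mult_right_mono) auto
    moreover have "b \<noteq> 0" "Re b \<ge> 0" using 1 \<delta> by auto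
    ultimately show "norm (of_real (exp (- (2 * w\<^sup>2))) * inverse (csqrt (b + of_real (w\<^sup>2)))) \<le> inverse (sqrt \<delta>) * exp (- (2 * w\<^sup>2))"
      using bessel_integrand_bound[of b w] by linarith
  qed
qed measurable

lemma bessel_integral_tendsto:
  assumes b: "b \<longlonglongrightarrow> a" and a: "Re a \<ge> 0" "a \<noteq> 0"
    and bn: "\<And>n. Re (b n) \<ge> 0" "\<And>n. norm (b n) \<ge> \<delta>" and \<delta>: "\<delta> > 0"
  shows "(\<lambda>n. bessel_integral (b n)) \<longlonglongrightarrow> bessel_integral a"
  unfolding bessel_integral_def
proof (rule integral_dominated_convergence)
  show "integrable lborel (\<lambda>w. inverse (sqrt \<delta>) * exp (- (2 * w\<^sup>2)))"
    using gauss_1d_integral by (simp add: has_bochner_integral_iff)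
  show "AE w in lborel. (\<lambda>n. of_real (exp (- (2 * w\<^sup>2))) * inverse (csqrt (b n + of_real (w\<^sup>2))))
     \<longlonglongrightarrow> of_real (exp (- (2 * w\<^sup>2))) * inverse (csqrt (a + of_real (w\<^sup>2)))"
  proof (intro AE_I2 tendsto_mult tendsto_const tendsto_inverse)
    fix w :: real
    have n: "a + of_real (w\<^sup>2) \<notin> \<real>\<^sub>\<le>\<^sub>0" by (rule bessel_arg_not_nonpos[OF a])
    show "(\<lambda>n. csqrt (b n + of_real (w\<^sup>2))) \<longlonglongrightarrow> csqrt (a + of_real (w\<^sup>2))"
      by (rule isCont_tendsto_compose[OF continuous_at_csqrt[OF n]]) (intro tendsto_intros b)
    show "csqrt (a + of_real (w\<^sup>2)) \<noteq> 0" using n by (metis csqrt_eq_0 nonpos_Reals_zero_I)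
  qed
  fix n
  show "AE w in lborel. norm (of_real (exp (- (2 * w\<^sup>2))) * inverse (csqrt (b n + of_real (w\<^sup>2)))) \<le> inverse (sqrt \<delta>) * exp (- (2 * w\<^sup>2))"
  proof (intro AE_I2)
    fix w :: real
    have "inverse (sqrt (norm (b n))) * exp (- (2 * w\<^sup>2)) \<le> inverse (sqrt \<delta>) * exp (- (2 * w\<^sup>2))"
      using bn(2)[of n] \<delta> by (intro mult_right_mono le_imp_inverse_le) auto
    moreover have "b n \<noteq> 0" using bn(2)[of n] \<delta> by auto
    ultimately show "norm (of_real (exp (- (2 * w\<^sup>2))) * inverse (csqrt (b n + of_real (w\<^sup>2)))) \<le> inverse (sqrt \<delta>) * exp (- (2 * w\<^sup>2))"
      using bessel_integrand_bound[OF bn(1)[of n], of w] by linarith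
  qed
qed measurable

text \<open>
  The radial kernel of \<open>(\<kappa>\<^sup>2 - \<Delta>)\<^sup>-\<^sup>1\<close> for \<open>d = 1\<close> and \<open>d = 2\<close>: \<open>exp (- \<kappa> r) / (2 \<kappa>)\<close> on the line and
  \<open>K\<^sub>0(\<kappa> r) / (2 \<pi>)\<close> in the plane.
\<close>

definition helmholtz_kernel :: "nat \<Rightarrow> complex \<Rightarrow> real \<Rightarrow> complex" where
  "helmholtz_kernel d \<kappa> r = exp (- (\<kappa> * of_real r)) *
     (if d = 1 then 1 / (2 * \<kappa>) else bessel_integral (\<kappa> * of_real r) / (2 * of_real pi))"

text \<open>
  The lower bound \<open>1 / 4\<close> for \<open>|\<kappa>|\<close> is what the region used for the analytic continuation provides; it makes
  the constant uniform there and in the limit \<open>\<kappa> \<rightarrow> - \<i>\<close>.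
\<close>

lemma helmholtz_kernel_bound:
  assumes d: "d \<in> {1, 2}" and \<kappa>: "Re \<kappa> \<ge> 0" "norm \<kappa> \<ge> 1 / 4" and r: "r > 0"
  shows "norm (helmholtz_kernel d \<kappa> r) \<le> 2 * r powr (- ((real d - 1) / 2))"
proof -
  have e: "norm (exp (- (\<kappa> * of_real r))) \<le> 1" using \<kappa> r by simp
  show ?thesis
  proof (cases "d = 1")
    case True
    have "norm (1 / (2 * \<kappa>)) \<le> 2" using \<kappa> by (simp add: norm_divide norm_mult divide_simps)
    then have "norm (exp (- (\<kappa> * of_real r))) * norm (1 / (2 * \<kappa>)) \<le> 1 * 2"
      using e by (intro mult_mono) auto
    then have "norm (helmholtz_kernel d \<kappa> r) \<le> 2"
      unfolding helmholtz_kernel_def if_P[OF True] by (subst norm_mult) simp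
    then show ?thesis using True r by simp
  next
    case False
    then have d2: "d = 2" using d by simp
    let ?a = "\<kappa> * of_real r"
    have a: "Re ?a \<ge> 0" "?a \<noteq> 0" using \<kappa> r by auto
    have "sqrt (r / 4) \<le> sqrt (norm ?a)"
      using mult_right_mono[OF \<kappa>(2), of r] r by (simp add: norm_mult)
    then have "inverse (sqrt (norm ?a)) \<le> inverse (sqrt (r / 4))" using r by (intro le_imp_inverse_le) auto
    also have "\<dots> = 2 * inverse (sqrt r)" by (simp add: real_sqrt_divide, simp only: divide_inverse)
    finally have i: "inverse (sqrt (norm ?a)) \<le> 2 * inverse (sqrt r)" .
    have "sqrt (pi / 2) \<le> sqrt 4" using pi_less_4 by (intro real_sqrt_le_mono) simp
    then have s: "sqrt (pi / 2) \<le> 2" by simp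
    have "sqrt (pi / 2) * inverse (sqrt (norm ?a)) \<le> 2 * (2 * inverse (sqrt r))"
      by (rule mult_mono[OF s i]) auto
    with norm_bessel_integral_le[OF a] have "norm (bessel_integral ?a) \<le> 2 * (2 * inverse (sqrt r))"
      by (rule order_trans)
    then have "norm (bessel_integral ?a / (2 * of_real pi)) \<le> 4 * inverse (sqrt r) / (2 * pi)"
    proof -
      have "norm (bessel_integral ?a / (2 * of_real pi)) = norm (bessel_integral ?a) / (2 * pi)"
        by (simp add: norm_divide norm_mult)
      also have "\<dots> \<le> 2 * (2 * inverse (sqrt r)) / (2 * pi)"
        using \<open>norm (bessel_integral ?a) \<le> 2 * (2 * inverse (sqrt r))\<close> by (intro divide_right_mono) auto
      finally show ?thesis by simp
    qed
    also have "\<dots> \<le> 4 * inverse (sqrt r) / 2"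
      using pi_gt3 r by (intro divide_left_mono) auto
    finally have b: "norm (bessel_integral ?a / (2 * of_real pi)) \<le> 2 * inverse (sqrt r)" by simp
    have "norm (exp (- ?a)) * norm (bessel_integral ?a / (2 * of_real pi)) \<le> 1 * (2 * inverse (sqrt r))"
      using e b by (intro mult_mono) auto
    then have "norm (helmholtz_kernel d \<kappa> r) \<le> 2 * inverse (sqrt r)"
      unfolding helmholtz_kernel_def if_not_P[OF False] by (subst norm_mult) (simp only: mult_1)
    moreover have "r powr (- (1 / 2)) = inverse (sqrt r)"
      using r by (simp add: powr_minus powr_half_sqrt)
    ultimately show ?thesis using d2 by simp
  qed
qed

lemma bessel_integral_measurable [measurable]: "bessel_integral \<in> borel_measurable borel"
  unfolding bessel_integral_def
  by (rule lborel.borel_measurable_lebesgue_integral) measurable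

lemma helmholtz_kernel_measurable [measurable]:
  "(\<lambda>x::'a::euclidean_space. helmholtz_kernel d \<kappa> (norm x)) \<in> borel_measurable borel"
  unfolding helmholtz_kernel_def by measurable

lemma helmholtz_kernel_holomorphic:
  assumes "r > 0"
  shows "(\<lambda>\<kappa>. helmholtz_kernel d \<kappa> r) holomorphic_on {\<kappa>. Re \<kappa> > 0}"
proof (cases "d = 1")
  case True
  then show ?thesis unfolding helmholtz_kernel_def by (auto intro!: holomorphic_intros)
next
  case False
  have "(bessel_integral \<circ> (\<lambda>\<kappa>. \<kappa> * of_real r)) holomorphic_on {\<kappa>. Re \<kappa> > 0}"
    by (rule holomorphic_on_compose_gen[OF _ bessel_integral_holomorphic])
       (use assms in \<open>auto intro!: holomorphic_intros\<close>)
  then show ?thesis unfolding helmholtz_kernel_def using False by (auto intro!: holomorphic_intros simp: comp_def)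
qed

lemma integral_substitution_pos:
  fixes f g g' :: "real \<Rightarrow> real"
  assumes der: "\<And>w. (g has_real_derivative g' w) (at w)" and pos: "\<And>w. g' w > 0"
    and range: "range g = {0<..}" and [measurable]: "f \<in> borel_measurable borel"
    and int: "has_bochner_integral lborel (\<lambda>w. g' w * f (g w)) b"
  shows "(LINT s|lborel. indicator {0<..} s * f s) = b"
proof -
  have mono: "strict_mono g"
    by (rule strict_monoI, rule DERIV_pos_imp_increasing) (use der pos in blast)+
  have ip: "integrable lborel (\<lambda>w. g' w * f (g w))" and eb: "(LINT w|lborel. g' w * f (g w)) = b"
    using int by (auto simp: has_bochner_integral_iff)
  have m: "(\<lambda>w. g' w * f (g w)) \<in> borel_measurable lborel" using ip by simp
  have hi: "((\<lambda>w. g' w * f (g w)) has_integral b) UNIV"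
    using has_integral_integral_lborel[OF ip] eb by simp
  have "(\<lambda>w. \<bar>g' w\<bar> * f (g w)) absolutely_integrable_on UNIV \<and> integral UNIV (\<lambda>w. \<bar>g' w\<bar> * f (g w)) = b"
  proof
    show "(\<lambda>w. \<bar>g' w\<bar> * f (g w)) absolutely_integrable_on UNIV"
      using ip pos by (simp add: set_integrable_def integrable_completion[OF m] less_imp_le)
    show "integral UNIV (\<lambda>w. \<bar>g' w\<bar> * f (g w)) = b"
      using hi pos by (simp add: less_imp_le integral_unique)
  qed
  then have "f absolutely_integrable_on range g \<and> integral (range g) f = b"
    by (subst (asm) has_absolute_integral_change_of_variables_1')
       (use der mono in \<open>auto intro: has_field_derivative_at_within strict_mono_imp_inj_on\<close>)
  then have 1: "f absolutely_integrable_on {0<..}" "integral {0<..} f = b" unfolding range by auto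
  have "(LINT s|lborel. indicator {0<..} s * f s) = (LINT s|lebesgue. indicator {0<..} s * f s)"
    by (rule integral_completion[symmetric]) measurable
  also have "\<dots> = b"
    using set_lebesgue_integral_eq_integral(2)[OF 1(1)] 1(2) by (simp add: set_lebesgue_integral_def)
  finally show ?thesis .
qed

definition damped_weight :: "real \<Rightarrow> real \<Rightarrow> real" where
  "damped_weight k \<sigma> = indicator {0<..} \<sigma> * exp (- (k\<^sup>2 * \<sigma>))"

lemma damped_weight_laplace:
  assumes "k > 0" "s \<ge> 0"
  shows "has_bochner_integral lborel (\<lambda>\<sigma>. damped_weight k \<sigma> * exp (- (\<sigma> * s))) (1 / (s + k\<^sup>2))"
proof (rule has_bochner_integral_nn_integral)
  have pos: "s + k\<^sup>2 > 0" using assms by (simp add: add_nonneg_pos)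
  have "damped_weight k \<sigma> * exp (- (\<sigma> * s)) = indicator {0<..} \<sigma> * exp (- ((s + k\<^sup>2) * \<sigma>))" for \<sigma>
    by (simp add: damped_weight_def algebra_simps flip: exp_add)
  then show "(\<integral>\<^sup>+\<sigma>. ennreal (damped_weight k \<sigma> * exp (- (\<sigma> * s))) \<partial>lborel) = ennreal (1 / (s + k\<^sup>2))"
    by (simp only: nn_integral_exp_decay[OF pos])
  show "0 \<le> 1 / (s + k\<^sup>2)" using pos by simp
qed (auto simp: damped_weight_def)

lemma damped_weight_integrable: "k > 0 \<Longrightarrow> integrable lborel (damped_weight k)"
  using damped_weight_laplace[of k 0] by (simp add: has_bochner_integral_iff)

text \<open>
  The closed form of the resolvent kernel for real \<open>k\<close>. With \<open>a = k |x|\<close>, the substitution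
  \<open>\<sigma> = (w + sqrt (a + w\<^sup>2))\<^sup>2 / (2 k\<^sup>2)\<close> turns the exponent \<open>k\<^sup>2 \<sigma> + |x|\<^sup>2 / (4 \<sigma>)\<close> into \<open>a + 2 w\<^sup>2\<close>. In
  dimension one the remaining factor is a constant plus an odd function of \<open>w\<close>, in dimension two it is
  \<open>1 / sqrt (a + w\<^sup>2)\<close>.
\<close>

lemma gaussian_mixture_damped:
  fixes x :: "'a::euclidean_space"
  assumes d: "DIM('a) \<in> {1, 2}" and k: "k > 0" and x: "x \<noteq> 0"
  shows "of_real (gaussian_mixture (damped_weight k) x) = helmholtz_kernel DIM('a) (of_real k) (norm x)"
proof -
  define r where "r = norm x"
  have r: "r > 0" using x by (simp add: r_def)
  define a where "a = k * r"
  have a: "a > 0" using k r by (simp add: a_def)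
  \<comment> \<open>q (w) and S (w) - w are positive with product a, which is what makes the exponent quadratic in w\<close>
  define S where "S w = sqrt (a + w\<^sup>2)" for w
  have S: "S w > 0" "(S w)\<^sup>2 = a + w\<^sup>2" for w using a by (auto simp: S_def add_pos_nonneg)
  have Sw: "\<bar>w\<bar> < S w" for w
    unfolding S_def using a by (intro real_less_rsqrt) simp
  define q where "q w = w + S w" for w
  have q: "q w > 0" for w using Sw[of w] by (simp add: q_def)
  have q2: "(S w - w) * q w = a" for w using S(2)[of w] by (simp add: q_def algebra_simps power2_eq_square)
  define g where "g w = (q w)\<^sup>2 / (2 * k\<^sup>2)" for w
  define g' where "g' w = 2 * g w / S w" for w
  have g: "g w > 0" for w using q[of w] k by (simp add: g_def)
  have gp: "g' w > 0" for w using g[of w] S(1)[of w] by (simp add: g'_def)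
  have Sder: "(S has_real_derivative w / S w) (at w)" for w
  proof -
    have "a + w\<^sup>2 > 0" using a by (simp add: add_pos_nonneg)
    then show ?thesis unfolding S_def by (auto intro!: derivative_eq_intros simp: divide_simps)
  qed
  have der: "(g has_real_derivative g' w) (at w)" for w
  proof -
    have "(q has_real_derivative 1 + w / S w) (at w)"
      unfolding q_def by (intro derivative_intros Sder)
    then have "(g has_real_derivative (2 * q w * (1 + w / S w)) / (2 * k\<^sup>2)) (at w)"
      unfolding g_def by (intro DERIV_cdivide) (auto intro!: derivative_eq_intros)
    moreover have "1 + w / S w = q w / S w" using S(1)[of w] by (simp add: q_def field_simps)
    ultimately show ?thesis by (simp add: g'_def g_def power2_eq_square ac_simps)
  qed
  have rng: "range g = {0<..}"
  proof (intro equalityI subsetI)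
    fix \<sigma> :: real assume "\<sigma> \<in> {0<..}"
    then have \<sigma>: "\<sigma> > 0" by simp
    define Q where "Q = k * sqrt (2 * \<sigma>)"
    have Q: "Q > 0" using k \<sigma> by (simp add: Q_def)
    define w where "w = (Q - a / Q) / 2"
    have "a + w\<^sup>2 = ((Q + a / Q) / 2)\<^sup>2"
      using Q by (simp add: w_def power2_eq_square field_simps)
    then have "S w = (Q + a / Q) / 2"
      unfolding S_def using Q a by (simp add: real_sqrt_unique)
    then have "q w = Q" by (simp add: q_def w_def field_simps)
    then have "g w = \<sigma>" using k \<sigma> by (simp add: g_def Q_def power_mult_distrib)
    then show "\<sigma> \<in> range g" by blast
  qed (use g in auto)
  define f where "f \<sigma> = exp (- (k\<^sup>2 * \<sigma>)) * heat_kernel \<sigma> x" for \<sigma>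
  have [measurable]: "f \<in> borel_measurable borel" unfolding f_def heat_kernel_def by measurable
  have fg: "f (g w) = exp (- a) * exp (- (2 * w\<^sup>2)) / (sqrt (2 * pi) * (q w / k)) ^ DIM('a)" for w
  proof -
    have 1: "k\<^sup>2 * g w = (q w)\<^sup>2 / 2" using k by (simp add: g_def)
    have "a\<^sup>2 = (S w - w)\<^sup>2 * (q w)\<^sup>2" unfolding q2[of w, symmetric] by (simp add: power_mult_distrib)
    then have 2: "r\<^sup>2 / (4 * g w) = (S w - w)\<^sup>2 / 2"
      using q[of w] k by (simp add: g_def a_def power_mult_distrib field_simps)
    have "(q w)\<^sup>2 / 2 + (S w - w)\<^sup>2 / 2 = (S w)\<^sup>2 + w\<^sup>2"
      by (simp add: q_def power2_eq_square field_simps)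
    then have "(q w)\<^sup>2 / 2 + (S w - w)\<^sup>2 / 2 = a + 2 * w\<^sup>2"
      using S(2)[of w] by simp
    then have e: "exp (- (k\<^sup>2 * g w)) * exp (- (r\<^sup>2 / (4 * g w))) = exp (- a) * exp (- (2 * w\<^sup>2))"
      unfolding 1 2 exp_add[symmetric] by simp
    have "sqrt (4 * pi * g w) = sqrt (2 * pi) * (q w / k)"
      using q[of w] k by (simp add: g_def real_sqrt_mult real_sqrt_divide)
    then show ?thesis
      unfolding f_def heat_kernel_def using e by (simp add: dot_square_norm r_def[symmetric])
  qed
  have ga: "has_bochner_integral lborel (\<lambda>w::real. exp (- (2 * w\<^sup>2))) (sqrt (pi / 2))"
    by (rule gauss_1d_integral)
  obtain b where b: "has_bochner_integral lborel (\<lambda>w. g' w * f (g w)) b"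
    and hb: "of_real b = helmholtz_kernel DIM('a) (of_real k) r"
  proof (cases "DIM('a) = 1")
    case True
    define \<phi> where "\<phi> w = exp (- (2 * w\<^sup>2)) * (w / S w)" for w :: real
    have \<phi>i: "integrable lborel \<phi>"
    proof (rule Bochner_Integration.integrable_bound[of lborel "\<lambda>w::real. exp (- (2 * w\<^sup>2))"])
      show "integrable lborel (\<lambda>w::real. exp (- (2 * w\<^sup>2)))" using ga by (simp add: has_bochner_integral_iff)
      show "\<phi> \<in> borel_measurable lborel" unfolding \<phi>_def S_def by measurable
      have "norm (\<phi> w) \<le> norm (exp (- (2 * w\<^sup>2)))" for w
      proof -
        have "\<bar>w / S w\<bar> \<le> 1" using Sw[of w] S(1)[of w] by (simp add: abs_divide)
        then have "exp (- (2 * w\<^sup>2)) * \<bar>w / S w\<bar> \<le> exp (- (2 * w\<^sup>2)) * 1" by (intro mult_left_mono) auto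
        then show ?thesis by (simp only: \<phi>_def real_norm_def abs_mult abs_exp_cancel mult_1_right)
      qed
      then show "AE w in lborel. norm (\<phi> w) \<le> norm (exp (- (2 * w\<^sup>2)))" by simp
    qed
    \<comment> \<open>the odd part of the integrand does not contribute\<close>
    have "(LINT w|lborel. \<phi> w) = (LINT w|lborel. \<phi> (0 + (- 1) * w))"
      using lborel_integral_real_affine[of "-1" \<phi> 0] by simp
    also have "\<dots> = - (LINT w|lborel. \<phi> w)" by (simp add: \<phi>_def S_def)
    finally have "(LINT w|lborel. \<phi> w) = 0" by simp
    with \<phi>i have "has_bochner_integral lborel \<phi> 0" by (simp add: has_bochner_integral_iff)
    from has_bochner_integral_mult_right[OF has_bochner_integral_add[OF ga this], of "exp (- a) / (k * sqrt (2 * pi))"]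
    have "has_bochner_integral lborel (\<lambda>w. exp (- a) / (k * sqrt (2 * pi)) * (exp (- (2 * w\<^sup>2)) + \<phi> w))
        (exp (- a) / (k * sqrt (2 * pi)) * (sqrt (pi / 2) + 0))" by simp
    moreover have "exp (- a) / (k * sqrt (2 * pi)) * (exp (- (2 * w\<^sup>2)) + \<phi> w) = g' w * f (g w)" for w
    proof -
      have "exp (- (2 * w\<^sup>2)) + \<phi> w = exp (- (2 * w\<^sup>2)) * (q w / S w)"
        using S(1)[of w] by (simp add: \<phi>_def q_def field_simps)
      moreover have "c / (k * p) * (E * (Q / T)) = 2 * (Q\<^sup>2 / (2 * k\<^sup>2)) / T * (c * E / (p * (Q / k)) ^ 1)"
        if "p > 0" "Q > 0" "T > 0" for c p E Q T :: real
        using that k by (simp add: field_simps power2_eq_square)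
      ultimately show ?thesis
        unfolding fg True using q[of w] S(1)[of w] by (simp add: g'_def g_def)
    qed
    ultimately have 1: "has_bochner_integral lborel (\<lambda>w. g' w * f (g w)) (exp (- a) / (k * sqrt (2 * pi)) * (sqrt (pi / 2) + 0))"
      by simp
    have "exp (- a) / (k * sqrt (2 * pi)) * (sqrt (pi / 2) + 0) = exp (- a) / (2 * k)"
      using k by (simp add: real_sqrt_mult real_sqrt_divide field_simps)
    then have "of_real (exp (- a) / (k * sqrt (2 * pi)) * (sqrt (pi / 2) + 0)) = helmholtz_kernel DIM('a) (of_real k) r"
      unfolding helmholtz_kernel_def using True by (simp add: a_def exp_of_real[symmetric])
    with 1 that show ?thesis by blast
  next
    case False
    then have d2: "DIM('a) = 2" using d by simp
    define B where "B = (LINT w|lborel. exp (- (2 * w\<^sup>2)) * inverse (S w))"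
    have integrand: "of_real (exp (- (2 * w\<^sup>2))) * inverse (csqrt (of_real a + of_real (w\<^sup>2))) = complex_of_real (exp (- (2 * w\<^sup>2)) * inverse (S w))" for w
    proof -
      have "csqrt (of_real (a + w\<^sup>2)) = of_real (S w)"
        unfolding S_def using a by (intro csqrt_of_real) (simp add: add_nonneg_nonneg)
      then show ?thesis by simp
    qed
    have Bi: "integrable lborel (\<lambda>w. exp (- (2 * w\<^sup>2)) * inverse (S w))"
    proof (rule Bochner_Integration.integrable_bound[of lborel "\<lambda>w::real. inverse (sqrt a) * exp (- (2 * w\<^sup>2))"])
      show "integrable lborel (\<lambda>w::real. inverse (sqrt a) * exp (- (2 * w\<^sup>2)))" using ga by (simp add: has_bochner_integral_iff)
      show "(\<lambda>w. exp (- (2 * w\<^sup>2)) * inverse (S w)) \<in> borel_measurable lborel" unfolding S_def by measurable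
      have "norm (exp (- (2 * w\<^sup>2)) * inverse (S w)) \<le> norm (inverse (sqrt a) * exp (- (2 * w\<^sup>2)))" for w
      proof -
        have "inverse (S w) \<le> inverse (sqrt a)" using a unfolding S_def by (intro le_imp_inverse_le) auto
        then show ?thesis using S(1)[of w] a by (simp add: abs_mult mult.commute)
      qed
      then show "AE w in lborel. norm (exp (- (2 * w\<^sup>2)) * inverse (S w)) \<le> norm (inverse (sqrt a) * exp (- (2 * w\<^sup>2)))" by simp
    qed
    have bessel: "bessel_integral (of_real a) = of_real B"
      unfolding bessel_integral_def B_def integrand integral_complex_of_real ..
    have "has_bochner_integral lborel (\<lambda>w. exp (- (2 * w\<^sup>2)) * inverse (S w)) B"
      using Bi by (simp add: B_def has_bochner_integral_iff)
    from has_bochner_integral_mult_right[OF this, of "exp (- a) / (2 * pi)"]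
    have "has_bochner_integral lborel (\<lambda>w. exp (- a) / (2 * pi) * (exp (- (2 * w\<^sup>2)) * inverse (S w))) (exp (- a) / (2 * pi) * B)" by simp
    moreover have "exp (- a) / (2 * pi) * (exp (- (2 * w\<^sup>2)) * inverse (S w)) = g' w * f (g w)" for w
    proof -
      have "c / (2 * pi) * (E * inverse T) = 2 * (Q\<^sup>2 / (2 * k\<^sup>2)) / T * (c * E / (2 * pi * (Q\<^sup>2 / k\<^sup>2)))"
        if "Q > 0" "T > 0" for c E Q T :: real
        using that k by (simp add: field_simps)
      moreover have "(sqrt (2 * pi) * (q w / k))\<^sup>2 = 2 * pi * ((q w)\<^sup>2 / k\<^sup>2)"
        by (simp only: power_mult_distrib power_divide) simp
      ultimately show ?thesis
        unfolding fg d2 using q[of w] S(1)[of w] by (simp only: g'_def g_def)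
    qed
    ultimately have 1: "has_bochner_integral lborel (\<lambda>w. g' w * f (g w)) (exp (- a) / (2 * pi) * B)"
      by simp
    have "of_real (exp (- a) / (2 * pi) * B) = helmholtz_kernel DIM('a) (of_real k) r"
      unfolding helmholtz_kernel_def using d2 bessel by (simp add: a_def exp_of_real[symmetric])
    with 1 that show ?thesis by blast
  qed
  have "gaussian_mixture (damped_weight k) x = (LINT \<sigma>|lborel. indicator {0<..} \<sigma> * f \<sigma>)"
    unfolding gaussian_mixture_def damped_weight_def f_def by (simp add: mult.assoc)
  also have "\<dots> = b"
    by (rule integral_substitution_pos[OF der gp rng _ b]) measurable
  finally show ?thesis using hb by (simp add: r_def)
qed

text \<open>
  Both bounds come from the factorization \<open>s + \<kappa>\<^sup>2 = (sqrt s + \<i> \<kappa>) (sqrt s - \<i> \<kappa>)\<close>, by comparing imaginary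
  or real parts. The second one makes \<open>1 / |s - 1|\<close> a majorant for the limit \<open>\<kappa> \<rightarrow> - \<i>\<close>.
\<close>

lemma norm_symbol_ge:
  fixes s :: real
  assumes "s \<ge> 0"
  shows "(Re \<kappa>)\<^sup>2 \<le> norm (of_real s + \<kappa>\<^sup>2)"
    and "Im \<kappa> = - 1 \<Longrightarrow> \<bar>s - 1\<bar> \<le> norm (of_real s + \<kappa>\<^sup>2)"
proof -
  define q where "q = sqrt s"
  have q: "q \<ge> 0" "q\<^sup>2 = s" using assms by (auto simp: q_def)
  have "of_real s + \<kappa>\<^sup>2 = (of_real q + \<i> * \<kappa>) * (of_real q - \<i> * \<kappa>)"
    by (simp add: algebra_simps power2_eq_square q(2)[symmetric])
  then have n: "norm (of_real s + \<kappa>\<^sup>2) = norm (of_real q + \<i> * \<kappa>) * norm (of_real q - \<i> * \<kappa>)"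
    by (simp add: norm_mult)
  have im: "\<bar>Re \<kappa>\<bar> \<le> norm (of_real q + \<i> * \<kappa>)" "\<bar>Re \<kappa>\<bar> \<le> norm (of_real q - \<i> * \<kappa>)"
    using abs_Im_le_cmod[of "of_real q + \<i> * \<kappa>"] abs_Im_le_cmod[of "of_real q - \<i> * \<kappa>"] by auto
  have "\<bar>Re \<kappa>\<bar> * \<bar>Re \<kappa>\<bar> \<le> norm (of_real s + \<kappa>\<^sup>2)"
    unfolding n by (intro mult_mono im) auto
  then show "(Re \<kappa>)\<^sup>2 \<le> norm (of_real s + \<kappa>\<^sup>2)" by (simp add: power2_eq_square)
  assume "Im \<kappa> = - 1"
  then have re: "q + 1 \<le> norm (of_real q + \<i> * \<kappa>)" "\<bar>q - 1\<bar> \<le> norm (of_real q - \<i> * \<kappa>)"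
    using abs_Re_le_cmod[of "of_real q + \<i> * \<kappa>"] abs_Re_le_cmod[of "of_real q - \<i> * \<kappa>"] by auto
  have "\<bar>s - 1\<bar> = (q + 1) * \<bar>q - 1\<bar>"
  proof -
    have "s - 1 = (q + 1) * (q - 1)" by (simp add: q(2)[symmetric] algebra_simps power2_eq_square)
    then show ?thesis using q(1) by (simp only: abs_mult abs_of_nonneg add_nonneg_nonneg zero_le_one)
  qed
  also have "\<dots> \<le> norm (of_real s + \<kappa>\<^sup>2)"
    unfolding n using q by (intro mult_mono re) auto
  finally show "\<bar>s - 1\<bar> \<le> norm (of_real s + \<kappa>\<^sup>2)" .
qed

section \<open>Limiting absorption\<close>

lemma helmholtz_majorant_integrable:
  fixes g :: "'a::euclidean_space \<Rightarrow> complex"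
  assumes "g \<in> schwartz"
  shows "integrable lborel (\<lambda>x. 2 * norm x powr (- ((real DIM('a) - 1) / 2)) * norm (g x))"
proof -
  have "integrable lborel (\<lambda>x. complex_of_real (2 * norm x powr (- ((real DIM('a) - 1) / 2))) * g x)"
    by (rule schwartz_integrable_mult[OF assms, where M = 2 and a = "(real DIM('a) - 1) / 2"])
       (auto simp: norm_mult field_simps Suc_leI intro: le_less_trans[of _ "real DIM('a) - 1"])
  from integrable_norm[OF this] show ?thesis by (simp add: norm_mult abs_mult)
qed

lemma helmholtz_kernel_tendsto:
  assumes d: "d \<in> {1, 2}" and r: "r > 0" and t: "t \<longlonglongrightarrow> 0" "\<And>n. t n \<ge> 0"
  shows "(\<lambda>n. helmholtz_kernel d (of_real (t n) - \<i>) r) \<longlonglongrightarrow> helmholtz_kernel d (- \<i>) r"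
proof -
  have k: "(\<lambda>n. of_real (t n) - \<i>) \<longlonglongrightarrow> - \<i>"
    using tendsto_diff[OF tendsto_of_real[OF t(1)] tendsto_const[of \<i>]] by simp
  have e: "(\<lambda>n. exp (- ((of_real (t n) - \<i>) * of_real r))) \<longlonglongrightarrow> exp (- (- \<i> * of_real r))"
    by (intro tendsto_intros k)
  show ?thesis
  proof (cases "d = 1")
    case True
    have "(\<lambda>n. 1 / (2 * (of_real (t n) - \<i>))) \<longlonglongrightarrow> 1 / (2 * - \<i>)"
      by (intro tendsto_intros k) simp
    from tendsto_mult[OF e this] show ?thesis unfolding helmholtz_kernel_def using True by simp
  next
    case False
    have "(\<lambda>n. bessel_integral ((of_real (t n) - \<i>) * of_real r)) \<longlonglongrightarrow> bessel_integral (- \<i> * of_real r)"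
    proof (rule bessel_integral_tendsto[where \<delta> = r])
      show "(\<lambda>n. (of_real (t n) - \<i>) * of_real r) \<longlonglongrightarrow> - \<i> * of_real r" by (intro tendsto_intros k)
      show "r \<le> norm ((of_real (t n) - \<i>) * of_real r)" for n
      proof -
        have "1 \<le> norm (of_real (t n) - \<i>)" using abs_Im_le_cmod[of "of_real (t n) - \<i>"] by simp
        from mult_right_mono[OF this, of r] show ?thesis using r by (simp add: norm_mult)
      qed
    qed (use r t in auto)
    then have "(\<lambda>n. bessel_integral ((of_real (t n) - \<i>) * of_real r) / (2 * of_real pi)) \<longlonglongrightarrow> bessel_integral (- \<i> * of_real r) / (2 * of_real pi)"
      by (intro tendsto_intros) auto
    from tendsto_mult[OF e this] show ?thesis unfolding helmholtz_kernel_def if_not_P[OF False] .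
  qed
qed

text \<open>
  Both sides are holomorphic in \<open>\<kappa>\<close>, and they agree for real \<open>\<kappa>\<close> because the kernel is then a
  superposition of heat kernels.
\<close>

lemma helmholtz_pairing_damped:
  fixes g :: "'a::euclidean_space \<Rightarrow> complex"
  assumes d: "DIM('a) \<in> {1, 2}" and g: "g \<in> schwartz" and \<kappa>: "Re \<kappa> > 0" "Re \<kappa> - Im \<kappa> > 1 / 2"
  shows "(2 * pi) ^ DIM('a) * (LINT x|lborel. helmholtz_kernel DIM('a) \<kappa> (norm x) * g x)
     = (LINT \<xi>|lborel. fourier g \<xi> / (of_real (\<xi> \<bullet> \<xi>) + \<kappa>\<^sup>2))"
proof -
  \<comment> \<open>an intersection of half-planes: convex, away from 0, and containing 1 and t - i for every t > 0\<close>
  define U where "U = {\<kappa>. Re \<kappa> > 0} \<inter> {\<kappa>. Re \<kappa> - Im \<kappa> > 1 / 2}"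
  have halfplane: "{\<kappa>. Re \<kappa> - Im \<kappa> > 1 / 2} = {\<kappa>. inner (Complex 1 (- 1)) \<kappa> > 1 / 2}"
    by (auto simp: inner_complex_def)
  have U: "open U" "convex U"
    unfolding U_def halfplane
    by (intro open_Int open_halfspace_Re_gt open_halfspace_gt, intro convex_Int convex_halfspace_Re_gt convex_halfspace_gt)
  have norm_U: "norm w \<ge> 1 / 4" "Re w > 0" if "w \<in> U" for w
    using that abs_Re_le_cmod[of w] abs_Im_le_cmod[of w] by (auto simp: U_def)
  have Gi: "integrable lborel (fourier g)" by (intro schwartz_integrable fourier_schwartz g)
  have [measurable]: "g \<in> borel_measurable borel" "fourier g \<in> borel_measurable borel"
    using Gi schwartz_borel_measurable[OF g] by auto
  define \<Phi> where "\<Phi> \<kappa> = (LINT x|lborel. helmholtz_kernel DIM('a) \<kappa> (norm x) * g x)" for \<kappa>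
  define \<Psi> where "\<Psi> \<kappa> = (LINT \<xi>|lborel. fourier g \<xi> / (of_real (\<xi> \<bullet> \<xi>) + \<kappa>\<^sup>2))" for \<kappa>
  have \<Phi>: "\<Phi> holomorphic_on U"
    unfolding \<Phi>_def
  proof (rule holomorphic_on_parametric_integral[OF U(1)])
    show "AE x in lborel. (\<lambda>z. helmholtz_kernel DIM('a) z (norm x) * g x) holomorphic_on U"
      using lborel_AE_nonzero
    proof eventually_elim
      case (elim x)
      then show ?case
        by (intro holomorphic_intros holomorphic_on_subset[OF helmholtz_kernel_holomorphic]) (auto simp: U_def)
    qed
    fix z assume z: "z \<in> U"
    obtain \<delta> where \<delta>: "\<delta> > 0" "cball z \<delta> \<subseteq> U" using U(1) z open_contains_cball by metis
    have "AE x in lborel. \<forall>w\<in>cball z \<delta>. norm (helmholtz_kernel DIM('a) w (norm x) * g x)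
        \<le> 2 * norm x powr (- ((real DIM('a) - 1) / 2)) * norm (g x)"
      using lborel_AE_nonzero
    proof eventually_elim
      case (elim x)
      show ?case
      proof
        fix w assume "w \<in> cball z \<delta>"
        then have w: "w \<in> U" using \<delta> by blast
        show "norm (helmholtz_kernel DIM('a) w (norm x) * g x) \<le> 2 * norm x powr (- ((real DIM('a) - 1) / 2)) * norm (g x)"
          unfolding norm_mult
          by (intro mult_right_mono helmholtz_kernel_bound[OF d]) (use norm_U[OF w] elim in auto)
      qed
    qed
    then show "\<exists>\<delta>>0. \<exists>B. cball z \<delta> \<subseteq> U \<and> integrable lborel B \<and>
        (AE x in lborel. \<forall>w\<in>cball z \<delta>. norm (helmholtz_kernel DIM('a) w (norm x) * g x) \<le> B x)"
      using \<delta> helmholtz_majorant_integrable[OF g] by blast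
  qed measurable
  have \<Psi>: "\<Psi> holomorphic_on U"
    unfolding \<Psi>_def
  proof (rule holomorphic_on_parametric_integral[OF U(1)])
    have nz: "of_real (\<xi> \<bullet> \<xi>) + z\<^sup>2 \<noteq> 0" if "z \<in> U" for \<xi> :: 'a and z
    proof -
      have "0 < (Re z)\<^sup>2" using norm_U[OF that] by simp
      also have "\<dots> \<le> norm (of_real (\<xi> \<bullet> \<xi>) + z\<^sup>2)" by (rule norm_symbol_ge) simp
      finally show ?thesis by auto
    qed
    then show "AE \<xi> in lborel. (\<lambda>z. fourier g \<xi> / (of_real (\<xi> \<bullet> \<xi>) + z\<^sup>2)) holomorphic_on U"
      by (intro AE_I2 holomorphic_intros) auto
    fix z assume z: "z \<in> U"
    obtain \<delta>0 where \<delta>0: "\<delta>0 > 0" "cball z \<delta>0 \<subseteq> U" using U(1) z open_contains_cball by metis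
    define c where "c = Re z / 2"
    have c: "c > 0" using norm_U[OF z] by (simp add: c_def)
    define \<delta> where "\<delta> = min \<delta>0 c"
    have \<delta>: "\<delta> > 0" "cball z \<delta> \<subseteq> U" using \<delta>0 c by (auto simp: \<delta>_def)
    have "norm (fourier g \<xi> / (of_real (\<xi> \<bullet> \<xi>) + w\<^sup>2)) \<le> norm (fourier g \<xi>) / c\<^sup>2" if w: "w \<in> cball z \<delta>" for w \<xi>
    proof -
      have "norm (z - w) \<le> c" using w by (simp add: dist_norm \<delta>_def)
      then have "Re w \<ge> c" using complex_Re_le_cmod[of "z - w"] by (simp add: c_def)
      then have "c\<^sup>2 \<le> (Re w)\<^sup>2" using c by (intro power_mono) auto
      also have "\<dots> \<le> norm (of_real (\<xi> \<bullet> \<xi>) + w\<^sup>2)" by (rule norm_symbol_ge) simp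
      finally have le: "c\<^sup>2 \<le> norm (of_real (\<xi> \<bullet> \<xi>) + w\<^sup>2)" .
      moreover have "0 < c\<^sup>2" using c by simp
      ultimately have "0 < norm (of_real (\<xi> \<bullet> \<xi>) + w\<^sup>2)" by (rule less_le_trans[rotated])
      then show ?thesis unfolding norm_divide
        by (intro divide_left_mono le mult_pos_pos \<open>0 < c\<^sup>2\<close>) auto
    qed
    then have "AE \<xi> in lborel. \<forall>w\<in>cball z \<delta>. norm (fourier g \<xi> / (of_real (\<xi> \<bullet> \<xi>) + w\<^sup>2)) \<le> norm (fourier g \<xi>) / c\<^sup>2"
      by (intro AE_I2 ballI)
    moreover have "integrable lborel (\<lambda>\<xi>. norm (fourier g \<xi>) / c\<^sup>2)" using Gi by simp
    ultimately show "\<exists>\<delta>>0. \<exists>B. cball z \<delta> \<subseteq> U \<and> integrable lborel B \<and>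
        (AE \<xi> in lborel. \<forall>w\<in>cball z \<delta>. norm (fourier g \<xi> / (of_real (\<xi> \<bullet> \<xi>) + w\<^sup>2)) \<le> B \<xi>)"
      using \<delta> by (intro exI[of _ \<delta>] exI[of _ "\<lambda>\<xi>. norm (fourier g \<xi>) / c\<^sup>2"] conjI)
  qed measurable
  have real_case: "(2 * pi) ^ DIM('a) * \<Phi> (of_real k) - \<Psi> (of_real k) = 0" if k: "k > 0" for k :: real
  proof -
    have "\<Phi> (of_real k) = (LINT x|lborel. of_real (gaussian_mixture (damped_weight k) x) * g x)"
      unfolding \<Phi>_def
    proof (rule integral_cong_AE)
      show "AE x in lborel. helmholtz_kernel DIM('a) (of_real k) (norm x) * g x = of_real (gaussian_mixture (damped_weight k) x) * g x"
        using lborel_AE_nonzero by eventually_elim (simp add: gaussian_mixture_damped[OF d k])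
      have [measurable]: "gaussian_mixture (damped_weight k) \<in> borel_measurable (borel :: 'a measure)"
        using gaussian_mixture_integrable[OF damped_weight_integrable[OF k], where 'a = 'a] by (simp add: damped_weight_def)
      show "(\<lambda>x. of_real (gaussian_mixture (damped_weight k) x) * g x) \<in> borel_measurable lborel" by measurable
    qed measurable
    moreover have "(LINT \<sigma>|lborel. damped_weight k \<sigma> * exp (- (\<sigma> * (\<xi> \<bullet> \<xi>)))) = 1 / (\<xi> \<bullet> \<xi> + k\<^sup>2)" for \<xi> :: 'a
      using damped_weight_laplace[OF k, of "\<xi> \<bullet> \<xi>"] by (simp add: has_bochner_integral_iff)
    moreover have "\<Psi> (of_real k) = (LINT \<xi>|lborel. of_real (1 / (\<xi> \<bullet> \<xi> + k\<^sup>2)) * fourier g \<xi>)"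
      unfolding \<Psi>_def by simp
    ultimately show ?thesis
      using gaussian_mixture_pairing[OF damped_weight_integrable[OF k] _ g] by (simp add: damped_weight_def)
  qed
  have "(2 * pi) ^ DIM('a) * \<Phi> \<kappa> - \<Psi> \<kappa> = 0"
  proof (rule analytic_continuation[where f = "\<lambda>\<kappa>. (2 * pi) ^ DIM('a) * \<Phi> \<kappa> - \<Psi> \<kappa>"
        and S = U and U = "complex_of_real ` {1/2<..}" and \<xi> = 1])
    show "(\<lambda>\<kappa>. (2 * pi) ^ DIM('a) * \<Phi> \<kappa> - \<Psi> \<kappa>) holomorphic_on U"
      by (intro holomorphic_intros \<Phi> \<Psi>)
    show "connected U" using U(2) by (rule convex_connected)
    show "1 islimpt complex_of_real ` {1/2<..}"
      unfolding islimpt_approachable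
    proof (intro allI impI)
      fix e :: real assume "e > 0"
      then have "complex_of_real (1 + e / 2) \<in> complex_of_real ` {1/2<..}" by (intro imageI) simp
      moreover have "complex_of_real (1 + e / 2) \<noteq> 1 \<and> dist (complex_of_real (1 + e / 2)) 1 < e"
        using \<open>e > 0\<close> by (simp add: dist_norm norm_divide)
      ultimately show "\<exists>x'\<in>complex_of_real ` {1/2<..}. x' \<noteq> 1 \<and> dist x' 1 < e" by blast
    qed
  qed (use U real_case \<kappa> in \<open>auto simp: U_def\<close>)
  then show ?thesis by (simp add: \<Phi>_def \<Psi>_def)
qed

lemma lborel_AE_not_unit_sphere: "AE \<xi>::'a::euclidean_space in lborel. \<xi> \<bullet> \<xi> \<noteq> 1"
proof -
  have "sphere (0::'a) 1 \<in> null_sets lborel"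
    using negligible_sphere[of "0::'a" 1] by (simp add: negligible_iff_null_sets null_sets_completion_iff)
  from AE_not_in[OF this] show ?thesis
  proof eventually_elim
    case (elim \<xi>)
    then have "norm \<xi> \<noteq> 1" by simp
    moreover have "norm \<xi> \<noteq> - 1" using norm_ge_zero[of \<xi>] by linarith
    ultimately show ?case by (simp add: dot_square_norm power2_eq_1_iff)
  qed
qed

text \<open>
  The limit \<open>\<kappa> = t - \<i>\<close>, \<open>t \<rightarrow> 0\<close> from the right. On the left the kernels have a common majorant, and on
  the right the assumed integrability of the limit provides one.
\<close>

lemma helmholtz_pairing:
  fixes g :: "'a::euclidean_space \<Rightarrow> complex"
  assumes d: "DIM('a) \<in> {1, 2}" and g: "g \<in> schwartz"
    and int: "integrable lborel (\<lambda>\<xi>. fourier g \<xi> / of_real (\<xi> \<bullet> \<xi> - 1))"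
  shows "(2 * pi) ^ DIM('a) * (LINT x|lborel. helmholtz_kernel DIM('a) (- \<i>) (norm x) * g x)
     = (LINT \<xi>|lborel. fourier g \<xi> / of_real (\<xi> \<bullet> \<xi> - 1))"
proof -
  have [measurable]: "g \<in> borel_measurable borel" "fourier g \<in> borel_measurable borel"
    by (intro schwartz_borel_measurable fourier_schwartz g)+
  define t where "t n = inverse (real (Suc n))" for n
  have t: "t \<longlonglongrightarrow> 0" "t n > 0" "t n \<ge> 0" for n
    unfolding t_def by (rule LIMSEQ_inverse_real_of_nat) auto
  let ?k = "\<lambda>n. of_real (t n) - \<i>"
  have lim1: "(\<lambda>n. LINT x|lborel. helmholtz_kernel DIM('a) (?k n) (norm x) * g x) \<longlonglongrightarrow> (LINT x|lborel. helmholtz_kernel DIM('a) (- \<i>) (norm x) * g x)"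
  proof (rule integral_dominated_convergence[OF _ _ helmholtz_majorant_integrable[OF g]])
    show "AE x in lborel. (\<lambda>n. helmholtz_kernel DIM('a) (?k n) (norm x) * g x) \<longlonglongrightarrow> helmholtz_kernel DIM('a) (- \<i>) (norm x) * g x"
      using lborel_AE_nonzero
      by eventually_elim (intro tendsto_mult tendsto_const helmholtz_kernel_tendsto[OF d] t, auto)
    show "AE x in lborel. norm (helmholtz_kernel DIM('a) (?k n) (norm x) * g x) \<le> 2 * norm x powr (- ((real DIM('a) - 1) / 2)) * norm (g x)" for n
      using lborel_AE_nonzero
    proof eventually_elim
      case (elim x)
      have "1 \<le> norm (?k n)" using abs_Im_le_cmod[of "?k n"] by simp
      then have "norm (?k n) \<ge> 1 / 4" by linarith
      then show ?case unfolding norm_mult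
        by (intro mult_right_mono helmholtz_kernel_bound[OF d]) (use elim t in auto)
    qed
  qed measurable
  have lim2: "(\<lambda>n. LINT \<xi>|lborel. fourier g \<xi> / (of_real (\<xi> \<bullet> \<xi>) + (?k n)\<^sup>2)) \<longlonglongrightarrow> (LINT \<xi>|lborel. fourier g \<xi> / of_real (\<xi> \<bullet> \<xi> - 1))"
  proof (rule integral_dominated_convergence[OF _ _ integrable_norm[OF int]])
    show "AE \<xi> in lborel. (\<lambda>n. fourier g \<xi> / (of_real (\<xi> \<bullet> \<xi>) + (?k n)\<^sup>2)) \<longlonglongrightarrow> fourier g \<xi> / of_real (\<xi> \<bullet> \<xi> - 1)"
      using lborel_AE_not_unit_sphere
    proof eventually_elim
      case (elim \<xi>)
      have "?k \<longlonglongrightarrow> - \<i>"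
        using tendsto_diff[OF tendsto_of_real[OF t(1)] tendsto_const[of \<i>]] by simp
      then have lim: "(\<lambda>n. of_real (\<xi> \<bullet> \<xi>) + (?k n)\<^sup>2) \<longlonglongrightarrow> of_real (\<xi> \<bullet> \<xi>) + (- \<i>)\<^sup>2"
        by (intro tendsto_intros)
      have "of_real (\<xi> \<bullet> \<xi>) + (- \<i>)\<^sup>2 = complex_of_real (\<xi> \<bullet> \<xi> - 1)" by simp
      moreover have "complex_of_real (\<xi> \<bullet> \<xi> - 1) \<noteq> 0"
        unfolding of_real_eq_0_iff using elim by simp
      ultimately show ?case using tendsto_divide[OF tendsto_const lim, of "fourier g \<xi>"] by (simp only: not_False_eq_True)
    qed
    show "AE \<xi> in lborel. norm (fourier g \<xi> / (of_real (\<xi> \<bullet> \<xi>) + (?k n)\<^sup>2)) \<le> norm (fourier g \<xi> / of_real (\<xi> \<bullet> \<xi> - 1))" for n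
      using lborel_AE_not_unit_sphere
    proof eventually_elim
      case (elim \<xi>)
      have "\<bar>\<xi> \<bullet> \<xi> - 1\<bar> \<le> norm (of_real (\<xi> \<bullet> \<xi>) + (?k n)\<^sup>2)" by (rule norm_symbol_ge) auto
      then show ?case unfolding norm_divide norm_of_real
        using elim by (intro divide_left_mono) (auto intro!: mult_pos_pos intro: less_le_trans[of 0 "\<bar>\<xi> \<bullet> \<xi> - 1\<bar>"])
    qed
  qed measurable
  have "(2 * pi) ^ DIM('a) * (LINT x|lborel. helmholtz_kernel DIM('a) (?k n) (norm x) * g x)
      = (LINT \<xi>|lborel. fourier g \<xi> / (of_real (\<xi> \<bullet> \<xi>) + (?k n)\<^sup>2))" for n
    using t(2)[of n] by (intro helmholtz_pairing_damped[OF d g]) auto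
  then have "(\<lambda>n. (2 * pi) ^ DIM('a) * (LINT x|lborel. helmholtz_kernel DIM('a) (?k n) (norm x) * g x)) \<longlonglongrightarrow> (LINT \<xi>|lborel. fourier g \<xi> / of_real (\<xi> \<bullet> \<xi> - 1))"
    using lim2 by (simp only:)
  from LIMSEQ_unique[OF tendsto_mult_left[OF lim1] this] show ?thesis .
qed

section \<open>The fundamental solution\<close>

definition log_kernel :: "'a::euclidean_space \<Rightarrow> complex" where
  "log_kernel x = helmholtz_kernel DIM('a) (- \<i>) (norm x) + of_real (gaussian_mixture log_density x)"

lemma log_density_nonpos: "\<sigma> \<le> 0 \<Longrightarrow> log_density \<sigma> = 0"
  by (simp add: log_density_def)

lemma log_mixture_integrable: "integrable lborel (gaussian_mixture log_density :: 'a::euclidean_space \<Rightarrow> real)"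
  by (rule gaussian_mixture_integrable[OF log_density_integrable log_density_nonpos])

lemma log_mixture_measurable [measurable]: "gaussian_mixture log_density \<in> borel_measurable (borel :: 'a::euclidean_space measure)"
  using log_mixture_integrable[where 'a = 'a] by simp

lemma log_kernel_measurable [measurable]: "log_kernel \<in> borel_measurable borel"
  unfolding log_kernel_def by measurable

lemma log_kernel_mult_integrable:
  fixes f :: "'a::euclidean_space \<Rightarrow> complex"
  assumes d: "DIM('a) \<in> {1, 2}" and f: "f \<in> schwartz"
  shows "integrable lborel (\<lambda>x. helmholtz_kernel DIM('a) (- \<i>) (norm x) * f x)"
    and "integrable lborel (\<lambda>x. of_real (gaussian_mixture log_density x) * f x)"
    and "integrable lborel (\<lambda>x. log_kernel x * f x)"
proof -
  note [measurable] = schwartz_borel_measurable[OF f]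
  show 1: "integrable lborel (\<lambda>x. helmholtz_kernel DIM('a) (- \<i>) (norm x) * f x)"
  proof (rule Bochner_Integration.integrable_bound[OF helmholtz_majorant_integrable[OF f]])
    show "AE x in lborel. norm (helmholtz_kernel DIM('a) (- \<i>) (norm x) * f x)
        \<le> norm (2 * norm x powr (- ((real DIM('a) - 1) / 2)) * norm (f x))"
      using lborel_AE_nonzero
    proof eventually_elim
      case (elim x)
      then have "norm (helmholtz_kernel DIM('a) (- \<i>) (norm x)) \<le> 2 * norm x powr (- ((real DIM('a) - 1) / 2))"
        by (intro helmholtz_kernel_bound[OF d]) auto
      from mult_right_mono[OF this norm_ge_zero] show ?case
        by (simp only: norm_mult real_norm_def) (simp add: abs_mult)
    qed
  qed measurable
  obtain M where M: "\<And>x. norm (f x) \<le> M" using schwartz_decay[OF f, of 0] by auto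
  show 2: "integrable lborel (\<lambda>x. of_real (gaussian_mixture log_density x) * f x)"
  proof (rule Bochner_Integration.integrable_bound[OF integrable_mult_right[OF log_mixture_integrable, of M]])
    show "AE x in lborel. norm (of_real (gaussian_mixture log_density x) * f x) \<le> norm (M * gaussian_mixture log_density x)"
    proof (intro AE_I2)
      fix x
      have "norm (f x) \<le> \<bar>M\<bar>" using M[of x] by linarith
      then show "norm (of_real (gaussian_mixture log_density x) * f x) \<le> norm (M * gaussian_mixture log_density x)"
        by (simp add: norm_mult abs_mult mult.commute mult_right_mono)
    qed
  qed measurable
  show "integrable lborel (\<lambda>x. log_kernel x * f x)"
    unfolding log_kernel_def distrib_right by (intro Bochner_Integration.integrable_add 1 2)
qed

text \<open>
  The two multipliers \<open>1 / (s - 1)\<close> and \<open>1 / log s - 1 / (s - 1)\<close> add up.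
\<close>

lemma log_kernel_pairing:
  fixes g :: "'a::euclidean_space \<Rightarrow> complex"
  assumes d: "DIM('a) \<in> {1, 2}" and g: "g \<in> schwartz"
    and int: "integrable lborel (\<lambda>\<xi>. fourier g \<xi> / of_real (\<xi> \<bullet> \<xi> - 1))"
  shows "(2 * pi) ^ DIM('a) * (LINT x|lborel. log_kernel x * g x)
     = (LINT \<xi>|lborel. fourier g \<xi> / of_real (ln (\<xi> \<bullet> \<xi>)))"
proof -
  have Gi: "integrable lborel (fourier g)" by (intro schwartz_integrable fourier_schwartz g)
  have [measurable]: "fourier g \<in> borel_measurable borel" using Gi by simp
  define m where "m \<xi> = (LINT \<sigma>|lborel. log_density \<sigma> * exp (- (\<sigma> * (\<xi> \<bullet> \<xi>))))" for \<xi> :: 'a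
  have [measurable]: "m \<in> borel_measurable borel"
    unfolding m_def by (rule lborel.borel_measurable_lebesgue_integral) measurable
  have m_bound: "\<bar>m \<xi>\<bar> \<le> (LINT \<sigma>|lborel. log_density \<sigma>)" for \<xi>
  proof -
    have le: "norm (log_density \<sigma> * exp (- (\<sigma> * (\<xi> \<bullet> \<xi>)))) \<le> log_density \<sigma>" for \<sigma>
    proof (cases "\<sigma> > 0")
      case True
      then have "log_density \<sigma> * exp (- (\<sigma> * (\<xi> \<bullet> \<xi>))) \<le> log_density \<sigma> * 1"
        by (intro mult_left_mono log_density_nonneg) simp
      then show ?thesis by (simp add: log_density_nonneg)
    qed (simp add: log_density_nonpos)
    have "norm (m \<xi>) \<le> (LINT \<sigma>|lborel. log_density \<sigma>)"
      unfolding m_def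
    proof (rule Bochner_Integration.integral_norm_bound_integral[OF _ log_density_integrable le])
      show "integrable lborel (\<lambda>\<sigma>. log_density \<sigma> * exp (- (\<sigma> * (\<xi> \<bullet> \<xi>))))"
        by (rule Bochner_Integration.integrable_bound[OF log_density_integrable])
           (use le log_density_nonneg in \<open>auto intro!: AE_I2\<close>)
    qed
    then show ?thesis by simp
  qed
  have int_m: "integrable lborel (\<lambda>\<xi>. of_real (m \<xi>) * fourier g \<xi>)"
  proof (rule Bochner_Integration.integrable_bound)
    show "integrable lborel (\<lambda>\<xi>. (LINT \<sigma>|lborel. log_density \<sigma>) * norm (fourier g \<xi>))" using Gi by simp
    show "AE \<xi> in lborel. norm (of_real (m \<xi>) * fourier g \<xi>) \<le> norm ((LINT \<sigma>|lborel. log_density \<sigma>) * norm (fourier g \<xi>))"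
      using m_bound by (intro AE_I2) (auto simp: norm_mult abs_mult intro!: mult_right_mono order_trans[OF _ abs_ge_self])
  qed measurable
  have "(2 * pi) ^ DIM('a) * (LINT x|lborel. log_kernel x * g x)
      = (2 * pi) ^ DIM('a) * (LINT x|lborel. helmholtz_kernel DIM('a) (- \<i>) (norm x) * g x)
        + (2 * pi) ^ DIM('a) * (LINT x|lborel. of_real (gaussian_mixture log_density x) * g x)"
    unfolding log_kernel_def distrib_right
    by (simp only: Bochner_Integration.integral_add[OF log_kernel_mult_integrable(1)[OF d g] log_kernel_mult_integrable(2)[OF d g]] distrib_left)
  also have "\<dots> = (LINT \<xi>|lborel. fourier g \<xi> / of_real (\<xi> \<bullet> \<xi> - 1)) + (LINT \<xi>|lborel. of_real (m \<xi>) * fourier g \<xi>)"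
  proof -
    have "(2 * pi) ^ DIM('a) * (LINT x|lborel. of_real (gaussian_mixture log_density x) * g x) = (LINT \<xi>|lborel. of_real (m \<xi>) * fourier g \<xi>)"
      unfolding m_def by (rule gaussian_mixture_pairing[OF log_density_integrable log_density_nonpos g])
    then show ?thesis by (simp only: helmholtz_pairing[OF d g int])
  qed
  also have "\<dots> = (LINT \<xi>|lborel. fourier g \<xi> / of_real (\<xi> \<bullet> \<xi> - 1) + of_real (m \<xi>) * fourier g \<xi>)"
    by (rule Bochner_Integration.integral_add[symmetric, OF int int_m])
  also have "\<dots> = (LINT \<xi>|lborel. fourier g \<xi> / of_real (ln (\<xi> \<bullet> \<xi>)))"
  proof (rule integral_cong_AE)
    show "AE \<xi> in lborel. fourier g \<xi> / of_real (\<xi> \<bullet> \<xi> - 1) + of_real (m \<xi>) * fourier g \<xi> = fourier g \<xi> / of_real (ln (\<xi> \<bullet> \<xi>))"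
      using lborel_AE_not_unit_sphere lborel_AE_nonzero
    proof eventually_elim
      case (elim \<xi>)
      have "m \<xi> = log_multiplier (\<xi> \<bullet> \<xi>)"
        using has_bochner_integral_log_density[of "\<xi> \<bullet> \<xi>"] elim by (simp add: m_def has_bochner_integral_iff)
      then have m: "m \<xi> = 1 / ln (\<xi> \<bullet> \<xi>) - 1 / (\<xi> \<bullet> \<xi> - 1)"
        using elim by (simp add: log_multiplier_def)
      have "fourier g \<xi> / of_real (\<xi> \<bullet> \<xi> - 1) + of_real (m \<xi>) * fourier g \<xi> = of_real (1 / (\<xi> \<bullet> \<xi> - 1) + m \<xi>) * fourier g \<xi>"
        by (simp add: algebra_simps)
      also have "1 / (\<xi> \<bullet> \<xi> - 1) + m \<xi> = 1 / ln (\<xi> \<bullet> \<xi>)" unfolding m by simp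
      finally show ?case by simp
    qed
  qed measurable
  finally show ?thesis .
qed

text \<open>
  A form of \<open>|log s| / |s - 1| \<le> 2 (|log s| + 1)\<close>: the quotient is bounded near \<open>1\<close>, and away from \<open>1\<close> it is
  dominated by the logarithm. It makes the division by \<open>s - 1\<close> in the next lemma harmless.
\<close>

lemma abs_ln_le_near_one:
  fixes s :: real
  assumes "s > 0"
  shows "\<bar>ln s\<bar> \<le> 2 * \<bar>s - 1\<bar> * (\<bar>ln s\<bar> + 1)"
proof (cases "\<bar>s - 1\<bar> \<le> 1 / 2")
  case True
  then have s: "s \<ge> 1 / 2" unfolding abs_le_iff by linarith
  have "- ln s \<le> (1 - s) / s"
    using ln_le_minus_one[of "1 / s"] assms by (simp add: ln_div field_simps)
  also have "(1 - s) / s \<le> 2 * \<bar>s - 1\<bar>"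
  proof -
    have "(1 - s) \<le> \<bar>s - 1\<bar> * 1" by simp
    also have "\<dots> \<le> \<bar>s - 1\<bar> * (2 * s)" using s by (intro mult_left_mono) auto
    finally show ?thesis using assms by (simp add: divide_le_eq ac_simps)
  qed
  finally have 1: "- ln s \<le> 2 * \<bar>s - 1\<bar>" .
  have "ln s \<le> \<bar>s - 1\<bar>" by (rule order_trans[OF ln_le_minus_one[OF assms] abs_ge_self])
  also have "\<bar>s - 1\<bar> \<le> 2 * \<bar>s - 1\<bar>" by simp
  finally have 2: "ln s \<le> 2 * \<bar>s - 1\<bar>" .
  from 1 2 have "\<bar>ln s\<bar> \<le> 2 * \<bar>s - 1\<bar>" by (intro abs_leI)
  also have "\<dots> \<le> 2 * \<bar>s - 1\<bar> * (\<bar>ln s\<bar> + 1)" by (simp add: mult_le_cancel_left1)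
  finally show ?thesis .
next
  case False
  then have "1 * (\<bar>ln s\<bar> + 1) \<le> (2 * \<bar>s - 1\<bar>) * (\<bar>ln s\<bar> + 1)" by (intro mult_right_mono) auto
  moreover have "\<bar>ln s\<bar> \<le> 1 * (\<bar>ln s\<bar> + 1)" by simp
  ultimately show ?thesis by (rule order_trans[rotated])
qed

lemma log_kernel_log_laplacian:
  fixes f :: "'a::euclidean_space \<Rightarrow> complex"
  assumes d: "DIM('a) \<in> {1, 2}" and f: "f \<in> lizorkin"
  shows "(LINT x|lborel. log_kernel x * log_laplacian f x) = f 0"
proof -
  let ?g = "log_laplacian f"
  have gL: "?g \<in> lizorkin" and G: "\<And>\<xi>. fourier ?g \<xi> = of_real (ln (\<xi> \<bullet> \<xi>)) * fourier f \<xi>"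
    using log_laplacian[OF f] by auto
  have fS: "f \<in> schwartz" and gS: "?g \<in> schwartz" using f gL by (auto simp: lizorkin_def)
  have Fi: "integrable lborel (fourier f)" and Gi: "integrable lborel (fourier ?g)"
    by (intro schwartz_integrable fourier_schwartz fS gS)+
  have [measurable]: "fourier f \<in> borel_measurable borel" "fourier ?g \<in> borel_measurable borel"
    using Fi Gi by auto
  have int: "integrable lborel (\<lambda>\<xi>. fourier ?g \<xi> / of_real (\<xi> \<bullet> \<xi> - 1))"
  proof (rule Bochner_Integration.integrable_bound)
    show "integrable lborel (\<lambda>\<xi>. 2 * (norm (fourier ?g \<xi>) + norm (fourier f \<xi>)))" using Fi Gi by simp
    show "AE \<xi> in lborel. norm (fourier ?g \<xi> / of_real (\<xi> \<bullet> \<xi> - 1)) \<le> norm (2 * (norm (fourier ?g \<xi>) + norm (fourier f \<xi>)))"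
      using lborel_AE_not_unit_sphere lborel_AE_nonzero
    proof eventually_elim
      case (elim \<xi>)
      define s where "s = \<xi> \<bullet> \<xi>"
      have s: "s > 0" "\<bar>s - 1\<bar> > 0" using elim by (auto simp: s_def)
      have "\<bar>ln s\<bar> / \<bar>s - 1\<bar> \<le> 2 * (\<bar>ln s\<bar> + 1)"
        unfolding pos_divide_le_eq[OF s(2)] using abs_ln_le_near_one[OF s(1)] by (simp only: ac_simps)
      from mult_right_mono[OF this norm_ge_zero[of "fourier f \<xi>"]]
      have "\<bar>ln s\<bar> * norm (fourier f \<xi>) / \<bar>s - 1\<bar> \<le> 2 * (\<bar>ln s\<bar> * norm (fourier f \<xi>) + norm (fourier f \<xi>))"
        by (simp add: algebra_simps)
      then have "norm (fourier ?g \<xi> / of_real (\<xi> \<bullet> \<xi> - 1)) \<le> 2 * (norm (fourier ?g \<xi>) + norm (fourier f \<xi>))"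
        unfolding G norm_divide norm_mult norm_of_real s_def .
      also have "\<dots> \<le> norm (2 * (norm (fourier ?g \<xi>) + norm (fourier f \<xi>)))" by simp
      finally show ?case .
    qed
  qed measurable
  have "(2 * pi) ^ DIM('a) * (LINT x|lborel. log_kernel x * ?g x) = (LINT \<xi>|lborel. fourier ?g \<xi> / of_real (ln (\<xi> \<bullet> \<xi>)))"
    by (rule log_kernel_pairing[OF d gS int])
  also have "\<dots> = (LINT \<xi>|lborel. fourier f \<xi>)"
  proof (rule integral_cong_AE)
    show "AE \<xi> in lborel. fourier ?g \<xi> / of_real (ln (\<xi> \<bullet> \<xi>)) = fourier f \<xi>"
      using lborel_AE_not_unit_sphere lborel_AE_nonzero
    proof eventually_elim
      case (elim \<xi>)
      then have "ln (\<xi> \<bullet> \<xi>) \<noteq> 0" using ln_eq_zero_iff[of "\<xi> \<bullet> \<xi>"] by simp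
      then show ?case by (simp add: G)
    qed
  qed measurable
  also have "\<dots> = fourier (fourier f) 0" by (simp add: fourier_def[of "fourier f"])
  also have "\<dots> = (2 * pi) ^ DIM('a) * f 0" using fourier_inversion[OF fS, of 0] by simp
  finally show ?thesis by simp
qed

lemma test_functions_schwartz:
  assumes "f \<in> test_functions S"
  shows "f \<in> schwartz"
proof -
  let ?K = "closure {x. f x \<noteq> 0}"
  have sm: "smooth f" and K: "compact ?K" using assms by (auto simp: test_functions_def)
  have zero: "\<forall>x. x \<notin> ?K \<longrightarrow> partial_deriv bs f x = 0" if "bs \<in> lists Basis" for bs
    using that
  proof (induction bs)
    case Nil
    have "{x. f x \<noteq> 0} \<subseteq> ?K" by (rule closure_subset)
    then show ?case by auto
  next
    case (Cons b bs)
    then have IH: "\<And>x. x \<notin> ?K \<Longrightarrow> partial_deriv bs f x = 0" by auto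
    show ?case
    proof (intro allI impI)
      fix x assume x: "x \<notin> ?K"
      have "(partial_deriv bs f has_derivative (\<lambda>_. 0)) (at x)"
        by (rule has_derivative_transform_within_open[of "\<lambda>_. 0" _ _ _ "- ?K"]) (use x IH in auto)
      from frechet_derivative_at[OF this, symmetric] show "partial_deriv (b # bs) f x = 0" by simp
    qed
  qed
  have "bounded (range (\<lambda>x. norm x ^ k *\<^sub>R partial_deriv bs f x))" if bs: "bs \<in> lists Basis" for k bs
  proof -
    have "continuous_on ?K (\<lambda>x. norm x ^ k *\<^sub>R partial_deriv bs f x)"
    proof (intro continuous_intros continuous_at_imp_continuous_on ballI)
      fix x show "isCont (partial_deriv bs f) x"
        using sm bs unfolding smooth_def by (intro differentiable_imp_continuous_within) blast
    qed
    then have "bounded ((\<lambda>x. norm x ^ k *\<^sub>R partial_deriv bs f x) ` ?K)"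
      using K compact_continuous_image compact_imp_bounded by blast
    then have "bounded (insert 0 ((\<lambda>x. norm x ^ k *\<^sub>R partial_deriv bs f x) ` ?K))" by simp
    moreover have "range (\<lambda>x. norm x ^ k *\<^sub>R partial_deriv bs f x) \<subseteq> insert 0 ((\<lambda>x. norm x ^ k *\<^sub>R partial_deriv bs f x) ` ?K)"
      using zero[OF bs] by auto
    ultimately show ?thesis by (rule bounded_subset)
  qed
  then show ?thesis using sm by (simp add: schwartz_def)
qed

lemma test_functions_vanish: "f \<in> test_functions S \<Longrightarrow> x \<notin> S \<Longrightarrow> f x = 0"
  using closure_subset[of "{x. f x \<noteq> 0}"] by (auto simp: test_functions_def)

lemma integral_test_function_restrict:
  fixes f h :: "'a::euclidean_space \<Rightarrow> complex"
  assumes f: "f \<in> test_functions S" and [measurable]: "h \<in> borel_measurable borel"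
  shows "(LINT x|lborel. h x * f x) = (LINT x:S|lebesgue. h x * f x)"
proof -
  note [measurable] = schwartz_borel_measurable[OF test_functions_schwartz[OF f]]
  have "(LINT x|lborel. h x * f x) = (LINT x|lebesgue. h x * f x)"
    by (rule integral_completion[symmetric]) measurable
  also have "\<dots> = (LINT x:S|lebesgue. h x * f x)"
    unfolding set_lebesgue_integral_def
    by (intro Bochner_Integration.integral_cong refl) (auto simp: indicator_def test_functions_vanish[OF f])
  finally show ?thesis .
qed

lemma locally_integrable_onI:
  fixes h :: "'a::euclidean_space \<Rightarrow> complex"
  assumes [measurable]: "h \<in> borel_measurable borel" and bound: "\<And>x. x \<in> S \<Longrightarrow> norm (h x) \<le> M"
  shows "locally_integrable_on h S"
  unfolding locally_integrable_on_def
proof (intro allI impI)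
  fix K assume K: "compact K \<and> K \<subseteq> S"
  have [measurable]: "K \<in> sets borel" using K borel_compact by blast
  have fin: "emeasure lborel K < \<infinity>" using K emeasure_bounded_finite compact_imp_bounded by blast
  have "integrable lborel (\<lambda>x. indicator K x *\<^sub>R h x)"
  proof (rule Bochner_Integration.integrable_bound[of lborel "\<lambda>x. indicator K x *\<^sub>R M"])
    show "integrable lborel (\<lambda>x. indicator K x *\<^sub>R M)" using fin by simp
    show "AE x in lborel. norm (indicator K x *\<^sub>R h x) \<le> norm (indicator K x *\<^sub>R M)"
      using bound K by (intro AE_I2) (auto simp: indicator_def intro: order_trans[OF _ abs_ge_self])
  qed measurable
  then show "h absolutely_integrable_on K"
    unfolding set_integrable_def by (subst integrable_completion) measurable
qed

text \<open>
  On the ball of radius \<open>1 / 2\<close> one stays away from the unit sphere, so that the division by \<open>s - 1\<close> costs at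
  most a factor \<open>2\<close>.
\<close>

lemma fourier_log_kernel:
  fixes f :: "'a::euclidean_space \<Rightarrow> complex"
  assumes d: "DIM('a) \<in> {1, 2}" and f: "f \<in> test_functions (ball 0 (1 / 2))"
  shows "(LINT x|lborel. log_kernel x * fourier f x) = (LINT \<xi>|lborel. 1 / of_real (ln (\<xi> \<bullet> \<xi>)) * f \<xi>)"
proof -
  have fS: "f \<in> schwartz" by (rule test_functions_schwartz[OF f])
  note [measurable] = schwartz_borel_measurable[OF fS]
  have FS: "fourier f \<in> schwartz" by (rule fourier_schwartz[OF fS])
  have Gi: "integrable lborel (fourier (fourier f))" by (intro schwartz_integrable fourier_schwartz fS)
  have [measurable]: "fourier (fourier f) \<in> borel_measurable borel" using Gi by simp
  have G: "fourier (fourier f) \<xi> = (2 * pi) ^ DIM('a) * f (- \<xi>)" for \<xi> by (rule fourier_inversion[OF fS])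
  have int: "integrable lborel (\<lambda>\<xi>. fourier (fourier f) \<xi> / of_real (\<xi> \<bullet> \<xi> - 1))"
  proof (rule Bochner_Integration.integrable_bound)
    show "integrable lborel (\<lambda>\<xi>. 2 * norm (fourier (fourier f) \<xi>))" using Gi by simp
    have "norm (fourier (fourier f) \<xi> / of_real (\<xi> \<bullet> \<xi> - 1)) \<le> 2 * norm (fourier (fourier f) \<xi>)" for \<xi>
    proof (cases "norm \<xi> < 1 / 2")
      case True
      then have "(norm \<xi>)\<^sup>2 \<le> (1 / 2)\<^sup>2" by (intro power_mono) auto
      then have "\<bar>\<xi> \<bullet> \<xi> - 1\<bar> \<ge> 1 / 2" by (simp add: dot_square_norm power2_eq_square)
      then have "norm (fourier (fourier f) \<xi>) / \<bar>\<xi> \<bullet> \<xi> - 1\<bar> \<le> norm (fourier (fourier f) \<xi>) / (1 / 2)"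
        by (intro divide_left_mono) auto
      then show ?thesis unfolding norm_divide norm_of_real by simp
    next
      case False
      then have "f (- \<xi>) = 0" by (intro test_functions_vanish[OF f]) simp
      then show ?thesis by (simp add: G)
    qed
    then show "AE \<xi> in lborel. norm (fourier (fourier f) \<xi> / of_real (\<xi> \<bullet> \<xi> - 1)) \<le> norm (2 * norm (fourier (fourier f) \<xi>))"
      by (intro AE_I2) simp
  qed measurable
  have "(2 * pi) ^ DIM('a) * (LINT x|lborel. log_kernel x * fourier f x) = (LINT \<xi>|lborel. fourier (fourier f) \<xi> / of_real (ln (\<xi> \<bullet> \<xi>)))"
    by (rule log_kernel_pairing[OF d FS int])
  also have "\<dots> = (LINT \<xi>|lborel. (2 * pi) ^ DIM('a) * (1 / of_real (ln (\<xi> \<bullet> \<xi>)) * f (- \<xi>)))"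
    unfolding G by simp
  also have "\<dots> = (2 * pi) ^ DIM('a) * (LINT \<xi>|lborel. 1 / of_real (ln (\<xi> \<bullet> \<xi>)) * f (- \<xi>))"
    by (rule integral_mult_right_zero)
  also have "(LINT \<xi>|lborel. 1 / of_real (ln (\<xi> \<bullet> \<xi>)) * f (- \<xi>)) = (LINT \<xi>|lborel. 1 / of_real (ln (\<xi> \<bullet> \<xi>)) * f \<xi>)"
    using lborel_integral_affine[of "\<lambda>\<xi>. 1 / of_real (ln (\<xi> \<bullet> \<xi>)) * f \<xi>" "-1" 0] by simp
  finally show ?thesis by simp
qed

text \<open>
  The Helmholtz part decays exactly at the stated rate, and the other part is \<open>O(|x|\<^sup>-\<^sup>d)\<close>, which is
  smaller.
\<close>

lemma log_kernel_far_bound: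
  fixes x :: "'a::euclidean_space"
  assumes d: "DIM('a) \<in> {1, 2}" and x: "norm x \<ge> 2"
  shows "norm (log_kernel x) \<le> (2 + (LINT \<sigma>|lborel. log_density \<sigma>) * real DIM('a) ^ DIM('a)) * norm x powr (- ((real DIM('a) - 1) / 2))"
proof -
  define a where "a = (real DIM('a) - 1) / 2"
  have x0: "norm x > 0" "x \<noteq> 0" using x by auto
  have I: "0 \<le> (LINT \<sigma>|lborel. log_density \<sigma>)" by (simp add: log_density_nonneg)
  have 1: "norm (helmholtz_kernel DIM('a) (- \<i>) (norm x)) \<le> 2 * norm x powr (- a)"
    unfolding a_def by (intro helmholtz_kernel_bound[OF d]) (use x0 in auto)
  have "(1 / norm x) ^ DIM('a) = norm x powr (- real DIM('a))"
    using x0 by (simp add: powr_minus powr_realpow power_one_over inverse_eq_divide)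
  also have "\<dots> \<le> norm x powr (- a)"
    using x d by (intro powr_mono) (auto simp: a_def)
  finally have p: "(1 / norm x) ^ DIM('a) \<le> norm x powr (- a)" .
  have "norm (of_real (gaussian_mixture log_density x) :: complex) \<le> (LINT \<sigma>|lborel. log_density \<sigma>) * (real DIM('a) ^ DIM('a) * (1 / norm x) ^ DIM('a))"
    using gaussian_mixture_bound[OF log_density_integrable log_density_nonpos x0(2)] by (simp add: log_density_nonneg)
  also have "\<dots> \<le> (LINT \<sigma>|lborel. log_density \<sigma>) * (real DIM('a) ^ DIM('a) * norm x powr (- a))"
    by (intro mult_left_mono p I) auto
  finally have 2: "norm (of_real (gaussian_mixture log_density x) :: complex) \<le> (LINT \<sigma>|lborel. log_density \<sigma>) * (real DIM('a) ^ DIM('a) * norm x powr (- a))" .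
  have "norm (log_kernel x) \<le> norm (helmholtz_kernel DIM('a) (- \<i>) (norm x)) + norm (of_real (gaussian_mixture log_density x) :: complex)"
    unfolding log_kernel_def by (rule norm_triangle_ineq)
  also have "\<dots> \<le> (2 + (LINT \<sigma>|lborel. log_density \<sigma>) * real DIM('a) ^ DIM('a)) * norm x powr (- a)"
    using 1 2 by (simp add: algebra_simps)
  finally show ?thesis by (simp only: a_def)
qed

lemma log_kernel_radial:
  fixes x y :: "'a::euclidean_space"
  shows "norm x = norm y \<Longrightarrow> log_kernel x = log_kernel y"
  by (simp add: log_kernel_def gaussian_mixture_def heat_kernel_def dot_square_norm)

lemma log_kernel_weight_integrable:
  assumes d: "DIM('a::euclidean_space) \<in> {1, 2}"
  shows "integrable lborel (\<lambda>x::'a. norm (log_kernel x) / (1 + (norm x)\<^sup>2) ^ DIM('a))"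
proof (rule Bochner_Integration.integrable_bound)
  let ?B = "\<lambda>x::'a. 2 * (norm x powr (- ((real DIM('a) - 1) / 2)) / (1 + (norm x)\<^sup>2) ^ DIM('a)) + \<bar>gaussian_mixture log_density x\<bar>"
  have "0 \<le> (real DIM('a) - 1) / 2" "(real DIM('a) - 1) / 2 < DIM('a)"
    using d by auto
  from integrable_radial_weight[OF this]
  show "integrable lborel ?B"
    using log_mixture_integrable[where 'a = 'a] by (intro Bochner_Integration.integrable_add integrable_mult_right integrable_abs)
  show "AE x in lborel. norm (norm (log_kernel x) / (1 + (norm x)\<^sup>2) ^ DIM('a)) \<le> norm (?B x)"
    using lborel_AE_nonzero
  proof eventually_elim
    case (elim x)
    define W where "W = (1 + (norm x)\<^sup>2) ^ DIM('a)"
    have W: "W \<ge> 1" unfolding W_def by (intro one_le_power) simp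
    have "norm (log_kernel x) \<le> norm (helmholtz_kernel DIM('a) (- \<i>) (norm x)) + \<bar>gaussian_mixture log_density x\<bar>"
      unfolding log_kernel_def by (rule order_trans[OF norm_triangle_ineq]) simp
    also have "\<dots> \<le> 2 * norm x powr (- ((real DIM('a) - 1) / 2)) + \<bar>gaussian_mixture log_density x\<bar>"
      by (intro add_right_mono helmholtz_kernel_bound[OF d]) (use elim in auto)
    finally have "norm (log_kernel x) / W \<le> (2 * norm x powr (- ((real DIM('a) - 1) / 2)) + \<bar>gaussian_mixture log_density x\<bar>) / W"
      using W by (intro divide_right_mono) auto
    also have "\<dots> \<le> 2 * (norm x powr (- ((real DIM('a) - 1) / 2)) / W) + \<bar>gaussian_mixture log_density x\<bar>"
    proof -
      have "\<bar>gaussian_mixture log_density x\<bar> / W \<le> \<bar>gaussian_mixture log_density x\<bar> / 1"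
        using W by (intro divide_left_mono) auto
      then show ?thesis by (simp add: add_divide_distrib)
    qed
    finally show ?case
      using W unfolding W_def[symmetric] by simp
  qed
qed measurable

lemma schwartz_seminorm_upper:
  assumes "f \<in> schwartz"
  shows "norm x ^ k * norm (f x) \<le> schwartz_seminorm k [] f"
proof -
  obtain C where C: "\<And>x. norm x ^ k * norm (f x) \<le> C" using schwartz_decay[OF assms] by blast
  have "norm (norm x ^ k *\<^sub>R partial_deriv [] f x) \<le> (SUP x. norm (norm x ^ k *\<^sub>R partial_deriv [] f x))"
    by (rule cSUP_upper) (use C in \<open>auto intro!: bdd_aboveI2[of _ _ C]\<close>)
  then show ?thesis by (simp add: schwartz_seminorm_def)
qed

lemma schwartz_diff: "f \<in> schwartz \<Longrightarrow> g \<in> schwartz \<Longrightarrow> (\<lambda>x. f x - g x) \<in> schwartz"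
  using schwartz_lincomb[of g f "-1"] by (simp add: algebra_simps)

text \<open>
  Continuity with respect to the topology generated by seminorm balls follows, by linearity, from a bound
  by finitely many seminorms; the two undifferentiated ones suffice for functionals given by integration
  against a function.
\<close>

lemma tempered_distributionI:
  fixes T :: "('a::euclidean_space \<Rightarrow> complex) \<Rightarrow> complex"
  assumes add: "\<And>f g. f \<in> schwartz \<Longrightarrow> g \<in> schwartz \<Longrightarrow> T (\<lambda>x. f x + g x) = T f + T g"
    and scale: "\<And>c f. f \<in> schwartz \<Longrightarrow> T (\<lambda>x. c * f x) = c * T f"
    and bound: "\<And>f. f \<in> schwartz \<Longrightarrow> norm (T f) \<le> A * (schwartz_seminorm 0 [] f + schwartz_seminorm k [] f)"
    and A: "A > 0"
  shows "T \<in> tempered_distributions"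
proof -
  have diff: "T (\<lambda>x. g x - f x) = T g - T f" if "f \<in> schwartz" "g \<in> schwartz" for f g
    using add[OF that(2) schwartz_scale[OF that(1), of "-1"]] scale[OF that(1), of "-1"] by simp
  have "continuous_map schwartz_topology euclidean T"
    unfolding continuous_map_def
  proof (intro conjI allI impI)
    fix U :: "complex set" assume "openin euclidean U"
    then have U: "open U" by simp
    show "openin schwartz_topology {f \<in> topspace schwartz_topology. T f \<in> U}"
    proof (subst openin_subopen, intro ballI)
      fix f assume "f \<in> {f \<in> topspace schwartz_topology. T f \<in> U}"
      then have f: "f \<in> schwartz" and TU: "T f \<in> U" by (auto simp: topspace_schwartz_topology)
      obtain e where e: "e > 0" "ball (T f) e \<subseteq> U" using U TU open_contains_ball by blast
      define \<delta> where "\<delta> = e / (2 * A)"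
      have \<delta>: "\<delta> > 0" using e A by (simp add: \<delta>_def)
      define V where "V j = {g \<in> schwartz. schwartz_seminorm j [] (\<lambda>x. g x - f x) < \<delta>}" for j
      have openV: "openin schwartz_topology (V j)" for j
        unfolding schwartz_topology_def V_def
      proof (rule topology_generated_by_Basis, unfold mem_Collect_eq, intro exI conjI)
        show "[] \<in> lists Basis" by simp
      qed (use f \<delta> in auto)
      have fV: "f \<in> V j" for j using f \<delta> by (simp add: V_def schwartz_seminorm_def)
      have "V 0 \<inter> V k \<subseteq> {f \<in> topspace schwartz_topology. T f \<in> U}"
      proof
        fix g assume g: "g \<in> V 0 \<inter> V k"
        then have gS: "g \<in> schwartz" by (simp add: V_def)
        have "norm (T g - T f) \<le> A * (schwartz_seminorm 0 [] (\<lambda>x. g x - f x) + schwartz_seminorm k [] (\<lambda>x. g x - f x))"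
          using bound[OF schwartz_diff[OF gS f]] diff[OF f gS] by simp
        also have "\<dots> < A * (\<delta> + \<delta>)"
          using g A by (intro mult_strict_left_mono add_strict_mono) (auto simp: V_def)
        also have "\<dots> = e" using A by (simp add: \<delta>_def)
        finally have "T g \<in> ball (T f) e" by (simp add: dist_norm norm_minus_commute)
        then show "g \<in> {f \<in> topspace schwartz_topology. T f \<in> U}"
          using e gS by (auto simp: topspace_schwartz_topology)
      qed
      then show "\<exists>V. openin schwartz_topology V \<and> f \<in> V \<and> V \<subseteq> {f \<in> topspace schwartz_topology. T f \<in> U}"
        using openV fV by (intro exI[of _ "V 0 \<inter> V k"] conjI openin_Int) auto
    qed
  qed simp
  then show ?thesis
    using add scale by (simp add: continuous_dual_def topspace_schwartz_topology)
qed

definition log_fundamental :: "('a::euclidean_space \<Rightarrow> complex) \<Rightarrow> complex" where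
  "log_fundamental f = (LINT x|lborel. log_kernel x * f x)"

lemma log_fundamental_tempered:
  assumes d: "DIM('a::euclidean_space) \<in> {1, 2}"
  shows "(log_fundamental :: ('a \<Rightarrow> complex) \<Rightarrow> complex) \<in> tempered_distributions"
proof (rule tempered_distributionI)
  let ?I = "LINT x::'a|lborel. norm (log_kernel x) / (1 + (norm x)\<^sup>2) ^ DIM('a)"
  fix f :: "'a \<Rightarrow> complex" assume f: "f \<in> schwartz"
  show "log_fundamental (\<lambda>x. f x + g x) = log_fundamental f + log_fundamental g" if g: "g \<in> schwartz" for g
    unfolding log_fundamental_def distrib_left
    by (rule Bochner_Integration.integral_add) (intro log_kernel_mult_integrable(3)[OF d] f g)+
  show "log_fundamental (\<lambda>x. c * f x) = c * log_fundamental f" for c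
    unfolding log_fundamental_def mult.left_commute[of _ c] by (rule integral_mult_right_zero)
  let ?p = "schwartz_seminorm 0 [] f + schwartz_seminorm (2 * DIM('a)) [] f"
  have "norm (log_fundamental f) \<le> (LINT x::'a|lborel. norm (log_kernel x) / (1 + (norm x)\<^sup>2) ^ DIM('a) * (2 ^ DIM('a) * ?p))"
    unfolding log_fundamental_def
  proof (rule Bochner_Integration.integral_norm_bound_integral)
    show "integrable lborel (\<lambda>x. log_kernel x * f x)" by (rule log_kernel_mult_integrable(3)[OF d f])
    show "integrable lborel (\<lambda>x::'a. norm (log_kernel x) / (1 + (norm x)\<^sup>2) ^ DIM('a) * (2 ^ DIM('a) * ?p))"
      by (intro integrable_mult_left log_kernel_weight_integrable[OF d])
    fix x :: 'a
    define W where "W = (1 + (norm x)\<^sup>2) ^ DIM('a)"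
    have W: "W > 0" by (simp add: W_def add_pos_nonneg)
    have "W \<le> 2 ^ DIM('a) * (1 + norm x ^ (2 * DIM('a)))"
    proof (cases "norm x \<le> 1")
      case True
      then have "(norm x)\<^sup>2 \<le> 1" by (simp add: power_le_one)
      then have "W \<le> 2 ^ DIM('a)" unfolding W_def by (intro power_mono) auto
      also have "\<dots> \<le> 2 ^ DIM('a) * (1 + norm x ^ (2 * DIM('a)))" by (simp add: mult_le_cancel_left1)
      finally show ?thesis .
    next
      case False
      then have "1 \<le> (norm x)\<^sup>2" by (simp add: one_le_power)
      then have "W \<le> (2 * (norm x)\<^sup>2) ^ DIM('a)" unfolding W_def by (intro power_mono) auto
      also have "\<dots> = 2 ^ DIM('a) * norm x ^ (2 * DIM('a))" by (simp add: power_mult_distrib power_mult)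
      also have "\<dots> \<le> 2 ^ DIM('a) * (1 + norm x ^ (2 * DIM('a)))" by simp
      finally show ?thesis .
    qed
    then have "W * norm (f x) \<le> 2 ^ DIM('a) * (1 + norm x ^ (2 * DIM('a))) * norm (f x)" by (intro mult_right_mono) auto
    also have "\<dots> = 2 ^ DIM('a) * (norm x ^ 0 * norm (f x) + norm x ^ (2 * DIM('a)) * norm (f x))" by (simp add: algebra_simps)
    also have "\<dots> \<le> 2 ^ DIM('a) * ?p"
      by (intro mult_left_mono add_mono schwartz_seminorm_upper f) auto
    finally have Wf: "W * norm (f x) \<le> 2 ^ DIM('a) * ?p" .
    have "norm (log_kernel x * f x) = norm (log_kernel x) / W * (W * norm (f x))"
      using W by (simp add: norm_mult)
    also have "\<dots> \<le> norm (log_kernel x) / W * (2 ^ DIM('a) * ?p)"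
      using W by (intro mult_left_mono Wf) auto
    finally show "norm (log_kernel x * f x) \<le> norm (log_kernel x) / (1 + (norm x)\<^sup>2) ^ DIM('a) * (2 ^ DIM('a) * ?p)"
      by (simp only: W_def)
  qed
  also have "\<dots> = ?I * 2 ^ DIM('a) * ?p" by (simp only: integral_mult_left_zero mult.assoc)
  also have "\<dots> \<le> (?I * 2 ^ DIM('a) + 1) * ?p"
  proof (intro mult_right_mono)
    have "0 \<le> schwartz_seminorm j [] f" for j
      by (rule order_trans[OF _ schwartz_seminorm_upper[OF f, of 0 j]]) simp
    then show "0 \<le> ?p" by (intro add_nonneg_nonneg)
  qed simp
  finally show "norm (log_fundamental f) \<le> (?I * 2 ^ DIM('a) + 1) * ?p" .
next
  have "0 \<le> (LINT x::'a|lborel. norm (log_kernel x) / (1 + (norm x)\<^sup>2) ^ DIM('a))"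
    by (intro Bochner_Integration.integral_nonneg) (simp add: zero_le_power add_nonneg_nonneg)
  then show "0 < (LINT x::'a|lborel. norm (log_kernel x) / (1 + (norm x)\<^sup>2) ^ DIM('a)) * 2 ^ DIM('a) + 1"
    by (simp add: add_nonneg_pos)
qed

lemma tempered_imp_lizorkin_dual:
  assumes "T \<in> tempered_distributions"
  shows "T \<in> lizorkin_dual"
proof -
  have sub: "lizorkin \<subseteq> schwartz" by (auto simp: lizorkin_def)
  then have "topspace lizorkin_topology = lizorkin"
    by (auto simp: lizorkin_topology_def topspace_schwartz_topology)
  then show ?thesis
    using assms sub unfolding continuous_dual_def
    by (auto simp: topspace_schwartz_topology lizorkin_topology_def intro: continuous_map_from_subtopology)
qed

theorem theorem3:
  assumes "CARD('n::finite) \<in> {1, 2}"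
  shows "\<exists>(u :: (real ^ 'n \<Rightarrow> complex) \<Rightarrow> complex) E g.
    fundamental_solution u \<and> representative u E \<and>
    coincides_on E g {x. norm x \<ge> 2} \<and> radial_on g {x. norm x \<ge> 2} \<and>
    (\<exists>C > 0. \<forall>x. norm x \<ge> 2 \<longrightarrow>
       norm (g x) \<le> C * norm x powr (- ((real CARD('n) - 1) / 2)))"
proof -
  let ?E = "log_fundamental :: (real ^ 'n \<Rightarrow> complex) \<Rightarrow> complex"
  let ?g = "log_kernel :: real ^ 'n \<Rightarrow> complex"
  have d: "DIM(real ^ 'n) \<in> {1, 2}" using assms by simp
  define C where "C = 2 + (LINT \<sigma>|lborel. log_density \<sigma>) * real CARD('n) ^ CARD('n)"
  have "0 \<le> (LINT \<sigma>|lborel. log_density \<sigma>)" by (simp add: log_density_nonneg)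
  then have C: "C > 0" unfolding C_def by (intro add_pos_nonneg) auto
  have far: "norm (?g x) \<le> C * norm x powr (- ((real CARD('n) - 1) / 2))" if "norm x \<ge> 2" for x
    using log_kernel_far_bound[OF d that] by (simp add: C_def)
  \<comment> \<open>one total function serves as the distribution and as its restriction to the Lizorkin space\<close>
  have E: "?E \<in> tempered_distributions" by (rule log_fundamental_tempered[OF d])
  have fs: "fundamental_solution ?E"
    unfolding fundamental_solution_def log_laplacian_dist_def log_fundamental_def[of "log_laplacian _"]
    using tempered_imp_lizorkin_dual[OF E] log_kernel_log_laplacian[OF d] by blast
  have coincides: "coincides_on ?E ?g {x. norm x \<ge> 2}"
    unfolding coincides_on_def
  proof (intro conjI ballI)
    show "locally_integrable_on ?g {x. norm x \<ge> 2}"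
    proof (rule locally_integrable_onI)
      fix x :: "real ^ 'n" assume "x \<in> {x. norm x \<ge> 2}"
      then have x: "norm x \<ge> 2" by simp
      then have "x \<noteq> 0" by auto
      have "norm x powr (- ((real CARD('n) - 1) / 2)) \<le> norm x powr 0"
        using x assms by (intro powr_mono) auto
      then have "C * norm x powr (- ((real CARD('n) - 1) / 2)) \<le> C * 1"
        using C \<open>x \<noteq> 0\<close> by (intro mult_left_mono) auto
      with far[OF x] show "norm (?g x) \<le> C" by simp
    qed measurable
    show "?E f = (LINT x:{x. norm x \<ge> 2}|lebesgue. ?g x * f x)" if "f \<in> test_functions {x. norm x \<ge> 2}" for f
      unfolding log_fundamental_def by (rule integral_test_function_restrict[OF that]) measurable
  qed
  have fourier_near_0: "coincides_on (fourier_dist ?E) (\<lambda>\<xi>. 1 / of_real (ln (\<xi> \<bullet> \<xi>))) (ball 0 (1 / 2))"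
    unfolding coincides_on_def
  proof (intro conjI ballI)
    show "locally_integrable_on (\<lambda>\<xi>::real ^ 'n. 1 / of_real (ln (\<xi> \<bullet> \<xi>))) (ball 0 (1 / 2))"
    proof (rule locally_integrable_onI)
      fix \<xi> :: "real ^ 'n" assume "\<xi> \<in> ball 0 (1 / 2)"
      then have "norm \<xi> \<le> 1 / 2" by simp
      then have "(norm \<xi>)\<^sup>2 \<le> (1 / 2)\<^sup>2" by (intro power_mono) auto
      then have s: "\<xi> \<bullet> \<xi> \<le> 1 / 4" by (simp add: dot_square_norm power2_eq_square)
      show "norm (1 / complex_of_real (ln (\<xi> \<bullet> \<xi>))) \<le> 2"
      proof (cases "\<xi> = 0")
        case False
        then have "ln (\<xi> \<bullet> \<xi>) \<le> \<xi> \<bullet> \<xi> - 1" by (intro ln_le_minus_one) simp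
        then have "\<bar>ln (\<xi> \<bullet> \<xi>)\<bar> \<ge> 1 / 2" using s by linarith
        then show ?thesis unfolding norm_divide norm_of_real by (simp add: divide_le_eq)
      qed simp
    qed measurable
    show "fourier_dist ?E f = (LINT \<xi>:ball 0 (1 / 2)|lebesgue. 1 / of_real (ln (\<xi> \<bullet> \<xi>)) * f \<xi>)"
      if f: "f \<in> test_functions (ball 0 (1 / 2))" for f
    proof -
      have [measurable]: "(\<lambda>\<xi>::real ^ 'n. 1 / complex_of_real (ln (\<xi> \<bullet> \<xi>))) \<in> borel_measurable borel" by measurable
      show ?thesis
        unfolding fourier_dist_def log_fundamental_def fourier_log_kernel[OF d f]
        by (rule integral_test_function_restrict[OF f]) measurable
    qed
  qed
  have "\<exists>r>0. \<exists>h. coincides_on (fourier_dist ?E) h (ball 0 r)"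
    using fourier_near_0 by (intro exI[of _ "1 / 2"] conjI) auto
  then have rep: "representative ?E ?E"
    unfolding representative_def using E by blast
  have radial: "radial_on ?g {x. norm x \<ge> 2}"
    unfolding radial_on_def using log_kernel_radial by blast
  show ?thesis
    using fs rep coincides radial C far by blast
qed

end
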